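(* Let $F\in\mathcal{C}^\infty(\mathbb{R}^d,\mathbb{R}^d)$ and let $\mathcal{O}\subset\mathbb{R}^d$ be a bounded, connected open set of class $\mathcal{C}^2$, $D=\mathcal{O}\times\mathbb{R}^d$. Let $u\in\mathcal{C}^{1,2}(\mathbb{R}_+^*\times D)$ be such that $\partial_tu-\mathcal{L}u\le0$ on $\mathbb{R}_+^*\times D$. (i) If $u\in\mathcal{C}^b\big((\mathbb{R}_+\times(D\cup\Gamma^+))\setminus(\{0\}\times\Gamma^+)\big)$, then $$\sup_{\mathbb{R}_+^*\times D}u(t,x)=\sup_{(\{0\}\times D)\cup(\mathbb{R}_+^*\times\Gamma^+)}u(t,x).$$ (ii) If $u$ attains its maximum (over $\mathbb{R}_+^*\times D$) at a point $(t_0,x_0)\in\mathbb{R}_+^*\times D$, then $$\forall t\le t_0\ (t>0),\ \forall x\in D,\qquad u(t,x)=u(t_0,x_0).$$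
   Context: Fix $d\ge1$, $\gamma\in\mathbb{R}$, $\sigma>0$. Notation: $\mathbb{R}_+^*=(0,\infty)$; $\mathcal{C}^b(A)$ is the set of bounded continuous real functions on $A$; $n(q)$ is the unit outward normal to $\mathcal{O}$ at $q\in\partial\mathcal{O}$; $\Gamma^+=\{(q,p)\in\partial\mathcal{O}\times\mathbb{R}^d: p\cdot n(q)>0\}$. The operator is $\mathcal{L}=p\cdot\nabla_q+F(q)\cdot\nabla_p-\gamma p\cdot\nabla_p+\frac{\sigma^2}{2}\Delta_p$ acting on functions of $x=(q,p)\in\mathbb{R}^d\times\mathbb{R}^d$. $\mathcal{C}^{1,2}(\mathbb{R}_+^*\times D)$ is the set of functions $u(t,x)$ such that $u,\partial_t u,\nabla_x u,\nabla_x^2u$ exist and are continuous on $\mathbb{R}_+^*\times D$. *)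

theory Defs
  imports "HOL-Analysis.Analysis"
begin

section \<open>Smoothness on open sets\<close>

text \<open>
  \<open>C_k_on k f S\<close>, for open \<open>S\<close>, says that \<open>f\<close> is of class \<open>C\<^sup>k\<close> on \<open>S\<close>: every directional
  derivative of \<open>f\<close> is again of class \<open>C\<^sup>k\<^sup>-\<^sup>1\<close>.
\<close>

fun C_k_on :: "nat \<Rightarrow> ('a::euclidean_space \<Rightarrow> 'b::euclidean_space) \<Rightarrow> 'a set \<Rightarrow> bool" where
  "C_k_on 0 f S \<longleftrightarrow> continuous_on S f"
| "C_k_on (Suc k) f S \<longleftrightarrow>
     (\<forall>x\<in>S. f differentiable (at x)) \<and>
     (\<forall>v. C_k_on k (\<lambda>x. frechet_derivative f (at x) v) S)"

definition C_infinity_on :: "('a::euclidean_space \<Rightarrow> 'b::euclidean_space) \<Rightarrow> 'a set \<Rightarrow> bool" where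
  "C_infinity_on f S \<longleftrightarrow> (\<forall>k. C_k_on k f S)"

section \<open>Differential operators\<close>

definition gradient :: "('a::euclidean_space \<Rightarrow> real) \<Rightarrow> 'a \<Rightarrow> 'a" where
  "gradient f x = (\<Sum>b\<in>Basis. frechet_derivative f (at x) b *\<^sub>R b)"

definition laplacian :: "('a::euclidean_space \<Rightarrow> real) \<Rightarrow> 'a \<Rightarrow> real" where
  "laplacian f x = (\<Sum>b\<in>Basis. frechet_derivative (\<lambda>y. frechet_derivative f (at y) b) (at x) b)"

definition time_deriv :: "(real \<times> 'a \<Rightarrow> real) \<Rightarrow> real \<times> 'a \<Rightarrow> real" where
  "time_deriv u = (\<lambda>(t, x). deriv (\<lambda>s. u (s, x)) t)"

definition kinetic_operator ::
  "('a::euclidean_space \<Rightarrow> 'a) \<Rightarrow> real \<Rightarrow> real \<Rightarrow> ('a \<times> 'a \<Rightarrow> real) \<Rightarrow> 'a \<times> 'a \<Rightarrow> real" where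
  "kinetic_operator F \<gamma> \<sigma> f = (\<lambda>(q, p).
     p \<bullet> gradient (\<lambda>q'. f (q', p)) q
     + F q \<bullet> gradient (\<lambda>p'. f (q, p')) p
     - \<gamma> * (p \<bullet> gradient (\<lambda>p'. f (q, p')) p)
     + \<sigma>\<^sup>2 / 2 * laplacian (\<lambda>p'. f (q, p')) p)"

text \<open>
  The class \<open>C\<^sup>1\<^sup>,\<^sup>2\<close> of functions of \<open>(t, x)\<close>. Only the values of \<open>u\<close> on \<open>\<Omega>\<close> matter when \<open>\<Omega>\<close> is
  open. In the last conjunct, \<open>frechet_derivative \<dots> v\<close> is the Hessian in \<open>x\<close> applied to \<open>v\<close>.
\<close>

definition C_1_2_on :: "(real \<times> 'a::euclidean_space \<Rightarrow> real) \<Rightarrow> (real \<times> 'a) set \<Rightarrow> bool" where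
  "C_1_2_on u \<Omega> \<longleftrightarrow>
     continuous_on \<Omega> u \<and>
     (\<forall>(t, x)\<in>\<Omega>. (\<lambda>s. u (s, x)) differentiable (at t)) \<and>
     continuous_on \<Omega> (time_deriv u) \<and>
     (\<forall>(t, x)\<in>\<Omega>. (\<lambda>y. u (t, y)) differentiable (at x)) \<and>
     continuous_on \<Omega> (\<lambda>(t, x). gradient (\<lambda>y. u (t, y)) x) \<and>
     (\<forall>(t, x)\<in>\<Omega>. gradient (\<lambda>y. u (t, y)) differentiable (at x)) \<and>
     (\<forall>v. continuous_on \<Omega> (\<lambda>(t, x). frechet_derivative (gradient (\<lambda>y. u (t, y))) (at x) v))"

section \<open>Domains of class \<open>C\<^sup>2\<close> and their outward normal\<close>

text \<open>
  \<open>\<phi>\<close> is a \<open>C\<^sup>2\<close> defining function of \<open>\<O>\<close> on the neighbourhood \<open>U\<close> of the boundary point \<open>q\<close>.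
\<close>

definition C2_defining_function ::
  "'a::euclidean_space set \<Rightarrow> 'a \<Rightarrow> 'a set \<Rightarrow> ('a \<Rightarrow> real) \<Rightarrow> bool" where
  "C2_defining_function \<O> q U \<phi> \<longleftrightarrow>
     open U \<and> q \<in> U \<and> C_k_on 2 \<phi> U \<and> (\<forall>x\<in>U. gradient \<phi> x \<noteq> 0) \<and>
     \<O> \<inter> U = {x \<in> U. \<phi> x < 0} \<and> frontier \<O> \<inter> U = {x \<in> U. \<phi> x = 0}"

definition C2_domain :: "'a::euclidean_space set \<Rightarrow> bool" where
  "C2_domain \<O> \<longleftrightarrow> open \<O> \<and> (\<forall>q\<in>frontier \<O>. \<exists>U \<phi>. C2_defining_function \<O> q U \<phi>)"

text \<open>
  The normalised gradient of a defining function; it does not depend on the choice of the latter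
  by \<open>outward_normal_eq\<close> below.
\<close>

definition outward_normal :: "'a::euclidean_space set \<Rightarrow> 'a \<Rightarrow> 'a" where
  "outward_normal \<O> q =
     (THE n. \<exists>U \<phi>. C2_defining_function \<O> q U \<phi> \<and> n = sgn (gradient \<phi> q))"

definition Gamma_plus :: "'a::euclidean_space set \<Rightarrow> ('a \<times> 'a) set" where
  "Gamma_plus \<O> = {(q, p). q \<in> frontier \<O> \<and> p \<bullet> outward_normal \<O> q > 0}"

lemma frechet_derivative_eq_inner_gradient:
  assumes "f differentiable (at x)"
  shows "frechet_derivative f (at x) v = gradient f x \<bullet> v"
proof -
  have lin: "linear (frechet_derivative f (at x))"
    using assms by (rule linear_frechet_derivative)
  have "frechet_derivative f (at x) v
      = frechet_derivative f (at x) (\<Sum>b\<in>Basis. (v \<bullet> b) *\<^sub>R b)"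
    by (simp only: euclidean_representation)
  also have "\<dots> = (\<Sum>b\<in>Basis. (v \<bullet> b) * frechet_derivative f (at x) b)"
    by (simp only: linear_sum[OF lin] linear_scale[OF lin] real_scaleR_def)
  also have "\<dots> = gradient f x \<bullet> v"
    unfolding gradient_def inner_sum_left inner_scaleR_left
    by (intro sum.cong refl) (metis inner_commute mult.commute)
  finally show ?thesis .
qed

lemma C2_defining_function_along_line:
  assumes "C2_defining_function \<O> q U \<phi>" "q \<in> frontier \<O>"
  shows "gradient \<phi> q \<bullet> v > 0 \<Longrightarrow> \<forall>\<^sub>F t in at_right 0. q + t *\<^sub>R v \<notin> \<O>"
    and "gradient \<phi> q \<bullet> v < 0 \<Longrightarrow> \<forall>\<^sub>F t in at_right 0. q + t *\<^sub>R v \<in> \<O>"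
proof -
  have U: "open U" "q \<in> U" "\<O> \<inter> U = {x \<in> U. \<phi> x < 0}"
    and q0: "\<phi> q = 0" and diff: "\<phi> differentiable (at q)"
    using assms by (auto simp: C2_defining_function_def numeral_2_eq_2)
  have "((\<lambda>t. q + t *\<^sub>R v) \<longlongrightarrow> q + 0 *\<^sub>R v) (at_right 0)"
    by (intro tendsto_intros)
  then have evU: "\<forall>\<^sub>F t in at_right 0. q + t *\<^sub>R v \<in> U"
    using U by (auto simp: tendsto_def)
  have "(\<phi> has_derivative frechet_derivative \<phi> (at q)) (at (q + 0 *\<^sub>R v))"
    using diff by (simp add: frechet_derivative_works)
  then have "((\<lambda>t. \<phi> (q + t *\<^sub>R v)) has_derivative
      (\<lambda>t. frechet_derivative \<phi> (at q) (t *\<^sub>R v))) (at 0)"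
    by (rule has_derivative_compose[rotated]) (auto intro!: derivative_eq_intros)
  then have "((\<lambda>t. \<phi> (q + t *\<^sub>R v)) has_real_derivative gradient \<phi> q \<bullet> v) (at 0)"
    by (simp add: frechet_derivative_eq_inner_gradient[OF diff] has_field_derivative_def
        mult_commute_abs)
  note D = this
  show "\<forall>\<^sub>F t in at_right 0. q + t *\<^sub>R v \<notin> \<O>" if pos: "gradient \<phi> q \<bullet> v > 0"
  proof -
    obtain d where "d > 0" "\<And>h. 0 < h \<Longrightarrow> h < d \<Longrightarrow> \<phi> (q + h *\<^sub>R v) > 0"
      using DERIV_pos_inc_right[OF D pos] q0 by auto
    then have "\<forall>\<^sub>F t in at_right 0. \<phi> (q + t *\<^sub>R v) > 0"
      unfolding eventually_at_right_field by blast
    with evU show ?thesis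
      by eventually_elim (use U(3) in force)
  qed
  show "\<forall>\<^sub>F t in at_right 0. q + t *\<^sub>R v \<in> \<O>" if neg: "gradient \<phi> q \<bullet> v < 0"
  proof -
    obtain d where "d > 0" "\<And>h. 0 < h \<Longrightarrow> h < d \<Longrightarrow> \<phi> (q + h *\<^sub>R v) < 0"
      using DERIV_neg_dec_right[OF D neg] q0 by auto
    then have "\<forall>\<^sub>F t in at_right 0. \<phi> (q + t *\<^sub>R v) < 0"
      unfolding eventually_at_right_field by blast
    with evU show ?thesis
      by eventually_elim (use U(3) in force)
  qed
qed

lemma outward_normal_eq:
  assumes \<phi>: "C2_defining_function \<O> q U \<phi>" and q: "q \<in> frontier \<O>"
  shows "outward_normal \<O> q = sgn (gradient \<phi> q)"
  unfolding outward_normal_def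
proof (rule the_equality)
  show "\<exists>U' \<phi>'. C2_defining_function \<O> q U' \<phi>' \<and> sgn (gradient \<phi> q) = sgn (gradient \<phi>' q)"
    using \<phi> by blast
next
  fix n assume "\<exists>V \<psi>. C2_defining_function \<O> q V \<psi> \<and> n = sgn (gradient \<psi> q)"
  then obtain V \<psi> where \<psi>: "C2_defining_function \<O> q V \<psi>" and n: "n = sgn (gradient \<psi> q)"
    by blast
  define m where "m = sgn (gradient \<phi> q)"
  have nz: "gradient \<phi> q \<noteq> 0" "gradient \<psi> q \<noteq> 0"
    using \<phi> \<psi> by (auto simp: C2_defining_function_def)
  then have norms: "norm m = 1" "norm n = 1"
    by (auto simp: m_def n norm_sgn)
  show "n = sgn (gradient \<phi> q)"
  proof (rule ccontr)
    assume "n \<noteq> sgn (gradient \<phi> q)"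
    then have "(m - n) \<bullet> (m - n) > 0"
      by (simp add: m_def)
    moreover have "m \<bullet> m = 1" "n \<bullet> n = 1"
      using norms by (simp_all add: dot_square_norm)
    ultimately have "m \<bullet> n < 1"
      by (simp add: inner_diff inner_commute)
    then have "m \<bullet> (n - m) < 0" "n \<bullet> (n - m) > 0"
      using \<open>m \<bullet> m = 1\<close> \<open>n \<bullet> n = 1\<close> by (simp_all add: inner_diff inner_commute)
    moreover have "gradient \<phi> q = norm (gradient \<phi> q) *\<^sub>R m"
      "gradient \<psi> q = norm (gradient \<psi> q) *\<^sub>R n"
      using nz by (simp_all add: m_def n sgn_div_norm)
    ultimately have "gradient \<phi> q \<bullet> (n - m) < 0" "gradient \<psi> q \<bullet> (n - m) > 0"
      using nz by (metis inner_scaleR_left mult_pos_neg zero_less_norm_iff,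
          metis inner_scaleR_left mult_pos_pos zero_less_norm_iff)
    then have "\<forall>\<^sub>F t in at_right 0. q + t *\<^sub>R (n - m) \<in> \<O>"
      "\<forall>\<^sub>F t in at_right 0. q + t *\<^sub>R (n - m) \<notin> \<O>"
      using C2_defining_function_along_line(2)[OF \<phi> q]
        C2_defining_function_along_line(1)[OF \<psi> q] by blast+
    then have "\<forall>\<^sub>F t in at_right (0::real). False"
      by eventually_elim simp
    then show False
      by simp
  qed
qed

end

theory Submission
  imports Defs
begin

text \<open>
  Both parts rest on comparison with explicit barriers: at a maximum of \<open>u - V\<close> over earlier times
  the inequality for \<open>u\<close> forces \<open>\<partial>\<^sub>t V - \<L>V \<le> 0\<close>.

  For (ii), a strict bound \<open>u < M\<close> at \<open>(t1, Q t1, P t1)\<close> is transported along any curve in \<open>\<O>\<close> with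
  \<open>Q' = - P\<close> and \<open>P\<close> of class \<open>C\<^sup>1\<close>: a subsolution supported in a tube around the curve, whose width
  in position shrinks exponentially, stays below \<open>M - u\<close>. Such curves join any two phase-space points
  over a segment in \<open>\<O>\<close> in any given time, and connectedness of \<open>\<O>\<close> does the rest.

  For (i), the supremum is approached along a sequence; after subtracting a small multiple of
  \<open>t + exp (C t) (1 + |p|\<^sup>2)\<close> the sequence is bounded, and its limit can only be a boundary point where
  continuity is not assumed. Such points are excluded by local barriers, written in the distance-like
  coordinate \<open>\<rho>\<close> and the normal velocity \<open>v\<close>: near the corner \<open>t = 0\<close>, \<open>\<rho> = 0\<close> a Gaussian in
  \<open>\<rho> + t v\<close> concentrating at \<open>0\<close>, and near \<open>\<rho> = 0\<close>, \<open>v \<ge> 0\<close> a function with a logarithmic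
  singularity that is adapted to the scaling \<open>\<rho> \<sim> v\<^sup>3\<close>.
\<close>

section \<open>Evaluating the operator on test functions\<close>

text \<open>The operator diffuses in the velocity only, so tools for uniformly parabolic equations
  do not apply. In (ii) a strict bound reaches other positions only through transport; P can be
  steered because diffusion acts on the velocity, and \<open>Q' = - P\<close> because
  \<open>\<partial>\<^sub>t - \<L>\<close> transports positions along - p. In (i) the obstacle is
  that u is merely bounded near incoming and grazing boundary points and near the corner.
  Heuristically, the diffusion with dq = p dt started inside almost surely never exits at such
  points and is not on the boundary at a prescribed time. The barriers say this analytically:
  supersolutions that are as small as desired at one chosen interior point, yet at least 1 near the
  singular set. Incoming points are easy, since transport alone makes \<open>- ln \<rho>\<close> a
  supersolution where \<open>v \<ge> 0\<close>. Grazing points are delicate: for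
  \<open>v < 0\<close> transport has the wrong sign and diffusion in v must compensate it, which
  dictates the second term of \<open>grazing_fun\<close>. Charts are local, so a barrier cannot be
  subtracted globally; hence the second, localised maximisation in
  \<open>weak_maximum_principle\<close>.\<close>

lemma second_derivative_nonpos_at_max:
  fixes f f1 :: "real \<Rightarrow> real"
  assumes f: "\<And>s. (f has_real_derivative f1 s) (at s)"
    and f1: "(f1 has_real_derivative l) (at 0)"
    and "r > 0" and max: "\<And>s. \<bar>s\<bar> < r \<Longrightarrow> f s \<le> f 0"
  shows "l \<le> 0"
proof (rule ccontr)
  assume "\<not> l \<le> 0"
  then have "l > 0" by simp
  have "f1 0 = 0"
    using DERIV_local_max[OF f \<open>r > 0\<close>, of 0] max by (simp add: abs_minus_commute)
  with DERIV_pos_inc_right[OF f1 \<open>l > 0\<close>] obtain e where e: "e > 0"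
    and pos: "\<And>h. 0 < h \<Longrightarrow> h < e \<Longrightarrow> f1 h > 0" by auto
  define a where "a = min e r / 2"
  have a: "0 < a" "a < e" "a < r" using e \<open>r > 0\<close> by (auto simp: a_def min_def)
  then obtain z where "z > 0" "z < a" "f a - f 0 = (a - 0) * f1 z"
    using MVT2[of 0 a f f1] f by auto
  with pos[of z] a have "f a - f 0 > 0" by simp
  with max[of a] a show False by simp
qed

text \<open>
  \<open>has_kinetic_value \<sigma> c V t q p l\<close>: the value of \<open>\<partial>\<^sub>t V - \<L>V\<close> at \<open>(t, q, p)\<close> is \<open>l\<close>, where \<open>c\<close>
  stands for the drift \<open>F q - \<gamma> p\<close>. The first-order part of \<open>\<partial>\<^sub>t - \<L>\<close> is the derivative along
  the direction \<open>(1, - p, - c)\<close>, so that only derivatives of functions of one real variable occur.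
\<close>

definition has_kinetic_value ::
  "real \<Rightarrow> 'a \<Rightarrow> (real \<times> 'a \<times> 'a \<Rightarrow> real) \<Rightarrow> real \<Rightarrow> 'a \<Rightarrow> 'a::euclidean_space \<Rightarrow> real \<Rightarrow> bool" where
  "has_kinetic_value \<sigma> c V t q p l \<longleftrightarrow> (\<exists>D \<Lambda>.
     ((\<lambda>s. V (t + s, q - s *\<^sub>R p, p - s *\<^sub>R c)) has_real_derivative D) (at 0) \<and>
     (\<forall>b\<in>Basis. \<exists>V'. (\<forall>s. ((\<lambda>s. V (t, q, p + s *\<^sub>R b)) has_real_derivative V' s) (at s)) \<and>
        (V' has_real_derivative \<Lambda> b) (at 0)) \<and>
     l = D - \<sigma>\<^sup>2 / 2 * (\<Sum>b\<in>Basis. \<Lambda> b))"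

lemma has_kinetic_valueI:
  assumes "((\<lambda>s. V (t + s, q - s *\<^sub>R p, p - s *\<^sub>R c)) has_real_derivative D) (at 0)"
    and "\<And>b s. b \<in> Basis \<Longrightarrow> ((\<lambda>s. V (t, q, p + s *\<^sub>R b)) has_real_derivative V' b s) (at s)"
    and "\<And>b. b \<in> Basis \<Longrightarrow> (V' b has_real_derivative \<Lambda> b) (at 0)"
    and "l = D - \<sigma>\<^sup>2 / 2 * (\<Sum>b\<in>Basis. \<Lambda> b)"
  shows "has_kinetic_value \<sigma> c V t q p l"
  unfolding has_kinetic_value_def using assms by blast

lemma has_kinetic_value_add:
  assumes "has_kinetic_value \<sigma> c V t q p l" "has_kinetic_value \<sigma> c W t q p m"
  shows "has_kinetic_value \<sigma> c (\<lambda>z. V z + W z) t q p (l + m)"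
proof -
  obtain D \<Lambda> where V: "((\<lambda>s. V (t + s, q - s *\<^sub>R p, p - s *\<^sub>R c)) has_real_derivative D) (at 0)"
    "\<forall>b\<in>Basis. \<exists>V'. (\<forall>s. ((\<lambda>s. V (t, q, p + s *\<^sub>R b)) has_real_derivative V' s) (at s)) \<and>
        (V' has_real_derivative \<Lambda> b) (at 0)"
    "l = D - \<sigma>\<^sup>2 / 2 * (\<Sum>b\<in>Basis. \<Lambda> b)"
    using assms(1) unfolding has_kinetic_value_def by blast
  obtain E \<Theta> where W: "((\<lambda>s. W (t + s, q - s *\<^sub>R p, p - s *\<^sub>R c)) has_real_derivative E) (at 0)"
    "\<forall>b\<in>Basis. \<exists>V'. (\<forall>s. ((\<lambda>s. W (t, q, p + s *\<^sub>R b)) has_real_derivative V' s) (at s)) \<and>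
        (V' has_real_derivative \<Theta> b) (at 0)"
    "m = E - \<sigma>\<^sup>2 / 2 * (\<Sum>b\<in>Basis. \<Theta> b)"
    using assms(2) unfolding has_kinetic_value_def by blast
  have "\<exists>U'. (\<forall>s. ((\<lambda>s. V (t, q, p + s *\<^sub>R b) + W (t, q, p + s *\<^sub>R b)) has_real_derivative U' s) (at s)) \<and>
        (U' has_real_derivative \<Lambda> b + \<Theta> b) (at 0)" if b: "b \<in> Basis" for b
  proof -
    obtain V' W' where
      "\<forall>s. ((\<lambda>s. V (t, q, p + s *\<^sub>R b)) has_real_derivative V' s) (at s)"
      "(V' has_real_derivative \<Lambda> b) (at 0)"
      "\<forall>s. ((\<lambda>s. W (t, q, p + s *\<^sub>R b)) has_real_derivative W' s) (at s)"
      "(W' has_real_derivative \<Theta> b) (at 0)"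
      using V(2) W(2) b by blast
    then show ?thesis
      by (intro exI[of _ "\<lambda>s. V' s + W' s"] conjI allI DERIV_add) auto
  qed
  with DERIV_add[OF V(1) W(1)] show ?thesis
    unfolding has_kinetic_value_def V(3) W(3)
    by (intro exI[of _ "D + E"] exI[of _ "\<lambda>b. \<Lambda> b + \<Theta> b"])
       (auto simp: sum.distrib algebra_simps)
qed

lemma has_kinetic_value_cmult:
  assumes "has_kinetic_value \<sigma> c V t q p l"
  shows "has_kinetic_value \<sigma> c (\<lambda>z. k * V z) t q p (k * l)"
proof -
  obtain D \<Lambda> where V: "((\<lambda>s. V (t + s, q - s *\<^sub>R p, p - s *\<^sub>R c)) has_real_derivative D) (at 0)"
    "\<forall>b\<in>Basis. \<exists>V'. (\<forall>s. ((\<lambda>s. V (t, q, p + s *\<^sub>R b)) has_real_derivative V' s) (at s)) \<and>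
        (V' has_real_derivative \<Lambda> b) (at 0)"
    "l = D - \<sigma>\<^sup>2 / 2 * (\<Sum>b\<in>Basis. \<Lambda> b)"
    using assms unfolding has_kinetic_value_def by blast
  have "\<exists>U'. (\<forall>s. ((\<lambda>s. k * V (t, q, p + s *\<^sub>R b)) has_real_derivative U' s) (at s)) \<and>
        (U' has_real_derivative k * \<Lambda> b) (at 0)" if b: "b \<in> Basis" for b
  proof -
    obtain V' where
      "\<forall>s. ((\<lambda>s. V (t, q, p + s *\<^sub>R b)) has_real_derivative V' s) (at s)"
      "(V' has_real_derivative \<Lambda> b) (at 0)"
      using V(2) b by blast
    then show ?thesis
      by (intro exI[of _ "\<lambda>s. k * V' s"] conjI allI DERIV_cmult) auto
  qed
  with DERIV_cmult[OF V(1), of k] show ?thesis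
    unfolding has_kinetic_value_def V(3)
    by (intro exI[of _ "k * D"] exI[of _ "\<lambda>b. k * \<Lambda> b"])
       (auto simp: sum_distrib_left[symmetric] algebra_simps)
qed

lemma has_kinetic_value_const: "has_kinetic_value \<sigma> c (\<lambda>z. k) t q p 0"
  by (rule has_kinetic_valueI[where D = 0 and V' = "\<lambda>_ _. 0" and \<Lambda> = "\<lambda>_. 0"]) auto

section \<open>Regularity of the subsolution and comparison at a maximum\<close>

locale kinetic_subsolution =
  fixes F :: "'a::euclidean_space \<Rightarrow> 'a" and \<gamma> \<sigma> :: real and \<O> :: "'a set"
    and u :: "real \<times> 'a \<times> 'a \<Rightarrow> real"
  assumes sigma_pos: "\<sigma> > 0" and cont_F: "continuous_on UNIV F"
    and open_O: "open \<O>"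
    and smooth: "C_1_2_on u ({0<..} \<times> (\<O> \<times> UNIV))"
    and subsol: "\<And>t x. t > 0 \<Longrightarrow> x \<in> \<O> \<times> UNIV \<Longrightarrow>
           time_deriv u (t, x) - kinetic_operator F \<gamma> \<sigma> (\<lambda>y. u (t, y)) x \<le> 0"
begin

definition drift :: "'a \<Rightarrow> 'a \<Rightarrow> 'a" where "drift q p = F q - \<gamma> *\<^sub>R p"

lemma continuous_u: "continuous_on ({0<..} \<times> \<O> \<times> UNIV) u"
  using smooth by (simp add: C_1_2_on_def)

lemma space_derivative:
  assumes "t > 0" "x \<in> \<O> \<times> UNIV"
  shows "((\<lambda>y. u (t, y)) has_derivative (\<lambda>w. gradient (\<lambda>y. u (t, y)) x \<bullet> w)) (at x)"
proof -
  have "(\<lambda>y. u (t, y)) differentiable (at x)"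
    using smooth assms by (auto simp: C_1_2_on_def)
  then have "((\<lambda>y. u (t, y)) has_derivative frechet_derivative (\<lambda>y. u (t, y)) (at x)) (at x)"
    and "frechet_derivative (\<lambda>y. u (t, y)) (at x) = (\<lambda>w. gradient (\<lambda>y. u (t, y)) x \<bullet> w)"
    by (auto simp: frechet_derivative_works[symmetric] frechet_derivative_eq_inner_gradient fun_eq_iff)
  then show ?thesis by simp
qed

text \<open>\<open>C_1_2_on\<close> provides derivatives in t and in x separately, but the transport
  direction mixes them. Continuity of the space gradient lets the two combine into a joint
  derivative; the ball supplies the convex set of x that this requires.\<close>

lemma joint_derivative:
  assumes t: "t > 0" and x: "x \<in> \<O> \<times> UNIV"
  shows "(u has_derivative (\<lambda>(s, w). s * time_deriv u (t, x) + gradient (\<lambda>y. u (t, y)) x \<bullet> w)) (at (t, x))"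
proof -
  define g where "g = (\<lambda>t x. gradient (\<lambda>y. u (t, y)) x)"
  have "open (\<O> \<times> (UNIV :: 'a set))" using open_O by (intro open_Times) auto
  then obtain r where r: "r > 0" "ball x r \<subseteq> \<O> \<times> UNIV"
    using x openE by blast
  have "(\<lambda>s. u (s, x)) differentiable (at t)"
    using smooth assms by (auto simp: C_1_2_on_def)
  then have "((\<lambda>s. u (s, x)) has_real_derivative deriv (\<lambda>s. u (s, x)) t) (at t)"
    by (simp add: DERIV_deriv_iff_real_differentiable)
  then have dt: "((\<lambda>s. u (s, x)) has_derivative (\<lambda>s. s * time_deriv u (t, x))) (at t within {0<..})"
    by (simp add: time_deriv_def has_field_derivative_def mult_commute_abs has_derivative_at_withinI)
  have "continuous_on ({0<..} \<times> \<O> \<times> UNIV) (\<lambda>(t, x). g t x)"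
    using smooth by (simp add: C_1_2_on_def g_def)
  then have "continuous_on ({0<..} \<times> ball x r) (\<lambda>(t, x). g t x)"
    by (rule continuous_on_subset) (use r in auto)
  then have "continuous (at (t, x) within {0<..} \<times> ball x r) (\<lambda>z. g (fst z) (snd z))"
    using t r by (auto simp: continuous_on_eq_continuous_within split_def)
  then have gc: "continuous (at (t, x) within {0<..} \<times> ball x r) (\<lambda>(t, x). blinfun_inner_right (g t x))"
    unfolding split_def
    by (intro bounded_linear.continuous[OF bounded_linear_blinfun_inner_right])
  have "((\<lambda>(s, y). u (s, y)) has_derivative (\<lambda>(ts, w). ts * time_deriv u (t, x) + blinfun_apply (blinfun_inner_right (g t x)) w))
      (at (t, x) within {0<..} \<times> ball x r)"
  proof (rule has_derivative_partialsI[where f = "\<lambda>s y. u (s, y)"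
        and fy = "\<lambda>s y. blinfun_inner_right (g s y)", OF dt _ gc])
    show "((\<lambda>y. u (t, y)) has_derivative blinfun_apply (blinfun_inner_right (g t y))) (at y within ball x r)"
      if "t \<in> {0<..}" "y \<in> ball x r" for t y
      using has_derivative_at_withinI[OF space_derivative[of t y]] that r
      by (auto simp: g_def blinfun_inner_right.rep_eq)
  qed (use r in auto)
  moreover have "at (t, x) within {0<..} \<times> ball x r = at (t, x)"
    by (rule at_within_open) (use t r in \<open>auto intro!: open_Times\<close>)
  ultimately show ?thesis by (simp add: g_def blinfun_inner_right.rep_eq split_def)
qed

lemma operator_eq:
  assumes t: "t > 0" and q: "q \<in> \<O>"
  shows "kinetic_operator F \<gamma> \<sigma> (\<lambda>y. u (t, y)) (q, p) =
    gradient (\<lambda>y. u (t, y)) (q, p) \<bullet> (p, drift q p) + \<sigma>\<^sup>2 / 2 * laplacian (\<lambda>p. u (t, q, p)) p"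
proof -
  let ?g = "gradient (\<lambda>y. u (t, y)) (q, p)"
  have d: "((\<lambda>y. u (t, y)) has_derivative (\<lambda>w. ?g \<bullet> w)) (at (q, p))"
    using space_derivative t q by simp
  have dq: "((\<lambda>q. u (t, q, p)) has_derivative (\<lambda>w. ?g \<bullet> (w, 0))) (at q)"
    by (rule has_derivative_compose[of "\<lambda>q. (q, p)" "\<lambda>w. (w, 0)" q UNIV "\<lambda>y. u (t, y)" "\<lambda>w. ?g \<bullet> w"])
       (use d in \<open>auto intro!: derivative_eq_intros\<close>)
  have dp: "((\<lambda>p. u (t, q, p)) has_derivative (\<lambda>w. ?g \<bullet> (0, w))) (at p)"
    by (rule has_derivative_compose[of "\<lambda>p. (q, p)" "\<lambda>w. (0, w)" p UNIV "\<lambda>y. u (t, y)" "\<lambda>w. ?g \<bullet> w"])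
       (use d in \<open>auto intro!: derivative_eq_intros\<close>)
  have "w \<bullet> gradient (\<lambda>q. u (t, q, p)) q = ?g \<bullet> (w, 0)" for w
    using frechet_derivative_eq_inner_gradient[OF differentiableI[OF dq], of w] frechet_derivative_at[OF dq]
    by (simp add: inner_commute fun_eq_iff)
  moreover have "w \<bullet> gradient (\<lambda>p. u (t, q, p)) p = ?g \<bullet> (0, w)" for w
    using frechet_derivative_eq_inner_gradient[OF differentiableI[OF dp], of w] frechet_derivative_at[OF dp]
    by (simp add: inner_commute fun_eq_iff)
  moreover have "?g \<bullet> (p, drift q p) = ?g \<bullet> (p, 0) + ?g \<bullet> (0, F q) - \<gamma> * (?g \<bullet> (0, p))"
    by (cases ?g) (simp add: drift_def inner_diff_right)
  ultimately show ?thesis by (simp add: kinetic_operator_def)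
qed

text \<open>\<open>laplacian\<close> iterates directional derivatives of a function of p alone,
  whereas \<open>C_1_2_on\<close> differentiates the full gradient in (q, p). Both lead to the same
  number \<open>G (0, b) \<bullet> (0, b)\<close>.\<close>

lemma second_derivative_line:
  assumes t: "t > 0" and q: "q \<in> \<O>"
  shows "\<exists>f'. (\<forall>s. ((\<lambda>s. u (t, q, p + s *\<^sub>R b)) has_real_derivative f' s) (at s)) \<and>
    (f' has_real_derivative frechet_derivative (\<lambda>y. frechet_derivative (\<lambda>p. u (t, q, p)) (at y) b) (at p) b) (at 0)"
proof -
  let ?g = "\<lambda>y. gradient (\<lambda>y. u (t, y)) (q, y)"
  have dp: "((\<lambda>p. u (t, q, p)) has_derivative (\<lambda>w. ?g p \<bullet> (0, w))) (at p)" for p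
    by (rule has_derivative_compose[of "\<lambda>p. (q, p)" "\<lambda>w. (0, w)" p UNIV "\<lambda>y. u (t, y)" "\<lambda>w. ?g p \<bullet> w"])
       (use space_derivative[OF t, of "(q, p)"] q in \<open>auto intro!: derivative_eq_intros\<close>)
  then have eq: "frechet_derivative (\<lambda>p. u (t, q, p)) (at p) b = ?g p \<bullet> (0, b)" for p
    by (metis frechet_derivative_at)
  have "gradient (\<lambda>y. u (t, y)) differentiable (at (q, p))"
    using smooth assms by (auto simp: C_1_2_on_def)
  then obtain G where G: "(gradient (\<lambda>y. u (t, y)) has_derivative G) (at (q, p))"
    by (auto simp: differentiable_def)
  have "(?g has_derivative (\<lambda>w. G (0, w))) (at p)"
    by (rule has_derivative_compose[of "\<lambda>p. (q, p)" "\<lambda>w. (0, w)" p UNIV _ G])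
       (use G in \<open>auto intro!: derivative_eq_intros\<close>)
  then have dg: "((\<lambda>y. ?g y \<bullet> (0, b)) has_derivative (\<lambda>w. G (0, w) \<bullet> (0, b))) (at p)"
    by (rule has_derivative_inner_left)
  have lin: "linear (\<lambda>w. G (0, w) \<bullet> (0, b))"
    using dg by (rule has_derivative_linear)
  have line: "((\<lambda>s. p + s *\<^sub>R b) has_derivative (\<lambda>h. h *\<^sub>R b)) (at s)" for s :: real
    by (auto intro!: derivative_eq_intros)
  have "((\<lambda>s. u (t, q, p + s *\<^sub>R b)) has_real_derivative ?g (p + s *\<^sub>R b) \<bullet> (0, b)) (at s)" for s
    using has_derivative_compose[OF line dp, of s]
    by (simp add: has_field_derivative_def inner_prod_def mult_commute_abs)
  moreover have "((\<lambda>s. ?g (p + s *\<^sub>R b) \<bullet> (0, b)) has_real_derivative G (0, b) \<bullet> (0, b)) (at 0)"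
  proof -
    have dg': "((\<lambda>y. ?g y \<bullet> (0, b)) has_derivative (\<lambda>w. G (0, w) \<bullet> (0, b))) (at (p + 0 *\<^sub>R b))"
      using dg by simp
    show ?thesis
      using has_derivative_compose[OF line dg'] linear_scale[OF lin, of _ b]
      by (simp add: has_field_derivative_def mult_commute_abs)
  qed
  moreover have "frechet_derivative (\<lambda>y. frechet_derivative (\<lambda>p. u (t, q, p)) (at y) b) (at p) b = G (0, b) \<bullet> (0, b)"
    unfolding eq using frechet_derivative_at[OF dg] by metis
  ultimately show ?thesis by (intro exI[of _ "\<lambda>s. ?g (p + s *\<^sub>R b) \<bullet> (0, b)"]) auto
qed

lemma comparison_at_max:
  assumes t: "t > 0" and q: "q \<in> \<O>" and V: "has_kinetic_value \<sigma> (drift q p) V t q p l"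
    and "r > 0"
    and max: "\<And>t' q' p'. t' \<le> t \<Longrightarrow> dist (t', q', p') (t, q, p) < r \<Longrightarrow>
      u (t', q', p') - V (t', q', p') \<le> u (t, q, p) - V (t, q, p)"
  shows "l \<le> 0"
proof -
  let ?c = "drift q p"
  let ?L = "\<lambda>b. frechet_derivative (\<lambda>y. frechet_derivative (\<lambda>p. u (t, q, p)) (at y) b) (at p) b"
  let ?G = "gradient (\<lambda>y. u (t, y)) (q, p)"
  obtain D \<Lambda> where D: "((\<lambda>s. V (t + s, q - s *\<^sub>R p, p - s *\<^sub>R ?c)) has_real_derivative D) (at 0)"
    and \<Lambda>: "\<forall>b\<in>Basis. \<exists>V'. (\<forall>s. ((\<lambda>s. V (t, q, p + s *\<^sub>R b)) has_real_derivative V' s) (at s)) \<and>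
        (V' has_real_derivative \<Lambda> b) (at 0)"
    and l: "l = D - \<sigma>\<^sup>2 / 2 * (\<Sum>b\<in>Basis. \<Lambda> b)"
    using V unfolding has_kinetic_value_def by blast
  have line: "((\<lambda>s. (t + s, q - s *\<^sub>R p, p - s *\<^sub>R ?c)) has_derivative (\<lambda>s. (s, - s *\<^sub>R p, - s *\<^sub>R ?c))) (at 0)"
    by (auto intro!: derivative_eq_intros)
  have "(u has_derivative (\<lambda>(s, w). s * time_deriv u (t, q, p) + ?G \<bullet> w)) (at (t + 0, q - 0 *\<^sub>R p, p - 0 *\<^sub>R ?c))"
    using joint_derivative[OF t, of "(q, p)"] q by simp
  from has_derivative_compose[OF line this]
  have "((\<lambda>s. u (t + s, q - s *\<^sub>R p, p - s *\<^sub>R ?c)) has_derivative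
     (\<lambda>s. s * (time_deriv u (t, q, p) - ?G \<bullet> (p, ?c)))) (at 0)"
    by (rule has_derivative_eq_rhs) (auto simp: inner_prod_def algebra_simps fun_eq_iff)
  then have Du: "((\<lambda>s. u (t + s, q - s *\<^sub>R p, p - s *\<^sub>R ?c)) has_real_derivative
      time_deriv u (t, q, p) - ?G \<bullet> (p, ?c)) (at 0)"
    by (simp add: has_field_derivative_def mult_commute_abs)
  define f where "f = (\<lambda>s. u (t + s, q - s *\<^sub>R p, p - s *\<^sub>R ?c) - V (t + s, q - s *\<^sub>R p, p - s *\<^sub>R ?c))"
  have Df: "(f has_real_derivative time_deriv u (t, q, p) - ?G \<bullet> (p, ?c) - D) (at 0)"
    unfolding f_def by (rule DERIV_diff[OF Du D])
  have 1: "time_deriv u (t, q, p) - ?G \<bullet> (p, ?c) - D \<ge> 0"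
  proof (rule ccontr)
    assume "\<not> ?thesis"
    then obtain e where e: "e > 0" "\<And>h. 0 < h \<Longrightarrow> h < e \<Longrightarrow> f 0 < f (0 - h)"
      using DERIV_neg_dec_left[OF Df] by auto
    have "((\<lambda>h. (t - h, q + h *\<^sub>R p, p + h *\<^sub>R ?c)) \<longlongrightarrow> (t - 0, q + 0 *\<^sub>R p, p + 0 *\<^sub>R ?c)) (at_right 0)"
      by (intro tendsto_intros)
    then have "((\<lambda>h. (t - h, q + h *\<^sub>R p, p + h *\<^sub>R ?c)) \<longlongrightarrow> (t, q, p)) (at_right 0)" by simp
    from tendstoD[OF this \<open>r > 0\<close>]
    have "\<forall>\<^sub>F h in at_right 0. dist (t - h, q + h *\<^sub>R p, p + h *\<^sub>R ?c) (t, q, p) < r" .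
    moreover have "\<forall>\<^sub>F h in at_right 0. 0 < h \<and> h < e"
      using e(1) by (auto simp: eventually_at_right_field intro!: exI[of _ e])
    ultimately have "\<forall>\<^sub>F h::real in at_right 0. False"
    proof eventually_elim
      case (elim h)
      then have "f (0 - h) \<le> f 0"
        using max[of "t - h" "q + h *\<^sub>R p" "p + h *\<^sub>R ?c"] by (simp add: f_def)
      with e(2)[of h] elim show False by simp
    qed
    then show False by simp
  qed
  have 2: "?L b - \<Lambda> b \<le> 0" if b: "b \<in> Basis" for b
  proof -
    obtain V' where V': "\<And>s. ((\<lambda>s. V (t, q, p + s *\<^sub>R b)) has_real_derivative V' s) (at s)"
      "(V' has_real_derivative \<Lambda> b) (at 0)" using \<Lambda> b by blast
    obtain f' where f': "\<And>s. ((\<lambda>s. u (t, q, p + s *\<^sub>R b)) has_real_derivative f' s) (at s)"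
      "(f' has_real_derivative ?L b) (at 0)" using second_derivative_line[OF t q] by blast
    show ?thesis
    proof (rule second_derivative_nonpos_at_max[OF DERIV_diff[OF f'(1) V'(1)] DERIV_diff[OF f'(2) V'(2)] \<open>r > 0\<close>])
      fix s :: real assume "\<bar>s\<bar> < r"
      then have "dist (t, q, p + s *\<^sub>R b) (t, q, p) < r"
        using b by (simp add: dist_Pair_Pair dist_norm)
      from max[OF _ this]
      show "u (t, q, p + s *\<^sub>R b) - V (t, q, p + s *\<^sub>R b) \<le> u (t, q, p + 0 *\<^sub>R b) - V (t, q, p + 0 *\<^sub>R b)"
        by simp
    qed
  qed
  have "laplacian (\<lambda>p. u (t, q, p)) p \<le> (\<Sum>b\<in>Basis. \<Lambda> b)"
    unfolding laplacian_def by (rule sum_mono) (use 2 in auto)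
  then have "\<sigma>\<^sup>2 / 2 * laplacian (\<lambda>p. u (t, q, p)) p \<le> \<sigma>\<^sup>2 / 2 * (\<Sum>b\<in>Basis. \<Lambda> b)"
    by (rule mult_left_mono) simp
  moreover have "time_deriv u (t, q, p) - ?G \<bullet> (p, ?c) - \<sigma>\<^sup>2 / 2 * laplacian (\<lambda>p. u (t, q, p)) p \<le> 0"
    using subsol[OF t, of "(q, p)"] q operator_eq[OF t q, of p] by simp
  ultimately show ?thesis using 1 l by simp
qed

end

section \<open>Propagation of strict bounds\<close>

lemma DERIV_inner_self:
  fixes f :: "real \<Rightarrow> 'a::real_inner"
  assumes "(f has_vector_derivative f') (at s)"
  shows "((\<lambda>s. f s \<bullet> f s) has_real_derivative 2 * (f s \<bullet> f')) (at s)"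
  using bounded_bilinear.has_vector_derivative[OF bounded_bilinear_inner assms assms]
  by (simp add: has_real_derivative_iff_has_vector_derivative inner_commute)

lemma has_vector_derivative_shift_0:
  assumes "(f has_vector_derivative f') (at t)"
  shows "((\<lambda>s::real. f (t + s)) has_vector_derivative f') (at 0)"
  using assms has_derivative_compose[of "\<lambda>s. t + s" "\<lambda>s. 0 + s" 0 UNIV f "\<lambda>h. h *\<^sub>R f'",
      OF has_derivative_add[OF has_derivative_const has_derivative_ident]]
  by (simp add: has_vector_derivative_def)

text \<open>Because \<open>Q' = - P\<close>, the derivative of q - Q along the transport direction
  is just - (p - P). Squaring h matters: the second derivatives of its square contain the squared
  velocity gradient of h, which gives the last, negative term and survives at h = 0.\<close>

lemma tube_function_kinetic_value:
  fixes P Q R :: "real \<Rightarrow> 'a::euclidean_space" and e K K' \<tau> :: real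
  defines "h \<equiv> \<lambda>(t, q, p). 1 - (p - P t) \<bullet> (p - P t) / e\<^sup>2
      - exp (2 * K' * (t - \<tau>)) * ((q - Q t) \<bullet> (q - Q t)) / e\<^sup>2"
  assumes Q: "(Q has_vector_derivative - P t) (at t)" and P: "(P has_vector_derivative R t) (at t)"
    and e: "e \<noteq> 0"
  shows "has_kinetic_value \<sigma> c (\<lambda>z. exp (- K * (fst z - \<tau>)) * (h z)\<^sup>2) t q p
    (exp (- K * (t - \<tau>)) * (- K * (h (t, q, p))\<^sup>2
      + 4 * h (t, q, p) * ((p - P t) \<bullet> (c + R t + exp (2 * K' * (t - \<tau>)) *\<^sub>R (q - Q t))) / e\<^sup>2
      - 4 * h (t, q, p) * K' * (exp (2 * K' * (t - \<tau>)) * ((q - Q t) \<bullet> (q - Q t)) / e\<^sup>2)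
      + 2 * \<sigma>\<^sup>2 * DIM('a) * h (t, q, p) / e\<^sup>2
      - 4 * \<sigma>\<^sup>2 * ((p - P t) \<bullet> (p - P t)) / e ^ 4))"
proof -
  define v y E where "v = p - P t" and "y = q - Q t" and "E = exp (2 * K' * (t - \<tau>))"
  define H where "H = h (t, q, p)"
  have H: "H = 1 - v \<bullet> v / e\<^sup>2 - E * (y \<bullet> y) / e\<^sup>2"
    by (simp add: H_def h_def v_def y_def E_def)
  define A B where "A = (\<lambda>s. (p - s *\<^sub>R c - P (t + s)) \<bullet> (p - s *\<^sub>R c - P (t + s)))"
    and "B = (\<lambda>s. (q - s *\<^sub>R p - Q (t + s)) \<bullet> (q - s *\<^sub>R p - Q (t + s)))"
  have "((\<lambda>s. P (t + s)) has_vector_derivative R t) (at 0)"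
    using P by (rule has_vector_derivative_shift_0)
  then have "((\<lambda>s. p - s *\<^sub>R c - P (t + s)) has_vector_derivative (- c - R t)) (at 0)"
    by (auto intro!: derivative_eq_intros)
  from DERIV_inner_self[OF this] have A: "(A has_real_derivative - 2 * (v \<bullet> (c + R t))) (at 0)"
    unfolding A_def by (rule DERIV_cong) (simp add: v_def inner_diff_right inner_add_right)
  have "((\<lambda>s. Q (t + s)) has_vector_derivative - P t) (at 0)"
    using Q by (rule has_vector_derivative_shift_0)
  then have "((\<lambda>s. q - s *\<^sub>R p - Q (t + s)) has_vector_derivative - v) (at 0)"
    by (auto intro!: derivative_eq_intros simp: v_def)
  from DERIV_inner_self[OF this] have B: "(B has_real_derivative - 2 * (y \<bullet> v)) (at 0)"
    unfolding B_def by (rule DERIV_cong) (simp add: y_def)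
  have AB: "A 0 = v \<bullet> v" "B 0 = y \<bullet> y" by (simp_all add: A_def B_def v_def y_def)
  have "((\<lambda>s. exp (- K * (t + s - \<tau>)) * (1 - A s / e\<^sup>2 - exp (2 * K' * (t + s - \<tau>)) * B s / e\<^sup>2)\<^sup>2)
    has_real_derivative exp (- K * (t - \<tau>)) * (- K * H\<^sup>2
      + 4 * H * (v \<bullet> (c + R t + E *\<^sub>R y)) / e\<^sup>2 - 4 * H * K' * (E * (y \<bullet> y) / e\<^sup>2))) (at 0)"
  proof (rule DERIV_cong)
    have H': "((\<lambda>s. 1 - A s / e\<^sup>2 - exp (2 * K' * (t + s - \<tau>)) * B s / e\<^sup>2) has_real_derivative
        2 * (v \<bullet> (c + R t)) / e\<^sup>2 - (2 * K' * E * (y \<bullet> y) - 2 * E * (v \<bullet> y)) / e\<^sup>2) (at 0)"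
      by (rule derivative_eq_intros A B refl | (simp add: e; fail))+
        (simp add: AB E_def inner_commute[of y v] e field_simps power2_eq_square power4_eq_xxxx)
    have 0: "1 - A 0 / e\<^sup>2 - exp (2 * K' * (t + 0 - \<tau>)) * B 0 / e\<^sup>2 = H"
      by (simp add: AB H E_def)
    show "((\<lambda>s. exp (- K * (t + s - \<tau>)) * (1 - A s / e\<^sup>2 - exp (2 * K' * (t + s - \<tau>)) * B s / e\<^sup>2)\<^sup>2)
      has_real_derivative exp (- K * (t - \<tau>)) * (- K) * H\<^sup>2
        + exp (- K * (t - \<tau>)) * (2 * H * (2 * (v \<bullet> (c + R t)) / e\<^sup>2
            - (2 * K' * E * (y \<bullet> y) - 2 * E * (v \<bullet> y)) / e\<^sup>2))) (at 0)"
      by (rule derivative_eq_intros H' refl | simp)+ (simp add: AB H E_def algebra_simps)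
  qed (simp add: inner_add_right divide_inverse algebra_simps)
  then have D: "((\<lambda>s. exp (- K * (fst (t + s, q - s *\<^sub>R p, p - s *\<^sub>R c) - \<tau>)) * (h (t + s, q - s *\<^sub>R p, p - s *\<^sub>R c))\<^sup>2)
    has_real_derivative exp (- K * (t - \<tau>)) * (- K * H\<^sup>2
      + 4 * H * (v \<bullet> (c + R t + E *\<^sub>R y)) / e\<^sup>2 - 4 * H * K' * (E * (y \<bullet> y) / e\<^sup>2))) (at 0)"
    by (simp add: h_def A_def B_def)
  define H1 where "H1 = (\<lambda>b s. 1 - (v + s *\<^sub>R b) \<bullet> (v + s *\<^sub>R b) / e\<^sup>2 - E * (y \<bullet> y) / e\<^sup>2)"
  have eq: "h (t, q, p + s *\<^sub>R b) = H1 b s" for b s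
    by (simp add: h_def H1_def v_def y_def E_def algebra_simps)
  have lin: "((\<lambda>s. (v + s *\<^sub>R b) \<bullet> b) has_real_derivative b \<bullet> b) (at s)" for b s
    unfolding inner_add_left inner_scaleR_left by (auto intro!: derivative_eq_intros)
  have "((\<lambda>s. v + s *\<^sub>R b) has_vector_derivative b) (at s)" for b s
    by (auto intro!: derivative_eq_intros)
  note sq = DERIV_inner_self[OF this]
  have dH: "(H1 b has_real_derivative - 2 * ((v + s *\<^sub>R b) \<bullet> b) / e\<^sup>2) (at s)" for b s
    unfolding H1_def by (rule derivative_eq_intros sq refl | (simp add: e; fail))+
      (simp add: e power2_eq_square)
  have d1: "((\<lambda>s. exp (- K * (t - \<tau>)) * (H1 b s)\<^sup>2) has_real_derivative
      exp (- K * (t - \<tau>)) * (2 * H1 b s * (- 2 * ((v + s *\<^sub>R b) \<bullet> b) / e\<^sup>2))) (at s)" for b s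
    by (rule derivative_eq_intros dH refl | simp)+
  have d2: "((\<lambda>s. exp (- K * (t - \<tau>)) * (2 * H1 b s * (- 2 * ((v + s *\<^sub>R b) \<bullet> b) / e\<^sup>2))) has_real_derivative
      exp (- K * (t - \<tau>)) * (8 * (v \<bullet> b)\<^sup>2 / e ^ 4 - 4 * H / e\<^sup>2)) (at 0)" if "b \<in> Basis" for b
    apply (rule derivative_eq_intros dH lin refl | (simp add: e; fail))+
    using that apply (simp add: H H1_def field_simps e power2_eq_square power4_eq_xxxx)
    done
  show ?thesis
  proof (rule has_kinetic_valueI[OF D])
    show "((\<lambda>s. exp (- K * (fst (t, q, p + s *\<^sub>R b) - \<tau>)) * (h (t, q, p + s *\<^sub>R b))\<^sup>2) has_real_derivative
      exp (- K * (t - \<tau>)) * (2 * H1 b s * (- 2 * ((v + s *\<^sub>R b) \<bullet> b) / e\<^sup>2))) (at s)" for b s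
      using d1 by (simp add: eq)
    show "((\<lambda>s. exp (- K * (t - \<tau>)) * (2 * H1 b s * (- 2 * ((v + s *\<^sub>R b) \<bullet> b) / e\<^sup>2))) has_real_derivative
      exp (- K * (t - \<tau>)) * (8 * (v \<bullet> b)\<^sup>2 / e ^ 4 - 4 * H / e\<^sup>2)) (at 0)" if "b \<in> Basis" for b
      by (rule d2[OF that])
    have "(\<Sum>b\<in>Basis. exp (- K * (t - \<tau>)) * (8 * (v \<bullet> b)\<^sup>2 / e ^ 4 - 4 * H / e\<^sup>2))
      = exp (- K * (t - \<tau>)) * (8 * (v \<bullet> v) / e ^ 4 - 4 * H / e\<^sup>2 * DIM('a))"
      unfolding sum_distrib_left[symmetric] sum_subtractf sum_divide_distrib[symmetric]
      by (simp add: euclidean_inner[of v v] power2_eq_square)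
    then show "exp (- K * (t - \<tau>)) * (- K * (h (t, q, p))\<^sup>2
      + 4 * h (t, q, p) * ((p - P t) \<bullet> (c + R t + exp (2 * K' * (t - \<tau>)) *\<^sub>R (q - Q t))) / e\<^sup>2
      - 4 * h (t, q, p) * K' * (exp (2 * K' * (t - \<tau>)) * ((q - Q t) \<bullet> (q - Q t)) / e\<^sup>2)
      + 2 * \<sigma>\<^sup>2 * DIM('a) * h (t, q, p) / e\<^sup>2
      - 4 * \<sigma>\<^sup>2 * ((p - P t) \<bullet> (p - P t)) / e ^ 4) =
      exp (- K * (t - \<tau>)) * (- K * H\<^sup>2
      + 4 * H * (v \<bullet> (c + R t + E *\<^sub>R y)) / e\<^sup>2 - 4 * H * K' * (E * (y \<bullet> y) / e\<^sup>2))
      - \<sigma>\<^sup>2 / 2 * (\<Sum>b\<in>Basis. exp (- K * (t - \<tau>)) * (8 * (v \<bullet> b)\<^sup>2 / e ^ 4 - 4 * H / e\<^sup>2))"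
      by (simp only: flip: v_def y_def E_def H_def) (simp add: field_simps)
  qed
qed

text \<open>Put a = n / e. The choice of \<open>K'\<close> makes the trace term
  \<open>2 * \<sigma>\<^sup>2 * d * h / e\<^sup>2\<close> cancel against the part - 4 h K' of the
  shrinking term. Besides a multiple of \<open>h\<^sup>2\<close>, the positive remainder is bounded
  by terms linear in h and in a. Young's inequality, applied twice, splits them into multiples of
  \<open>a\<^sup>2\<close>, which use up half of the last term, and of \<open>h\<^sup>2\<close>,
  which the coefficient of \<open>h\<^sup>2\<close> absorbs; the summand 1 there makes the result
  strict.\<close>

lemma tube_inequality:
  fixes h n X A e K' \<sigma> d :: real
  assumes "\<sigma> > 0" "e > 0" "h > 0" "d \<ge> 0" "0 \<le> n" "n \<le> e" "X \<le> n * A"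
    and K': "K' = \<sigma>\<^sup>2 * d / (2 * e\<^sup>2)" and \<eta>: "\<eta> = 1 - n\<^sup>2 / e\<^sup>2 - h"
  shows "- (1 + 4 * A\<^sup>2 / \<sigma>\<^sup>2 + 4 * K' + 4 * K'\<^sup>2 * e\<^sup>2 / \<sigma>\<^sup>2) * h\<^sup>2 + 4 * h * X / e\<^sup>2 - 4 * h * K' * \<eta>
    + 2 * \<sigma>\<^sup>2 * d * h / e\<^sup>2 - 4 * \<sigma>\<^sup>2 * n\<^sup>2 / e ^ 4 < 0"
proof -
  define a where "a = n / e"
  have a: "0 \<le> a" "a \<le> 1" using assms by (auto simp: a_def)
  have n: "n = a * e" using \<open>e > 0\<close> by (simp add: a_def)
  have "K' \<ge> 0" using assms by (simp add: K')
  have "0 \<le> (\<sigma> * a / e - 2 * A * h / \<sigma>)\<^sup>2" by simp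
  also have "\<dots> = \<sigma>\<^sup>2 * a\<^sup>2 / e\<^sup>2 + 4 * A\<^sup>2 * h\<^sup>2 / \<sigma>\<^sup>2 - 4 * h * (n * A) / e\<^sup>2"
    using assms(1,2) by (simp add: n field_simps power2_eq_square)
  finally have 1: "4 * h * (n * A) / e\<^sup>2 \<le> \<sigma>\<^sup>2 * a\<^sup>2 / e\<^sup>2 + 4 * A\<^sup>2 * h\<^sup>2 / \<sigma>\<^sup>2" by simp
  have 2: "4 * h * X / e\<^sup>2 \<le> 4 * h * (n * A) / e\<^sup>2"
    using assms by (intro divide_right_mono mult_left_mono) auto
  have "0 \<le> (\<sigma> * a / e - 2 * K' * e * h / \<sigma>)\<^sup>2" by simp
  also have "\<dots> = \<sigma>\<^sup>2 * a\<^sup>2 / e\<^sup>2 + 4 * K'\<^sup>2 * e\<^sup>2 * h\<^sup>2 / \<sigma>\<^sup>2 - 4 * h * K' * a"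
    using assms(1,2) by (simp add: field_simps power2_eq_square)
  finally have 3: "4 * h * K' * a \<le> \<sigma>\<^sup>2 * a\<^sup>2 / e\<^sup>2 + 4 * K'\<^sup>2 * e\<^sup>2 * h\<^sup>2 / \<sigma>\<^sup>2" by simp
  have "a\<^sup>2 \<le> a" using a by (simp add: power2_eq_square mult_left_le)
  then have 4: "4 * h * K' * a\<^sup>2 \<le> 4 * h * K' * a"
    using \<open>h > 0\<close> \<open>K' \<ge> 0\<close> by (intro mult_left_mono) auto
  have 5: "2 * \<sigma>\<^sup>2 * d * h / e\<^sup>2 = 4 * h * K'" using \<open>e > 0\<close> by (simp add: K' field_simps)
  have 6: "4 * \<sigma>\<^sup>2 * n\<^sup>2 / e ^ 4 = 4 * (\<sigma>\<^sup>2 * a\<^sup>2 / e\<^sup>2)"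
    using \<open>e > 0\<close> by (simp add: n field_simps power2_eq_square power4_eq_xxxx)
  have 7: "\<eta> = 1 - a\<^sup>2 - h" by (simp add: \<eta> a_def power_divide)
  have 8: "4 * h * K' * \<eta> = 4 * h * K' - 4 * h * K' * a\<^sup>2 - 4 * K' * h\<^sup>2"
    by (simp add: 7 algebra_simps power2_eq_square)
  have 9: "\<sigma>\<^sup>2 * a\<^sup>2 / e\<^sup>2 \<ge> 0" "h\<^sup>2 > 0" using \<open>h > 0\<close> by auto
  have 10: "- (1 + 4 * A\<^sup>2 / \<sigma>\<^sup>2 + 4 * K' + 4 * K'\<^sup>2 * e\<^sup>2 / \<sigma>\<^sup>2) * h\<^sup>2 =
    - h\<^sup>2 - 4 * A\<^sup>2 * h\<^sup>2 / \<sigma>\<^sup>2 - 4 * K' * h\<^sup>2 - 4 * K'\<^sup>2 * e\<^sup>2 * h\<^sup>2 / \<sigma>\<^sup>2"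
    by (simp add: algebra_simps)
  show ?thesis using 1 2 3 4 9 unfolding 5 6 8 10 by linarith
qed

text \<open>
  Around the curve, with velocity perturbation \<open>p - P t\<close> and position perturbation \<open>q - Q t\<close>, the
  barrier \<open>exp (- K (t - t1)) h\<^sup>2\<close> is a strict subsolution in the tube \<open>{h > 0}\<close>. Where the
  velocity perturbation is not small, the diffusion acting on the square \<open>h\<^sup>2\<close> gives the sign near
  the lateral boundary; where it is small, the position radius shrinks fast enough.
\<close>

lemma (in kinetic_subsolution) strict_bound_along_curve:
  assumes Q: "\<And>t. (Q has_vector_derivative - P t) (at t)"
    and P: "\<And>t. (P has_vector_derivative R t) (at t)"
    and R: "continuous_on UNIV R"
    and t1: "0 < t1" and t10: "t1 \<le> t0" and inO: "\<And>t. t1 \<le> t \<Longrightarrow> t \<le> t0 \<Longrightarrow> Q t \<in> \<O>"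
    and le: "\<And>t q p. t > 0 \<Longrightarrow> q \<in> \<O> \<Longrightarrow> u (t, q, p) \<le> M"
    and start: "u (t1, Q t1, P t1) < M"
  shows "u (t0, Q t0, P t0) < M"
proof -
  have contQ: "continuous_on S Q" and contP: "continuous_on S P" for S
    by (rule continuous_on_vector_derivative, rule has_vector_derivative_at_within, rule Q)
       (rule continuous_on_vector_derivative, rule has_vector_derivative_at_within, rule P)
  have cQ: "compact (Q ` {t1..t0})" "Q ` {t1..t0} \<subseteq> \<O>"
    using contQ inO by (auto intro!: compact_continuous_image)
  obtain \<delta> where \<delta>: "\<delta> > 0" "(\<Union>x\<in>Q ` {t1..t0}. cball x \<delta>) \<subseteq> \<O>"
    by (rule compact_subset_open_imp_cball_epsilon_subset[OF cQ(1) open_O cQ(2)])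
  define m where "m = (M - u (t1, Q t1, P t1)) / 2"
  have "m > 0" using start by (simp add: m_def)
  have "open (({0<..} :: real set) \<times> \<O> \<times> (UNIV :: 'a set))"
    using open_O by (intro open_Times) auto
  moreover have "(t1, Q t1, P t1) \<in> {0<..} \<times> \<O> \<times> UNIV" using t1 t10 inO[of t1] by auto
  ultimately have "isCont u (t1, Q t1, P t1)"
    using continuous_u continuous_on_eq_continuous_at by blast
  then obtain d where d: "d > 0" "\<And>z. dist z (t1, Q t1, P t1) < d \<Longrightarrow> dist (u z) (u (t1, Q t1, P t1)) < m"
    using \<open>m > 0\<close> unfolding continuous_at_eps_delta by blast
  define e where "e = min \<delta> (d / 4)"
  have e: "e > 0" "e \<le> \<delta>" "4 * e \<le> d" using \<delta> d by (auto simp: e_def)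
  define K' where "K' = \<sigma>\<^sup>2 * DIM('a) / (2 * e\<^sup>2)"
  have "K' \<ge> 0" by (simp add: K'_def)
  define E where "E = (\<lambda>t. exp (2 * K' * (t - t1)))"
  have E1: "E t \<ge> 1" if "t1 \<le> t" for t using that \<open>K' \<ge> 0\<close> by (simp add: E_def)
  define h where "h = (\<lambda>(t, q, p). 1 - (p - P t) \<bullet> (p - P t) / e\<^sup>2
      - exp (2 * K' * (t - t1)) * ((q - Q t) \<bullet> (q - Q t)) / e\<^sup>2)"
  define Z where "Z = {z. t1 \<le> fst z \<and> fst z \<le> t0 \<and> h z \<ge> 0}"
  have near: "norm (p - P t) \<le> e" "norm (q - Q t) \<le> e"
    if t: "t1 \<le> t" and h: "h (t, q, p) \<ge> 0" for t q p
  proof -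
    have "((norm (p - P t))\<^sup>2 + E t * (norm (q - Q t))\<^sup>2) / e\<^sup>2 \<le> 1"
      using h by (simp add: h_def E_def power2_norm_eq_inner add_divide_distrib)
    then have "(norm (p - P t))\<^sup>2 + E t * (norm (q - Q t))\<^sup>2 \<le> e\<^sup>2"
      using e by simp
    moreover have "(norm (q - Q t))\<^sup>2 \<le> E t * (norm (q - Q t))\<^sup>2"
      using mult_right_mono[OF E1[OF t], of "(norm (q - Q t))\<^sup>2"] by simp
    ultimately have "(norm (p - P t))\<^sup>2 \<le> e\<^sup>2" "(norm (q - Q t))\<^sup>2 \<le> e\<^sup>2"
      by (smt (verit) zero_le_power2)+
    then show "norm (p - P t) \<le> e" "norm (q - Q t) \<le> e"
      using e by (auto simp: power_mono_iff)
  qed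
  have conth: "continuous_on UNIV h"
    unfolding h_def split_def using e
    by (intro continuous_intros continuous_on_compose2[OF contP[of UNIV]] continuous_on_compose2[OF contQ[of UNIV]]) auto
  have ZO: "q \<in> \<O>" if "(t, q, p) \<in> Z" for t q p
  proof -
    have "q \<in> cball (Q t) \<delta>"
      using near(2)[of t q p] that e by (auto simp: Z_def dist_norm norm_minus_commute)
    moreover have "Q t \<in> Q ` {t1..t0}" using that by (auto simp: Z_def)
    ultimately show ?thesis using \<delta>(2) by blast
  qed
  have "compact Z"
  proof -
    have "bounded (Q ` {t1..t0})" "bounded (P ` {t1..t0})"
      using contQ contP by (auto intro!: compact_imp_bounded compact_continuous_image)
    then obtain BQ BP where B: "\<And>t. t \<in> {t1..t0} \<Longrightarrow> norm (Q t) \<le> BQ" "\<And>t. t \<in> {t1..t0} \<Longrightarrow> norm (P t) \<le> BP"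
      unfolding bounded_iff by (metis imageI)
    have "Z \<subseteq> {t1..t0} \<times> cball 0 (BQ + e) \<times> cball 0 (BP + e)"
    proof
      fix z assume z: "z \<in> Z"
      obtain t q p where zz: "z = (t, q, p)" by (cases z) auto
      have "norm q \<le> BQ + e" "norm p \<le> BP + e"
        using near[of t q p] z B[of t] norm_triangle_ineq2[of q "Q t"] norm_triangle_ineq2[of p "P t"]
        by (auto simp: Z_def zz)
      then show "z \<in> {t1..t0} \<times> cball 0 (BQ + e) \<times> cball 0 (BP + e)"
        using z by (auto simp: Z_def zz)
    qed
    then have "bounded Z"
      by (rule bounded_subset[rotated]) (intro bounded_Times bounded_cball bounded_closed_interval)
    moreover have "closed Z"
      unfolding Z_def by (intro closed_Collect_conj closed_Collect_le continuous_intros conth)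
    ultimately show ?thesis by (simp add: compact_eq_bounded_closed)
  qed
  define A0 where "A0 = (\<lambda>(t, q, p). drift q p + R t + E t *\<^sub>R (q - Q t))"
  have "continuous_on Z A0"
    unfolding A0_def split_def drift_def E_def
    by (intro continuous_intros continuous_on_compose2[OF contQ[of UNIV]]
      continuous_on_compose2[OF cont_F] continuous_on_compose2[OF R]) auto
  then have "bounded (A0 ` Z)"
    using \<open>compact Z\<close> compact_continuous_image compact_imp_bounded by blast
  then obtain A where A: "\<And>z. z \<in> Z \<Longrightarrow> norm (A0 z) \<le> A"
    unfolding bounded_iff by blast
  \<comment> \<open>The choices are made in the order e, \<open>K'\<close>, tube Z, bound A on Z,
    and only then K, which enters nothing but the amplitude of \<open>\<phi>\<close>.\<close>
  define K where "K = 1 + 4 * A\<^sup>2 / \<sigma>\<^sup>2 + 4 * K' + 4 * K'\<^sup>2 * e\<^sup>2 / \<sigma>\<^sup>2"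
  have "K \<ge> 0" using \<open>K' \<ge> 0\<close> by (simp add: K_def)
  define \<phi> where "\<phi> = (\<lambda>z. exp (- K * (fst z - t1)) * (h z)\<^sup>2)"
  have val: "\<exists>l<0. has_kinetic_value \<sigma> (drift q p) \<phi> t q p l"
    if z: "(t, q, p) \<in> Z" and h0: "h (t, q, p) > 0" for t q p
  proof -
    let ?H = "h (t, q, p)" and ?v = "p - P t" and ?X = "(p - P t) \<bullet> (drift q p + R t + E t *\<^sub>R (q - Q t))"
    let ?\<eta> = "E t * ((q - Q t) \<bullet> (q - Q t)) / e\<^sup>2"
    let ?l = "exp (- K * (t - t1)) * (- K * ?H\<^sup>2 + 4 * ?H * ?X / e\<^sup>2 - 4 * ?H * K' * ?\<eta>
      + 2 * \<sigma>\<^sup>2 * DIM('a) * ?H / e\<^sup>2 - 4 * \<sigma>\<^sup>2 * (?v \<bullet> ?v) / e ^ 4)"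
    have "?X \<le> norm ?v * norm (A0 (t, q, p))"
      using norm_cauchy_schwarz by (simp add: A0_def)
    also have "\<dots> \<le> norm ?v * A"
      using A[OF z] by (intro mult_left_mono) auto
    finally have X: "?X \<le> norm ?v * A" .
    have "- K * ?H\<^sup>2 + 4 * ?H * ?X / e\<^sup>2 - 4 * ?H * K' * ?\<eta>
      + 2 * \<sigma>\<^sup>2 * DIM('a) * ?H / e\<^sup>2 - 4 * \<sigma>\<^sup>2 * (norm ?v)\<^sup>2 / e ^ 4 < 0"
      unfolding K_def
    proof (rule tube_inequality[OF sigma_pos e(1) h0 _ _ _ X K'_def])
      show "norm ?v \<le> e" using near[of t q p] z by (auto simp: Z_def)
      show "?\<eta> = 1 - (norm ?v)\<^sup>2 / e\<^sup>2 - ?H"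
        by (simp add: h_def E_def power2_norm_eq_inner)
    qed auto
    then have "?l < 0" by (simp add: power2_norm_eq_inner mult_pos_neg)
    moreover have "has_kinetic_value \<sigma> (drift q p) \<phi> t q p ?l"
      using tube_function_kinetic_value[where P = P and Q = Q and R = R and c = "drift q p" and q = q and p = p and K = K and K' = K'
          and \<tau> = t1 and \<sigma> = \<sigma> and e = e, OF Q[of t] P[of t]] e
      unfolding \<phi>_def h_def E_def by simp
    ultimately show ?thesis by blast
  qed
  define f where "f = (\<lambda>z. u z + m * \<phi> z)"
  have phi_bd: "\<phi> z \<le> 1" if "z \<in> Z" for z
  proof -
    obtain t q p where zz: "z = (t, q, p)" by (cases z) auto
    have "0 \<le> (p - P t) \<bullet> (p - P t) / e\<^sup>2"
      "0 \<le> exp (2 * K' * (t - t1)) * ((q - Q t) \<bullet> (q - Q t)) / e\<^sup>2" by auto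
    then have "h z \<le> 1" unfolding h_def zz prod.case by linarith
    then have "(h z)\<^sup>2 \<le> 1" using that by (simp add: Z_def power_le_one)
    moreover have "exp (- K * (fst z - t1)) \<le> 1" using that \<open>K \<ge> 0\<close> by (simp add: Z_def)
    ultimately show ?thesis unfolding \<phi>_def by (simp add: mult_le_one)
  qed
  have cont_phi: "continuous_on Z \<phi>"
    unfolding \<phi>_def by (intro continuous_intros continuous_on_subset[OF conth]) auto
  have Zdom: "Z \<subseteq> {0<..} \<times> \<O> \<times> UNIV"
    using ZO t1 by (force simp: Z_def)
  have "continuous_on Z f"
    unfolding f_def by (intro continuous_intros cont_phi continuous_on_subset[OF continuous_u Zdom])
  moreover have end_in: "(t0, Q t0, P t0) \<in> Z"
    using t10 by (simp add: Z_def h_def)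
  ultimately obtain z where z: "z \<in> Z" and zmax: "\<And>y. y \<in> Z \<Longrightarrow> f y \<le> f z"
    using continuous_attains_sup[OF \<open>compact Z\<close>, of f] by blast
  obtain t q p where zz: "z = (t, q, p)" by (cases z) auto
  \<comment> \<open>A value above M is attained neither where h = 0, since f = u there, nor at time
    t1, where \<open>u < M - m\<close> and \<open>\<phi> \<le> 1\<close>. At any other point of Z a
    maximum contradicts the comparison with \<open>- m * \<phi>\<close>.\<close>
  have "f z \<le> M"
  proof (rule ccontr)
    assume "\<not> f z \<le> M"
    then have fM: "f z > M" by simp
    have t: "t1 \<le> t" "t \<le> t0" "h z \<ge> 0" using z by (auto simp: Z_def zz)
    have uM: "u z \<le> M" using le[of t q p] t t1 ZO z by (simp add: zz)
    have "h z \<noteq> 0" using fM uM by (auto simp: f_def \<phi>_def)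
    with t have hz: "h z > 0" by simp
    have "t \<noteq> t1"
    proof
      assume "t = t1"
      have "dist z (t1, Q t1, P t1) \<le> norm (q - Q t1) + norm (p - P t1)"
        using norm_Pair_le[of "q - Q t1" "p - P t1"]
        by (simp add: zz \<open>t = t1\<close> dist_Pair_Pair dist_norm norm_Pair)
      also have "\<dots> < d" using near[of t q p] t e \<open>t = t1\<close> by (simp add: zz)
      finally have "dist (u z) (u (t1, Q t1, P t1)) < m" by (rule d)
      then have "u z < u (t1, Q t1, P t1) + m" by (simp add: dist_real_def abs_less_iff)
      then have "u z < M - m" by (simp add: m_def field_simps)
      moreover have "m * \<phi> z \<le> m" using phi_bd[OF z] \<open>m > 0\<close> by simp
      ultimately show False using fM by (simp add: f_def)
    qed
    with t have t': "t1 < t" by simp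
    have "isCont h z" using conth by (simp add: zz continuous_on_eq_continuous_at)
    then obtain r where r: "r > 0" "\<And>y. dist y z < r \<Longrightarrow> dist (h y) (h z) < h z"
      using hz unfolding continuous_at_eps_delta by blast
    obtain l where l: "l < 0" "has_kinetic_value \<sigma> (drift q p) \<phi> t q p l"
      using val z hz unfolding zz by blast
    have "- m * l \<le> 0"
    proof (rule comparison_at_max)
      show "has_kinetic_value \<sigma> (drift q p) (\<lambda>z. - m * \<phi> z) t q p (- m * l)"
        by (rule has_kinetic_value_cmult[OF l(2)])
      show "min r (t - t1) > 0" using r t' by simp
      show "u (t', q', p') - - m * \<phi> (t', q', p') \<le> u (t, q, p) - - m * \<phi> (t, q, p)"
        if "t' \<le> t" and dist: "dist (t', q', p') (t, q, p) < min r (t - t1)" for t' q' p'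
      proof -
        have "dist t' t \<le> dist (t', q', p') (t, q, p)"
          using dist_fst_le[of "(t', q', p')" "(t, q, p)"] by simp
        then have "t1 \<le> t'" using dist by (auto simp: dist_real_def abs_le_iff)
        moreover have "h (t', q', p') > 0"
          using r(2)[of "(t', q', p')"] dist by (simp add: zz dist_real_def)
        ultimately have "(t', q', p') \<in> Z" using \<open>t' \<le> t\<close> t by (simp add: Z_def)
        from zmax[OF this] show ?thesis by (simp add: f_def zz)
      qed
    qed (use t' t1 ZO z zz in auto)
    then show False using l(1) \<open>m > 0\<close> by (simp add: zero_le_mult_iff not_le)
  qed
  then have "u (t0, Q t0, P t0) + m * \<phi> (t0, Q t0, P t0) \<le> M"
    using zmax[OF end_in] by (simp add: f_def)
  moreover have "\<phi> (t0, Q t0, P t0) > 0" by (simp add: \<phi>_def h_def)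
  ultimately show ?thesis using mult_pos_pos[OF \<open>m > 0\<close>] by (smt (verit))
qed

section \<open>Curves with prescribed end points and end velocities\<close>

text \<open>Bernoulli's inequality bounds 1 + m s by the m-th power of 1 + s, and (1 + s) (1 - s) is
  at most 1. This makes the velocity corrections of the curve below small for large
  exponents.\<close>

lemma mult_power_one_minus_le:
  fixes s :: real
  assumes "0 \<le> s" "s \<le> 1" "m > 0"
  shows "s * (1 - s) ^ m \<le> 1 / m"
proof -
  have "(1 + m * s) * (1 - s) ^ m \<le> (1 + s) ^ m * (1 - s) ^ m"
    using Bernoulli_inequality[of s m] assms by (intro mult_right_mono) (auto simp: algebra_simps)
  also have "\<dots> = ((1 - s\<^sup>2)) ^ m"
    by (simp add: power_mult_distrib[symmetric] algebra_simps power2_eq_square)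
  also have "\<dots> \<le> 1" using assms by (intro power_le_one) (auto simp: abs_square_le_1)
  finally have "m * (s * (1 - s) ^ m) + (1 - s) ^ m \<le> 1" by (simp add: algebra_simps)
  moreover have "(1 - s) ^ m \<ge> 0" using assms by simp
  ultimately have "m * (s * (1 - s) ^ m) \<le> 1" by linarith
  then show ?thesis using assms by (simp add: field_simps)
qed

text \<open>
  Hermite interpolation. The factors \<open>(1 - s) ^ (n + 2)\<close> make the contribution of the prescribed
  velocities as small as desired, so that the curve stays close to the segment.
\<close>

lemma curve_near_segment:
  fixes a b \<alpha> \<beta> :: "'a::euclidean_space" and t1 t0 :: real
  assumes "open S" "closed_segment a b \<subseteq> S" "t1 < t0"
  obtains Q P R where
    "\<And>t. (Q has_vector_derivative - P t) (at t)" "\<And>t. (P has_vector_derivative R t) (at t)"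
    "continuous_on UNIV R" "Q t1 = a" "P t1 = \<alpha>" "Q t0 = b" "P t0 = \<beta>"
    "\<And>t. t1 \<le> t \<Longrightarrow> t \<le> t0 \<Longrightarrow> Q t \<in> S"
proof -
  define T where "T = t0 - t1"
  have "T > 0" using assms by (simp add: T_def)
  obtain \<delta> where \<delta>: "\<delta> > 0" "(\<Union>x\<in>closed_segment a b. cball x \<delta>) \<subseteq> S"
    by (rule compact_subset_open_imp_cball_epsilon_subset[OF compact_segment(1) assms(1,2)])
  \<comment> \<open>The distance to the segment will be at most
    \<open>T * (norm \<alpha> + norm \<beta>) / (n + 2)\<close>.\<close>
  obtain n :: nat where n: "T * (norm \<alpha> + norm \<beta>) / \<delta> < n"
    using reals_Archimedean2 by blast
  define s where "s = (\<lambda>t. (t - t1) / T)"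
  \<comment> \<open>f vanishes at both ends, and its derivative is T at 0 and 0 at 1, so it installs
    an end velocity without moving the end points. Writing the exponent as n + 2 keeps the second
    derivative free of subtraction on naturals.\<close>
  define f where "f = (\<lambda>s. T * s * (1 - s) ^ (n + 2))"
  define f1 where "f1 = (\<lambda>s::real. (1 - s) ^ (n + 2) - (n + 2) * s * (1 - s) ^ (n + 1))"
  define f2 where "f2 = (\<lambda>s::real. (- (2 * (n + 2)) * (1 - s) ^ (n + 1) + (n + 2) * (n + 1) * s * (1 - s) ^ n) / T)"
  \<comment> \<open>It goes from 0 to 1 with zero derivative at both ends, so the motion along the
    segment adds nothing to the end velocities.\<close>
  define \<theta> where "\<theta> = (\<lambda>s::real. 3 * s\<^sup>2 - 2 * s ^ 3)"
  define \<theta>1 where "\<theta>1 = (\<lambda>s. (6 * s - 6 * s\<^sup>2) / T)"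
  define \<theta>2 where "\<theta>2 = (\<lambda>s. (6 - 12 * s) / T\<^sup>2)"
  have ds: "(s has_real_derivative 1 / T) (at t)" for t
    unfolding s_def using \<open>T > 0\<close> by (auto intro!: derivative_eq_intros)
  have dr: "((\<lambda>t. 1 - s t) has_real_derivative - 1 / T) (at t)" for t
    using \<open>T > 0\<close> by (auto intro!: derivative_eq_intros ds)
  have df: "(f has_real_derivative T * f1 x) (at x)" for x
    unfolding f_def f1_def
    by (rule derivative_eq_intros refl | simp)+ (simp add: algebra_simps)
  have df1: "(f1 has_real_derivative T * f2 x) (at x)" for x
    unfolding f1_def f2_def using \<open>T > 0\<close>
    by - ((rule derivative_eq_intros refl | (simp; fail))+, simp, simp add: algebra_simps)
  have dc: "(\<theta> has_real_derivative T * \<theta>1 x) (at x)" for x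
    unfolding \<theta>_def \<theta>1_def using \<open>T > 0\<close>
    by (auto intro!: derivative_eq_intros simp: field_simps power2_eq_square)
  have dc1: "(\<theta>1 has_real_derivative T * \<theta>2 x) (at x)" for x
    unfolding \<theta>1_def \<theta>2_def using \<open>T > 0\<close>
    by (auto intro!: derivative_eq_intros simp: field_simps power2_eq_square)
  define Q where "Q = (\<lambda>t. a + \<theta> (s t) *\<^sub>R (b - a) - f (s t) *\<^sub>R \<alpha> + f (1 - s t) *\<^sub>R \<beta>)"
  define P where "P = (\<lambda>t. - \<theta>1 (s t) *\<^sub>R (b - a) + f1 (s t) *\<^sub>R \<alpha> + f1 (1 - s t) *\<^sub>R \<beta>)"
  define R where "R = (\<lambda>t. - \<theta>2 (s t) *\<^sub>R (b - a) + f2 (s t) *\<^sub>R \<alpha> - f2 (1 - s t) *\<^sub>R \<beta>)"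
  have chain: "((\<lambda>t. g (s t)) has_real_derivative g' (s t)) (at t)"
    "((\<lambda>t. g (1 - s t)) has_real_derivative - g' (1 - s t)) (at t)"
    if "\<And>x. (g has_real_derivative T * g' x) (at x)" for g g' t
    using DERIV_chain2[OF that ds] DERIV_chain2[OF that dr] \<open>T > 0\<close> by simp_all
  have "(Q has_vector_derivative - P t) (at t)" for t
    unfolding Q_def P_def
    by (rule derivative_eq_intros chain[OF df] chain[OF dc] refl)+ (simp add: algebra_simps)
  moreover have "(P has_vector_derivative R t) (at t)" for t
    unfolding P_def R_def
    by (rule derivative_eq_intros chain[OF df1] chain[OF dc1] refl)+ (simp add: algebra_simps)
  moreover have "continuous_on UNIV R"
    unfolding R_def f2_def \<theta>2_def s_def using \<open>T > 0\<close> by (intro continuous_intros) auto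
  moreover have s01: "s t1 = 0" "s t0 = 1" using \<open>T > 0\<close> by (auto simp: s_def T_def)
  then have "Q t1 = a" "P t1 = \<alpha>" "Q t0 = b" "P t0 = \<beta>"
    by (simp_all add: Q_def P_def f_def f1_def \<theta>_def \<theta>1_def)
  moreover have "Q t \<in> S" if t: "t1 \<le> t" "t \<le> t0" for t
  proof -
    have st: "0 \<le> s t" "s t \<le> 1" using t \<open>T > 0\<close> by (auto simp: s_def T_def field_simps)
    have "\<theta> (s t) = (s t)\<^sup>2 * (3 - 2 * s t)" "1 - \<theta> (s t) = (1 - s t)\<^sup>2 * (1 + 2 * s t)"
      by (simp_all add: \<theta>_def algebra_simps power2_eq_square power3_eq_cube)
    then have \<theta>: "0 \<le> \<theta> (s t)" "\<theta> (s t) \<le> 1"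
      using st by (simp, smt (verit) mult_nonneg_nonneg zero_le_power2)
    define x where "x = a + \<theta> (s t) *\<^sub>R (b - a)"
    have "x \<in> closed_segment a b"
      unfolding closed_segment_def x_def using \<theta> by (auto simp: algebra_simps intro!: exI[of _ "\<theta> (s t)"])
    moreover have "Q t \<in> cball x \<delta>"
    proof -
      have fb: "\<bar>f y\<bar> \<le> T / (n + 2)" if "0 \<le> y" "y \<le> 1" for y
      proof -
        have "y * (1 - y) ^ (n + 2) \<le> 1 / (n + 2)"
          using mult_power_one_minus_le[OF that, of "n + 2"] by simp
        then have "T * (y * (1 - y) ^ (n + 2)) \<le> T * (1 / (n + 2))"
          using \<open>T > 0\<close> by (intro mult_left_mono) auto
        moreover have "f y \<ge> 0" using that \<open>T > 0\<close> by (simp add: f_def)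
        ultimately show ?thesis by (simp add: f_def mult.assoc)
      qed
      have "dist x (Q t) = norm (f (s t) *\<^sub>R \<alpha> - f (1 - s t) *\<^sub>R \<beta>)"
        by (simp add: dist_norm x_def Q_def)
      also have "\<dots> \<le> \<bar>f (s t)\<bar> * norm \<alpha> + \<bar>f (1 - s t)\<bar> * norm \<beta>"
        by (metis norm_scaleR norm_triangle_ineq4)
      also have "\<dots> \<le> T / (n + 2) * norm \<alpha> + T / (n + 2) * norm \<beta>"
        using st by (intro add_mono mult_right_mono fb) auto
      also have "\<dots> = T * (norm \<alpha> + norm \<beta>) / (n + 2)" by (simp add: add_divide_distrib algebra_simps)
      also have "\<dots> \<le> \<delta>"
        using n \<delta>(1) by (simp add: field_simps)
      finally show ?thesis by simp
    qed
    ultimately show ?thesis using \<delta>(2) by blast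
  qed
  ultimately show ?thesis by (rule that)
qed

section \<open>Strong maximum principle\<close>

context kinetic_subsolution
begin

lemma strict_bound_along_segment:
  assumes le: "\<And>t q p. t > 0 \<Longrightarrow> q \<in> \<O> \<Longrightarrow> u (t, q, p) \<le> M"
    and "closed_segment a b \<subseteq> \<O>" "0 < t1" "t1 < t0" "u (t1, a, \<alpha>) < M"
  shows "u (t0, b, \<beta>) < M"
proof -
  obtain Q P R where *: "\<And>t. (Q has_vector_derivative - P t) (at t)" "\<And>t. (P has_vector_derivative R t) (at t)"
    "continuous_on UNIV R" "Q t1 = a" "P t1 = \<alpha>" "Q t0 = b" "P t0 = \<beta>"
    "\<And>t. t1 \<le> t \<Longrightarrow> t \<le> t0 \<Longrightarrow> Q t \<in> \<O>"
    using curve_near_segment[OF open_O assms(2,4)] by metis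
  show ?thesis
    using strict_bound_along_curve[OF *(1-3) assms(3) less_imp_le[OF assms(4)] *(8) le] * assms(5) by simp
qed

text \<open>A segment can be crossed in any positive time with any end velocities, so a strict bound
  at one point gives it at once for all later times and all velocities. In this form no time is used
  up in passing from ball to ball, and the property depends on the position alone, as induction over
  a connected set requires.\<close>

lemma strict_bound_propagates:
  assumes le: "\<And>t q p. t > 0 \<Longrightarrow> q \<in> \<O> \<Longrightarrow> u (t, q, p) \<le> M"
    and conn: "connected \<O>" and q1: "q1 \<in> \<O>" and q0: "q0 \<in> \<O>" and t: "0 < t1" "t1 < t0"
    and lt: "u (t1, q1, p1) < M"
  shows "u (t0, q0, p0) < M"
proof -
  define B where "B = (\<lambda>q. \<forall>t>t1. \<forall>p. u (t, q, p) < M)"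
  have "B q0"
  proof (rule connected_induction_simple[OF conn q1 q0])
    show "B q1"
      using strict_bound_along_segment[OF le, of q1 q1 t1] q1 t lt by (auto simp: B_def)
    fix a assume "a \<in> \<O>"
    then obtain r where r: "r > 0" "ball a r \<subseteq> \<O>" using open_O openE by blast
    have "B y" if xy: "x \<in> ball a r" "y \<in> ball a r" and x: "B x" for x y
      unfolding B_def
    proof (intro allI impI)
      fix t p assume "t1 < t"
      have "closed_segment x y \<subseteq> \<O>"
        using closed_segment_subset[OF xy convex_ball] r by blast
      moreover have "u ((t1 + t) / 2, x, 0) < M" using x \<open>t1 < t\<close> by (simp add: B_def)
      ultimately show "u (t, y, p) < M"
        using strict_bound_along_segment[OF le, of x y "(t1 + t) / 2" t] t \<open>t1 < t\<close> by auto
    qed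
    moreover have "openin (top_of_set \<O>) (ball a r)" "a \<in> ball a r"
      using r open_O by (simp_all add: openin_open_eq)
    ultimately show "\<exists>T. openin (top_of_set \<O>) T \<and> a \<in> T \<and> (\<forall>x\<in>T. \<forall>y\<in>T. B x \<longrightarrow> B y)"
      by blast
  qed
  then show ?thesis using t by (simp add: B_def)
qed

text \<open>Propagation needs a strictly earlier starting time. Continuity in time moves the strict
  bound back to some s < t, which is what includes the case t = t0.\<close>

lemma strong_maximum_principle:
  assumes conn: "connected \<O>" and t0: "t0 > 0" and q0: "q0 \<in> \<O>"
    and max: "\<And>t q p. t > 0 \<Longrightarrow> q \<in> \<O> \<Longrightarrow> u (t, q, p) \<le> u (t0, q0, p0)"
    and t: "0 < t" "t \<le> t0" and q: "q \<in> \<O>"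
  shows "u (t, q, p) = u (t0, q0, p0)"
proof (rule ccontr)
  assume "u (t, q, p) \<noteq> u (t0, q0, p0)"
  with max[OF t(1) q] have lt: "u (t, q, p) < u (t0, q0, p0)" by (simp add: less_le)
  have "(\<lambda>s. u (s, q, p)) differentiable (at t)"
    using smooth t q by (auto simp: C_1_2_on_def)
  then have "isCont (\<lambda>s. u (s, q, p)) t" by (rule differentiable_imp_continuous_within)
  then have "\<forall>\<^sub>F s in at t. u (s, q, p) < u (t0, q0, p0)"
    using lt by (simp add: isCont_def order_tendsto_iff)
  then have "\<forall>\<^sub>F s in at_left t. u (s, q, p) < u (t0, q0, p0)"
    by (simp add: eventually_at_split)
  moreover have "\<forall>\<^sub>F s in at_left t. 0 < s \<and> s < t"
    using t(1) by (auto simp: eventually_at_left_field intro!: exI[of _ 0])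
  ultimately have "\<forall>\<^sub>F s in at_left t. 0 < s \<and> s < t \<and> u (s, q, p) < u (t0, q0, p0)"
    by eventually_elim simp
  then obtain s where s: "0 < s" "s < t" "u (s, q, p) < u (t0, q0, p0)"
    using eventually_happens'[OF trivial_limit_at_left_real] by blast
  show False
    using strict_bound_propagates[OF max conn q q0 s(1) _ s(3), of t0 p0] s t by simp
qed

end

section \<open>Boundary charts\<close>

text \<open>Second derivatives are given as continuous for one pair of directions at a time.
  Finitely many pairs of basis vectors suffice: the sum of their absolute values is bounded on a
  closed ball and dominates the operator norm of H.\<close>

lemma C2_gradient:
  fixes \<phi> :: "'a::euclidean_space \<Rightarrow> real"
  assumes \<phi>: "C_k_on 2 \<phi> U" and U: "open U" and q0: "q0 \<in> U"
  obtains H r B where "r > 0" "ball q0 r \<subseteq> U" "B \<ge> 0"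
    "\<And>x. x \<in> U \<Longrightarrow> (\<phi> has_derivative (\<lambda>w. gradient \<phi> x \<bullet> w)) (at x)"
    "\<And>x. x \<in> U \<Longrightarrow> (gradient \<phi> has_derivative H x) (at x)"
    "\<And>x w. x \<in> ball q0 r \<Longrightarrow> norm (H x w) \<le> B * norm w"
proof -
  define \<phi>2 where "\<phi>2 = (\<lambda>b x w. frechet_derivative (\<lambda>x. frechet_derivative \<phi> (at x) b) (at x) w)"
  have diff: "\<phi> differentiable (at x)" if "x \<in> U" for x
    using \<phi> that by (simp add: numeral_2_eq_2)
  have diff2: "(\<lambda>x. frechet_derivative \<phi> (at x) b) differentiable (at x)" if "x \<in> U" for x b
    using \<phi> that by (simp add: numeral_2_eq_2)
  have cont: "continuous_on U (\<lambda>x. \<phi>2 b x w)" for b w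
    using \<phi> by (simp add: numeral_2_eq_2 \<phi>2_def)
  define H where "H = (\<lambda>x w. \<Sum>b\<in>Basis. \<phi>2 b x w *\<^sub>R b)"
  have H: "(gradient \<phi> has_derivative H x) (at x)" if "x \<in> U" for x
  proof -
    have "((\<lambda>x. frechet_derivative \<phi> (at x) b) has_derivative \<phi>2 b x) (at x)" for b
      unfolding \<phi>2_def using diff2[OF that, of b] by (simp add: frechet_derivative_works)
    then show ?thesis
      unfolding H_def gradient_def[abs_def]
      by (intro has_derivative_sum has_derivative_scaleR_left)
  qed
  obtain r where r: "r > 0" "cball q0 r \<subseteq> U"
    using U q0 open_contains_cball by blast
  have "continuous_on (cball q0 r) (\<lambda>x. \<Sum>b\<in>Basis. \<Sum>c\<in>Basis. \<bar>\<phi>2 b x c\<bar>)"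
    by (intro continuous_intros continuous_on_subset[OF cont] r(2))
  then have "bounded ((\<lambda>x. \<Sum>b\<in>Basis. \<Sum>c\<in>Basis. \<bar>\<phi>2 b x c\<bar>) ` cball q0 r)"
    by (intro compact_imp_bounded compact_continuous_image) auto
  then obtain B where B: "\<And>x. x \<in> cball q0 r \<Longrightarrow> \<bar>\<Sum>b\<in>Basis. \<Sum>c\<in>Basis. \<bar>\<phi>2 b x c\<bar>\<bar> \<le> B"
    unfolding bounded_iff real_norm_def by blast
  have "norm (H x w) \<le> \<bar>B\<bar> * norm w" if x: "x \<in> ball q0 r" for x w
  proof -
    have "x \<in> U" using x r by auto
    have "\<bar>\<phi>2 b x w\<bar> \<le> (\<Sum>c\<in>Basis. \<bar>\<phi>2 b x c\<bar>) * norm w" for b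
    proof -
      have lin: "linear (\<phi>2 b x)"
        unfolding \<phi>2_def using diff2[OF \<open>x \<in> U\<close>] by (rule linear_frechet_derivative)
      have "\<phi>2 b x w = \<phi>2 b x (\<Sum>c\<in>Basis. (w \<bullet> c) *\<^sub>R c)" by (simp only: euclidean_representation)
      also have "\<dots> = (\<Sum>c\<in>Basis. (w \<bullet> c) * \<phi>2 b x c)"
        by (simp only: linear_sum[OF lin] linear_scale[OF lin] real_scaleR_def)
      also have "\<bar>\<dots>\<bar> \<le> (\<Sum>c\<in>Basis. \<bar>(w \<bullet> c) * \<phi>2 b x c\<bar>)" by (rule sum_abs)
      also have "\<dots> \<le> (\<Sum>c\<in>Basis. \<bar>\<phi>2 b x c\<bar> * norm w)"
        by (intro sum_mono) (simp add: abs_mult mult.commute mult_right_mono Basis_le_norm)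
      finally show ?thesis by (simp add: sum_distrib_right)
    qed
    then have "(\<Sum>b\<in>Basis. norm (\<phi>2 b x w *\<^sub>R (b::'a))) \<le> (\<Sum>b\<in>Basis. (\<Sum>c\<in>Basis. \<bar>\<phi>2 b x c\<bar>) * norm w)"
      by (intro sum_mono) simp
    then have "norm (H x w) \<le> (\<Sum>b\<in>Basis. \<Sum>c\<in>Basis. \<bar>\<phi>2 b x c\<bar>) * norm w"
      unfolding H_def by (intro order_trans[OF norm_sum]) (simp add: sum_distrib_right)
    also have "\<dots> \<le> \<bar>B\<bar> * norm w"
      using B[of x] x by (intro mult_right_mono) auto
    finally show ?thesis .
  qed
  moreover have "(\<phi> has_derivative (\<lambda>w. gradient \<phi> x \<bullet> w)) (at x)" if "x \<in> U" for x
  proof -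
    have "frechet_derivative \<phi> (at x) = (\<lambda>w. gradient \<phi> x \<bullet> w)"
      using frechet_derivative_eq_inner_gradient[OF diff[OF that]] by (simp add: fun_eq_iff)
    then show ?thesis using diff[OF that] by (metis frechet_derivative_works)
  qed
  moreover have "ball q0 r \<subseteq> U" using r by auto
  ultimately show ?thesis using that[of r "\<bar>B\<bar>" H] r(1) H by auto
qed

text \<open>
  The defining function is normalised so that the variance \<open>\<sigma>\<^sup>2 |\<nabla>\<rho>|\<^sup>2 / 2\<close> of the velocity
  component normal to the boundary lies in a fixed range.
\<close>

lemma boundary_chart:
  fixes \<O> :: "'a::euclidean_space set"
  assumes dom: "C2_domain \<O>" and q0: "q0 \<in> frontier \<O>" and \<sigma>: "\<sigma> > 0"
  obtains r \<rho> g H B where "r > 0" "B \<ge> 0"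
    "\<And>x. x \<in> ball q0 r \<Longrightarrow> (\<rho> has_derivative (\<lambda>w. g x \<bullet> w)) (at x)"
    "\<And>x. x \<in> ball q0 r \<Longrightarrow> (g has_derivative H x) (at x)"
    "\<And>x w. x \<in> ball q0 r \<Longrightarrow> norm (H x w) \<le> B * norm w"
    "\<And>x. x \<in> ball q0 r \<Longrightarrow> 1 / 2 \<le> \<sigma>\<^sup>2 / 2 * (g x \<bullet> g x) \<and> \<sigma>\<^sup>2 / 2 * (g x \<bullet> g x) \<le> 1"
    "\<And>x. x \<in> ball q0 r \<Longrightarrow> x \<in> \<O> \<longleftrightarrow> \<rho> x > 0"
    "\<And>x. x \<in> ball q0 r \<Longrightarrow> x \<in> frontier \<O> \<longleftrightarrow> \<rho> x = 0"
    "\<And>x p. x \<in> ball q0 r \<Longrightarrow> x \<in> frontier \<O> \<Longrightarrow> p \<bullet> outward_normal \<O> x > 0 \<longleftrightarrow> p \<bullet> g x < 0"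
proof -
  obtain U \<phi> where def: "C2_defining_function \<O> q0 U \<phi>"
    using dom q0 unfolding C2_domain_def by blast
  then have U: "open U" "q0 \<in> U" "C_k_on 2 \<phi> U" "\<And>x. x \<in> U \<Longrightarrow> gradient \<phi> x \<noteq> 0"
    and O: "\<And>x. x \<in> U \<Longrightarrow> x \<in> \<O> \<longleftrightarrow> \<phi> x < 0" "\<And>x. x \<in> U \<Longrightarrow> x \<in> frontier \<O> \<longleftrightarrow> \<phi> x = 0"
    unfolding C2_defining_function_def by blast+
  obtain H r1 B where H: "r1 > 0" "ball q0 r1 \<subseteq> U" "B \<ge> 0"
    "\<And>x. x \<in> U \<Longrightarrow> (\<phi> has_derivative (\<lambda>w. gradient \<phi> x \<bullet> w)) (at x)"
    "\<And>x. x \<in> U \<Longrightarrow> (gradient \<phi> has_derivative H x) (at x)"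
    "\<And>x w. x \<in> ball q0 r1 \<Longrightarrow> norm (H x w) \<le> B * norm w"
    by (rule C2_gradient[OF U(3,1,2)]) (rule that)
  \<comment> \<open>This yields the value 3 / 4 at q0, the middle of the interval from 1 / 2 to 1;
    continuity keeps the value in the interval nearby.\<close>
  define k where "k = sqrt (3 / 2) / (\<sigma> * norm (gradient \<phi> q0))"
  have k: "k > 0" using \<sigma> U by (simp add: k_def)
  \<comment> \<open>The minus sign turns the gradient inwards: \<open>\<rho> > 0\<close> in
    \<open>\<O>\<close>, and outgoing means a negative normal velocity
    \<open>p \<bullet> g x\<close>.\<close>
  define g where "g = (\<lambda>x. - k *\<^sub>R gradient \<phi> x)"
  have "\<sigma>\<^sup>2 / 2 * (g q0 \<bullet> g q0) = 3 / 4"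
    using \<sigma> U(2,4) by (simp add: g_def k_def power2_eq_square[symmetric] field_simps dot_square_norm power_mult_distrib)
  moreover have "isCont (\<lambda>x. \<sigma>\<^sup>2 / 2 * (g x \<bullet> g x)) q0"
    using has_derivative_continuous[OF H(5)[OF U(2)]] unfolding g_def by (intro continuous_intros)
  ultimately obtain r2 where r2: "r2 > 0"
    "\<And>x. dist x q0 < r2 \<Longrightarrow> dist (\<sigma>\<^sup>2 / 2 * (g x \<bullet> g x)) (3 / 4) < 1 / 4"
    unfolding continuous_at_eps_delta by (metis zero_less_divide_1_iff zero_less_numeral)
  define r where "r = min r1 r2"
  have r: "r > 0" "ball q0 r \<subseteq> U" "ball q0 r \<subseteq> ball q0 r1" "ball q0 r \<subseteq> ball q0 r2"
    using H r2 by (auto simp: r_def)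
  show ?thesis
  proof (rule that[of r "k * B" "\<lambda>x. - k * \<phi> x" g "\<lambda>x w. - k *\<^sub>R H x w"])
    fix x assume x: "x \<in> ball q0 r"
    then have xU: "x \<in> U" using r by auto
    have "((\<lambda>x. - k * \<phi> x) has_derivative (\<lambda>w. - k * (gradient \<phi> x \<bullet> w))) (at x)"
      by (intro has_derivative_mult_right H(4) xU)
    then show "((\<lambda>x. - k * \<phi> x) has_derivative (\<lambda>w. g x \<bullet> w)) (at x)" by (simp add: g_def)
    show "(g has_derivative (\<lambda>w. - k *\<^sub>R H x w)) (at x)"
      unfolding g_def by (intro has_derivative_scaleR_right H(5) xU)
    show "norm (- k *\<^sub>R H x w) \<le> k * B * norm w" for w
      using H(6)[of x w] x r k by (auto simp: mult.assoc)
    have "dist x q0 < r2" using x by (simp add: r_def dist_commute)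
    from r2(2)[OF this]
    show "1 / 2 \<le> \<sigma>\<^sup>2 / 2 * (g x \<bullet> g x) \<and> \<sigma>\<^sup>2 / 2 * (g x \<bullet> g x) \<le> 1"
      unfolding dist_real_def abs_less_iff by linarith
    show "x \<in> \<O> \<longleftrightarrow> - k * \<phi> x > 0" using O(1)[OF xU] k by (simp add: mult_less_0_iff)
    show "x \<in> frontier \<O> \<longleftrightarrow> - k * \<phi> x = 0" using O(2)[OF xU] k by simp
    show "p \<bullet> outward_normal \<O> x > 0 \<longleftrightarrow> p \<bullet> g x < 0" if "x \<in> frontier \<O>" for p
    proof -
      have "C2_defining_function \<O> x U \<phi>" using def xU unfolding C2_defining_function_def by blast
      then have "outward_normal \<O> x = sgn (gradient \<phi> x)" using that by (rule outward_normal_eq)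
      then show ?thesis using U(4)[OF xU] k
        by (simp add: g_def sgn_div_norm zero_less_mult_iff zero_less_divide_iff)
    qed
  qed (use r k H in auto)
qed

section \<open>Barriers\<close>

text \<open>The premise on D speaks of arbitrary curves r, w with the right first-order behaviour,
  so that barriers are differentiated by one-variable rules and no joint differentiability of
  \<open>\<Psi>\<close> has to be shown. \<open>p \<bullet> H p + c \<bullet> g q\<close> is the
  drift of the normal velocity; its first part comes from the Hessian of
  \<open>\<rho>\<close>.\<close>

lemma chart_kinetic_value:
  fixes \<rho> :: "'a::euclidean_space \<Rightarrow> real" and g :: "'a \<Rightarrow> 'a"
  assumes \<rho>: "(\<rho> has_derivative (\<lambda>w. g q \<bullet> w)) (at q)" and g: "(g has_derivative H) (at q)"
    and D: "\<And>r w. (r has_real_derivative - (p \<bullet> g q)) (at 0) \<Longrightarrow>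
        (w has_real_derivative - (p \<bullet> H p + c \<bullet> g q)) (at 0) \<Longrightarrow>
        r 0 = \<rho> q \<Longrightarrow> w 0 = p \<bullet> g q \<Longrightarrow> ((\<lambda>s. \<Psi> (t + s) (r s) (w s)) has_real_derivative D) (at 0)"
    and \<Psi>1: "\<And>x. (\<Psi> t (\<rho> q) has_real_derivative \<Psi>1 x) (at x)"
    and \<Psi>2: "(\<Psi>1 has_real_derivative \<Psi>2) (at (p \<bullet> g q))"
  shows "has_kinetic_value \<sigma> c (\<lambda>(t, q, p). \<Psi> t (\<rho> q) (p \<bullet> g q)) t q p (D - \<sigma>\<^sup>2 / 2 * (g q \<bullet> g q) * \<Psi>2)"
proof (rule has_kinetic_valueI)
  have line: "((\<lambda>s. q - s *\<^sub>R p) has_derivative (\<lambda>s. - s *\<^sub>R p)) (at 0)"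
    by (auto intro!: derivative_eq_intros)
  have "((\<lambda>s. \<rho> (q - s *\<^sub>R p)) has_derivative (\<lambda>s. g q \<bullet> (- s *\<^sub>R p))) (at 0)"
    by (rule has_derivative_compose[OF line]) (simp add: \<rho>)
  then have r: "((\<lambda>s. \<rho> (q - s *\<^sub>R p)) has_real_derivative - (p \<bullet> g q)) (at 0)"
    unfolding has_field_derivative_def
    by (rule has_derivative_eq_rhs) (simp add: fun_eq_iff inner_commute[of p])
  have "((\<lambda>s. g (q - s *\<^sub>R p)) has_derivative (\<lambda>s. H (- s *\<^sub>R p))) (at 0)"
    by (rule has_derivative_compose[OF line]) (simp add: g)
  moreover have "((\<lambda>s. p - s *\<^sub>R c) has_derivative (\<lambda>s. - s *\<^sub>R c)) (at 0)"
    by (auto intro!: derivative_eq_intros)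
  ultimately have dw: "((\<lambda>s. (p - s *\<^sub>R c) \<bullet> g (q - s *\<^sub>R p)) has_derivative
      (\<lambda>s. (p - 0 *\<^sub>R c) \<bullet> H (- s *\<^sub>R p) + (- s *\<^sub>R c) \<bullet> g (q - 0 *\<^sub>R p))) (at 0)"
    by (intro has_derivative_inner)
  have Hs: "H (- (s *\<^sub>R p)) = - (s *\<^sub>R H p)" for s
    using linear_scale[OF has_derivative_linear[OF g], of "- s" p] by simp
  have w: "((\<lambda>s. (p - s *\<^sub>R c) \<bullet> g (q - s *\<^sub>R p)) has_real_derivative - (p \<bullet> H p + c \<bullet> g q)) (at 0)"
    unfolding has_field_derivative_def
    by (rule has_derivative_eq_rhs[OF dw]) (simp add: fun_eq_iff Hs algebra_simps)
  show "((\<lambda>s. (\<lambda>(t, q, p). \<Psi> t (\<rho> q) (p \<bullet> g q)) (t + s, q - s *\<^sub>R p, p - s *\<^sub>R c)) has_real_derivative D) (at 0)"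
    using D[OF r w] by simp
  have lin: "((\<lambda>s. (p + s *\<^sub>R b) \<bullet> g q) has_real_derivative b \<bullet> g q) (at s)" for b s
    unfolding inner_add_left inner_scaleR_left by (auto intro!: derivative_eq_intros)
  show "((\<lambda>s. (\<lambda>(t, q, p). \<Psi> t (\<rho> q) (p \<bullet> g q)) (t, q, p + s *\<^sub>R b)) has_real_derivative
      \<Psi>1 ((p + s *\<^sub>R b) \<bullet> g q) * (b \<bullet> g q)) (at s)" for b s
    using DERIV_chain2[OF \<Psi>1 lin] by simp
  have "(\<Psi>1 has_real_derivative \<Psi>2) (at ((p + 0 *\<^sub>R b) \<bullet> g q))" for b using \<Psi>2 by simp
  from DERIV_cmult_right[OF DERIV_chain2[OF this lin]]
  show "((\<lambda>s. \<Psi>1 ((p + s *\<^sub>R b) \<bullet> g q) * (b \<bullet> g q)) has_real_derivative \<Psi>2 * (b \<bullet> g q) * (b \<bullet> g q)) (at 0)" for b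
    by blast
  have "(\<Sum>b\<in>Basis. \<Psi>2 * (b \<bullet> g q) * (b \<bullet> g q)) = (g q \<bullet> g q) * \<Psi>2"
    by (simp add: euclidean_inner[of "g q" "g q"] sum_distrib_left sum_distrib_right inner_commute ac_simps)
  then show "D - \<sigma>\<^sup>2 / 2 * (g q \<bullet> g q) * \<Psi>2 = D - \<sigma>\<^sup>2 / 2 * (\<Sum>b\<in>Basis. \<Psi>2 * (b \<bullet> g q) * (b \<bullet> g q))"
    by simp
qed

section \<open>Barrier at the corner\<close>

text \<open>
  \<open>\<rho> + t v\<close> is transported by the free flow and spreads with variance of order \<open>t\<^sup>3\<close>; the function
  below is a Gaussian in it whose prefactor decays slower than the one of the heat kernel, which leaves
  room for the drift and for the variation of the diffusion coefficient.
\<close>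

definition corner_fun :: "real \<Rightarrow> real \<Rightarrow> real \<Rightarrow> real \<Rightarrow> real \<Rightarrow> real" where
  "corner_fun C \<delta> t \<rho> v =
     exp (1 + C * t - ln (\<delta>\<^sup>2 + 5 * t ^ 3 / 3) / 5 + ln (\<delta>\<^sup>2) / 5 - (\<rho> + t * v)\<^sup>2 / (\<delta>\<^sup>2 + 5 * t ^ 3 / 3))"

text \<open>In the variable z = \<open>\<rho> + t v\<close> the diffusion is
  \<open>\<kappa> t\<^sup>2\<close> times a second derivative. For \<open>\<kappa> = 1\<close> the
  exact kernel has S = \<open>4 t\<^sup>3 / 3\<close> and prefactor power - 1 / 2. The larger 5 / 3
  leaves one \<open>(z t / S)\<^sup>2\<close> to complete the square with the drift term, at the
  cost \<open>\<beta>\<^sup>2\<close> that C pays; the power - 1 / 5 makes the prefactor contribute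
  exactly \<open>- t\<^sup>2 / S\<close>, which diffusion covers as
  \<open>\<kappa> \<ge> 1 / 2\<close>.\<close>

lemma corner_kinetic_value:
  fixes \<rho> :: "'a::euclidean_space \<Rightarrow> real" and g :: "'a \<Rightarrow> 'a"
  assumes \<rho>: "(\<rho> has_derivative (\<lambda>w. g q \<bullet> w)) (at q)" and g: "(g has_derivative H) (at q)"
    and \<kappa>: "1 / 2 \<le> \<sigma>\<^sup>2 / 2 * (g q \<bullet> g q)" "\<sigma>\<^sup>2 / 2 * (g q \<bullet> g q) \<le> 1"
    and b: "(p \<bullet> H p + c \<bullet> g q)\<^sup>2 \<le> C" and t: "t \<ge> 0" and \<delta>: "\<delta> > 0"
  shows "\<exists>l\<ge>0. has_kinetic_value \<sigma> c (\<lambda>(t, q, p). corner_fun C \<delta> t (\<rho> q) (p \<bullet> g q)) t q p l"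
proof -
  define \<beta> where "\<beta> = p \<bullet> H p + c \<bullet> g q"
  define S where "S = \<delta>\<^sup>2 + 5 * t ^ 3 / 3"
  define z where "z = \<rho> q + t * (p \<bullet> g q)"
  define W where "W = corner_fun C \<delta> t (\<rho> q) (p \<bullet> g q)"
  define \<kappa> where "\<kappa> = \<sigma>\<^sup>2 / 2 * (g q \<bullet> g q)"
  have S: "S > 0" using t \<delta> by (simp add: S_def add_pos_nonneg)
  have S': "\<delta>\<^sup>2 + 5 * t ^ 3 / 3 \<noteq> 0" using S by (simp add: S_def)
  define D where "D = W * (C - t\<^sup>2 / S + 5 * z\<^sup>2 * t\<^sup>2 / S\<^sup>2 + 2 * z * t * \<beta> / S)"
  define \<Psi>1 where "\<Psi>1 = (\<lambda>x. corner_fun C \<delta> t (\<rho> q) x * (- 2 * (\<rho> q + t * x) * t / S))"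
  have *: "has_kinetic_value \<sigma> c (\<lambda>(t, q, p). corner_fun C \<delta> t (\<rho> q) (p \<bullet> g q)) t q p
     (D - \<sigma>\<^sup>2 / 2 * (g q \<bullet> g q) * (W * (4 * z\<^sup>2 * t\<^sup>2 / S\<^sup>2 - 2 * t\<^sup>2 / S)))"
  proof (rule chart_kinetic_value[OF \<rho> g])
    fix r w :: "real \<Rightarrow> real"
    assume r: "(r has_real_derivative - (p \<bullet> g q)) (at 0)"
      and w: "(w has_real_derivative - (p \<bullet> H p + c \<bullet> g q)) (at 0)"
      and r0: "r 0 = \<rho> q" and w0: "w 0 = p \<bullet> g q"
    have dS: "((\<lambda>s. \<delta>\<^sup>2 + 5 * (t + s) ^ 3 / 3) has_real_derivative 5 * t\<^sup>2) (at 0)"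
      by (auto intro!: derivative_eq_intros simp: power2_eq_square)
    have dz: "((\<lambda>s. r s + (t + s) * w s) has_real_derivative - t * \<beta>) (at 0)"
      using r0 w0 by (auto intro!: derivative_eq_intros r w simp: \<beta>_def algebra_simps)
    have S0: "\<delta>\<^sup>2 + 5 * (t + 0) ^ 3 / 3 = S" and z0: "r 0 + (t + 0) * w 0 = z"
      by (simp_all add: S_def z_def r0 w0)
    have dq: "((\<lambda>s. (r s + (t + s) * w s)\<^sup>2 / (\<delta>\<^sup>2 + 5 * (t + s) ^ 3 / 3)) has_real_derivative
        - 2 * z * t * \<beta> / S - 5 * z\<^sup>2 * t\<^sup>2 / S\<^sup>2) (at 0)"
    proof (rule DERIV_cong[OF DERIV_divide[OF DERIV_power[OF dz, of 2] dS]])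
      show "\<delta>\<^sup>2 + 5 * (t + 0) ^ 3 / 3 \<noteq> 0" using S' by simp
      show "(real 2 * (- t * \<beta> * (r 0 + (t + 0) * w 0) ^ (2 - Suc 0)) * (\<delta>\<^sup>2 + 5 * (t + 0) ^ 3 / 3)
          - (r 0 + (t + 0) * w 0)\<^sup>2 * (5 * t\<^sup>2)) / ((\<delta>\<^sup>2 + 5 * (t + 0) ^ 3 / 3) * (\<delta>\<^sup>2 + 5 * (t + 0) ^ 3 / 3))
        = - 2 * z * t * \<beta> / S - 5 * z\<^sup>2 * t\<^sup>2 / S\<^sup>2"
        unfolding S0 z0 using S by (simp add: field_simps power2_eq_square)
    qed
    have dl: "((\<lambda>s. ln (\<delta>\<^sup>2 + 5 * (t + s) ^ 3 / 3) / 5) has_real_derivative t\<^sup>2 / S) (at 0)"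
      by (rule DERIV_cong[OF DERIV_cdivide[OF DERIV_chain2[OF DERIV_ln_divide dS]]])
        (use S in \<open>simp_all only: S0, simp\<close>)
    have "((\<lambda>s. 1 + C * (t + s) - ln (\<delta>\<^sup>2 + 5 * (t + s) ^ 3 / 3) / 5 + ln (\<delta>\<^sup>2) / 5
        - (r s + (t + s) * w s)\<^sup>2 / (\<delta>\<^sup>2 + 5 * (t + s) ^ 3 / 3)) has_real_derivative
        C - t\<^sup>2 / S - (- 2 * z * t * \<beta> / S - 5 * z\<^sup>2 * t\<^sup>2 / S\<^sup>2)) (at 0)"
      by (rule derivative_eq_intros dl dq refl)+ simp
    from DERIV_chain2[OF DERIV_exp this]
    show "((\<lambda>s. corner_fun C \<delta> (t + s) (r s) (w s)) has_real_derivative D) (at 0)"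
      unfolding corner_fun_def
      by (rule DERIV_cong) (simp add: D_def W_def corner_fun_def r0 w0)
  next
    have d: "((\<lambda>x. corner_fun C \<delta> t (\<rho> q) x) has_real_derivative \<Psi>1 x) (at x)" for x
      unfolding corner_fun_def \<Psi>1_def S_def[symmetric] using S
      by (auto intro!: derivative_eq_intros simp: field_simps)
    then show "(corner_fun C \<delta> t (\<rho> q) has_real_derivative \<Psi>1 x) (at x)" for x by simp
    show "(\<Psi>1 has_real_derivative W * (4 * z\<^sup>2 * t\<^sup>2 / S\<^sup>2 - 2 * t\<^sup>2 / S)) (at (p \<bullet> g q))"
    proof (rule DERIV_cong)
      have "((\<lambda>x. - 2 * (\<rho> q + t * x) * t / S) has_real_derivative - 2 * t * t / S) (at (p \<bullet> g q))"
        using S by (auto intro!: derivative_eq_intros)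
      from DERIV_mult[OF d this, folded \<Psi>1_def]
      show "(\<Psi>1 has_real_derivative \<Psi>1 (p \<bullet> g q) * (- 2 * (\<rho> q + t * (p \<bullet> g q)) * t / S)
        + - 2 * t * t / S * corner_fun C \<delta> t (\<rho> q) (p \<bullet> g q)) (at (p \<bullet> g q))" .
      show "\<Psi>1 (p \<bullet> g q) * (- 2 * (\<rho> q + t * (p \<bullet> g q)) * t / S)
          + - 2 * t * t / S * corner_fun C \<delta> t (\<rho> q) (p \<bullet> g q) = W * (4 * z\<^sup>2 * t\<^sup>2 / S\<^sup>2 - 2 * t\<^sup>2 / S)"
        unfolding \<Psi>1_def W_def[symmetric] z_def[symmetric] by (simp add: field_simps power2_eq_square)
    qed
  qed
  have "D - \<kappa> * (W * (4 * z\<^sup>2 * t\<^sup>2 / S\<^sup>2 - 2 * t\<^sup>2 / S)) =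
     W * ((C - \<beta>\<^sup>2) + (z * t / S + \<beta>)\<^sup>2 + (4 - 4 * \<kappa>) * (z * t / S)\<^sup>2 + (2 * \<kappa> - 1) * (t\<^sup>2 / S))"
    using S by (simp add: D_def field_simps power2_eq_square)
  also have "\<dots> \<ge> 0"
    using b \<kappa> S unfolding \<kappa>_def[symmetric] \<beta>_def[symmetric]
    by (intro mult_nonneg_nonneg add_nonneg_nonneg) (auto simp: W_def corner_fun_def)
  finally show ?thesis using * unfolding \<kappa>_def by blast
qed

text \<open>The factor \<open>(\<delta>\<^sup>2) powr (1 / 5)\<close> hidden in the exponent tends
  to 0 with \<open>\<delta>\<close>, while \<open>t > 0\<close> keeps the other factors bounded. m
  is the value of \<open>ln (\<delta>\<^sup>2)\<close> for which the crude bound, without the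
  Gaussian, equals \<open>\<eta>\<close>.\<close>

lemma corner_fun_tendsto_0:
  assumes t: "t > 0" and \<eta>: "\<eta> > 0"
  shows "\<exists>\<delta>>0. corner_fun C \<delta> t \<rho> v \<le> \<eta>"
proof -
  define m where "m = ln (5 * t ^ 3 / 3) + 5 * (ln \<eta> - 1 - C * t)"
  define \<delta> where "\<delta> = exp (m / 2)"
  have \<delta>: "ln (\<delta>\<^sup>2) = m" by (simp add: \<delta>_def power2_eq_square flip: exp_add)
  have "ln (5 * t ^ 3 / 3) \<le> ln (\<delta>\<^sup>2 + 5 * t ^ 3 / 3)" using t by (intro ln_mono) auto
  moreover have "(\<rho> + t * v)\<^sup>2 / (\<delta>\<^sup>2 + 5 * t ^ 3 / 3) \<ge> 0" using t by simp
  ultimately have "corner_fun C \<delta> t \<rho> v \<le> exp (ln \<eta>)"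
    unfolding corner_fun_def exp_le_cancel_iff \<delta> m_def by argo
  then show ?thesis using \<eta> by (intro exI[of _ \<delta>]) (simp add: \<delta>_def)
qed

text \<open>At the corner the logarithms cancel and the Gaussian exponent vanishes. The summand 1 in
  \<open>corner_fun\<close> puts the limit strictly above the level 1 required of a barrier,
  whatever \<open>\<delta>\<close> is.\<close>

lemma corner_fun_tendsto_corner:
  assumes "(T \<longlongrightarrow> 0) F" "(R \<longlongrightarrow> 0) F" "(V \<longlongrightarrow> v) F" and "\<delta> > 0"
  shows "((\<lambda>x. corner_fun C \<delta> (T x) (R x) (V x)) \<longlongrightarrow> exp 1) F"
proof -
  have "((\<lambda>x. corner_fun C \<delta> (T x) (R x) (V x)) \<longlongrightarrow>
    exp (1 + C * 0 - ln (\<delta>\<^sup>2 + 5 * 0 ^ 3 / 3) / 5 + ln (\<delta>\<^sup>2) / 5 - (0 + 0 * v)\<^sup>2 / (\<delta>\<^sup>2 + 5 * 0 ^ 3 / 3))) F"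
    unfolding corner_fun_def using assms(4) by (intro tendsto_intros assms(1-3)) auto
  then show ?thesis by simp
qed

section \<open>Barrier at incoming and grazing points\<close>

text \<open>
  Up to the power of the normal velocity hidden in \<open>X = max 0 (- v) ^ 3\<close>, \<open>\<rho>\<close> and \<open>X\<close> have the same
  weight under the scaling \<open>\<rho> \<sim> v\<^sup>3\<close> of the operator \<open>v \<partial>\<^sub>\<rho> + \<kappa> \<partial>\<^sub>v\<^sup>2\<close>, so that \<open>grazing_fun\<close> is
  logarithmic up to a function homogeneous of degree zero. The constants make
  \<open>v \<partial>\<^sub>\<rho> + \<kappa> \<partial>\<^sub>v\<^sup>2\<close> of it nonpositive for all \<open>\<kappa>\<close> between \<open>1/2\<close> and \<open>1\<close>.
\<close>

definition grazing_fun :: "real \<Rightarrow> real \<Rightarrow> real" where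
  "grazing_fun \<rho> v = - ln (\<rho> + max 0 (- v) ^ 3 / 20)
     - 1 / 2 * (max 0 (- v) ^ 3 / (\<rho> + max 0 (- v) ^ 3 / 20))"

text \<open>The cases n = 1 and n = 0 give the first and second derivatives of the cube in
  \<open>grazing_fun\<close>, which is thereby twice differentiable across v = 0.\<close>

lemma DERIV_max_0_power:
  fixes x :: real
  shows "((\<lambda>x. max 0 (- x) ^ (n + 2)) has_real_derivative - (real n + 2) * max 0 (- x) ^ (n + 1)) (at x)"
proof -
  consider "x < 0" | "x > 0" | "x = 0" by linarith
  then show ?thesis
  proof cases
    case 1
    have "((\<lambda>x. (- x) ^ (n + 2)) has_real_derivative - (real n + 2) * max 0 (- x) ^ (n + 1)) (at x)"
      using 1 DERIV_power[where n = "n + 2" and x = x, OF DERIV_minus[OF DERIV_ident]]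
      by (simp add: max_def algebra_simps)
    then show ?thesis
    proof (rule has_field_derivative_transform_within_open)
      show "open {..<0::real}" by simp
    qed (use 1 in \<open>auto simp: max_def\<close>)
  next
    case 2
    have "((\<lambda>x::real. 0) has_real_derivative - (real n + 2) * max 0 (- x) ^ (n + 1)) (at x)"
      using 2 by (auto simp: max_def)
    then show ?thesis
    proof (rule has_field_derivative_transform_within_open)
      show "open {0::real<..}" by simp
    qed (use 2 in \<open>auto simp: max_def\<close>)
  next
    case 3
    have "((\<lambda>h::real. max 0 (- h) ^ (n + 1) * (- (if h < 0 then 1 else 0))) \<longlongrightarrow> 0) (at 0)"
    proof (rule tendsto_rabs_zero_cancel, rule tendsto_sandwich[OF _ _ tendsto_const])
      show "((\<lambda>h::real. \<bar>h\<bar> ^ (n + 1)) \<longlongrightarrow> 0) (at 0)"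
        by (auto intro!: tendsto_eq_intros)
    qed (auto intro!: always_eventually simp: abs_mult max_def)
    then have "((\<lambda>h::real. (max 0 (- (0 + h)) ^ (n + 2) - max 0 (- 0) ^ (n + 2)) / h) \<longlongrightarrow> 0) (at 0)"
      by (rule Lim_transform_eventually) (auto simp: eventually_at_filter max_def)
    then show ?thesis using 3 by (simp add: DERIV_def)
  qed
qed

text \<open>This is the kinetic value at v = - m divided by m. The transport term - 1 / E has the
  wrong sign; at X = 0 diffusion outweighs it, mainly through its action on X / E, with
  \<open>33 / 10 * \<kappa>\<close> against 1 + 1 / 10, where 1 / 10 = 3 / 30 bounds the drift. Over
  the denominator \<open>E ^ 3\<close> the rest is a quadratic form in \<open>\<rho>\<close> and X
  whose three coefficients are nonnegative on the range of \<open>\<kappa>\<close>.\<close>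

lemma grazing_inequality:
  fixes \<rho> m \<kappa> b :: real
  defines "X \<equiv> m ^ 3"
  defines "E \<equiv> \<rho> + X / 20"
  assumes \<rho>: "\<rho> > 0" and m: "m \<ge> 0" and \<kappa>: "1 / 2 \<le> \<kappa>" "\<kappa> \<le> 1" and b: "\<bar>b\<bar> * m \<le> 1 / 30"
  shows "(- 1 / E + X / (2 * E\<^sup>2)) + 3 * m * b * (- 1 / (20 * E) - \<rho> / (2 * E\<^sup>2))
    - \<kappa> * (9 * X * (1 / (400 * E\<^sup>2) + \<rho> / (20 * E ^ 3)) + 6 * (- 1 / (20 * E) - \<rho> / (2 * E\<^sup>2))) \<ge> 0"
proof -
  have X: "X \<ge> 0" using m by (simp add: X_def)
  have E: "E > 0" using \<rho> X by (simp add: E_def add_pos_nonneg)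
  have r: "\<rho> = E - X / 20" by (simp add: E_def)
  have r0: "\<rho> / E \<le> 1" using E X by (simp add: r)
  have "\<bar>3 * m * b * (- 1 / (20 * E) - \<rho> / (2 * E\<^sup>2))\<bar> = (3 * (\<bar>b\<bar> * m)) * ((1 / 20 + (\<rho> / E) / 2) / E)"
  proof -
    have "- 1 / (20 * E) - \<rho> / (2 * E\<^sup>2) = - ((1 / 20 + (\<rho> / E) / 2) / E)"
      using E by (simp add: field_simps power2_eq_square)
    moreover have "\<bar>3 * m * b * - Y\<bar> = 3 * (\<bar>b\<bar> * m) * Y" if "Y \<ge> 0" for Y
      using that m by (simp add: abs_mult)
    moreover have "(1 / 20 + (\<rho> / E) / 2) / E \<ge> 0" using E \<rho> by simp
    ultimately show ?thesis by presburger
  qed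
  also have "\<dots> \<le> (3 * (1 / 30)) * (1 / E)"
  proof (intro mult_mono divide_right_mono)
    have "1 / 20 + y / 2 \<le> 1" if "y \<le> 1" for y :: real using that by linarith
    then show "1 / 20 + (\<rho> / E) / 2 \<le> 1" using r0 by blast
  qed (use b E \<rho> m in auto)
  finally have 1: "3 * m * b * (- 1 / (20 * E) - \<rho> / (2 * E\<^sup>2)) \<ge> - (1 / (10 * E))"
    by (simp add: abs_le_iff)
  have "(- 1 / E + X / (2 * E\<^sup>2))
    - \<kappa> * (9 * X * (1 / (400 * E\<^sup>2) + \<rho> / (20 * E ^ 3)) + 6 * (- 1 / (20 * E) - \<rho> / (2 * E\<^sup>2))) - 1 / (10 * E)
    = ((33 / 10 * \<kappa> - 11 / 10) * \<rho>\<^sup>2 + (39 / 100 - 117 / 400 * \<kappa>) * \<rho> * X + (89 / 4000 - 3 / 8000 * \<kappa>) * X\<^sup>2) / E ^ 3"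
    using E unfolding r by (simp add: field_simps power2_eq_square power3_eq_cube)
  also have "\<dots> \<ge> 0"
    using \<kappa> \<rho> X E by (intro divide_nonneg_nonneg add_nonneg_nonneg mult_nonneg_nonneg) auto
  finally show ?thesis using 1 by linarith
qed

text \<open>For \<open>v \<ge> 0\<close> the function is \<open>- ln \<rho>\<close> with value
  \<open>v / \<rho>\<close>, so transport suffices. For \<open>v < 0\<close> the scaling
  \<open>\<rho> \<sim> v\<^sup>3\<close> lets a factor m = - v be taken out of every term, and
  \<open>grazing_inequality\<close> settles the quotient.\<close>

lemma grazing_kinetic_value:
  fixes \<rho> :: "'a::euclidean_space \<Rightarrow> real" and g :: "'a \<Rightarrow> 'a"
  assumes \<rho>: "(\<rho> has_derivative (\<lambda>w. g q \<bullet> w)) (at q)" and g: "(g has_derivative H) (at q)"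
    and \<kappa>: "1 / 2 \<le> \<sigma>\<^sup>2 / 2 * (g q \<bullet> g q)" "\<sigma>\<^sup>2 / 2 * (g q \<bullet> g q) \<le> 1"
    and pos: "\<rho> q > 0" and b: "\<bar>p \<bullet> H p + c \<bullet> g q\<bar> * max 0 (- (p \<bullet> g q)) \<le> 1 / 30"
  shows "\<exists>l\<ge>0. has_kinetic_value \<sigma> c (\<lambda>(t, q, p). grazing_fun (\<rho> q) (p \<bullet> g q)) t q p l"
proof -
  define v where "v = p \<bullet> g q"
  define m where "m = (\<lambda>v::real. max 0 (- v))"
  define X where "X = (\<lambda>v. m v ^ 3)"
  define \<beta> where "\<beta> = p \<bullet> H p + c \<bullet> g q"
  define \<kappa> where "\<kappa> = \<sigma>\<^sup>2 / 2 * (g q \<bullet> g q)"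
  have dX: "(X has_real_derivative - 3 * m x ^ 2) (at x)" for x
    using DERIV_max_0_power[of 1 x] by (simp add: X_def m_def numeral_3_eq_3 numeral_2_eq_2)
  have dX2: "((\<lambda>x. - 3 * m x ^ 2) has_real_derivative 6 * m x) (at x)" for x
    using DERIV_cmult[OF DERIV_max_0_power[of 0 x], of "- 3"] by (simp add: m_def power2_eq_square)
  have m0: "m x \<ge> 0" for x by (simp add: m_def)
  then have X0: "X x \<ge> 0" for x by (simp add: X_def)
  define E where "E = (\<lambda>x. \<rho> q + X x / 20)"
  have E: "E x > 0" for x using pos X0[of x] by (simp add: E_def add_pos_nonneg)
  define GX where "GX = (\<lambda>x. - 1 / (20 * E x) - \<rho> q / (2 * (E x)\<^sup>2))"
  define GXX where "GXX = (\<lambda>x. 1 / (400 * (E x)\<^sup>2) + \<rho> q / (20 * E x ^ 3))"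
  define Gr where "Gr = - 1 / E v + X v / (2 * (E v)\<^sup>2)"
  have dE: "(E has_real_derivative - 3 * m x ^ 2 / 20) (at x)" for x
    unfolding E_def by (auto intro!: derivative_eq_intros dX)
  have eq: "grazing_fun r x = - ln (r + X x / 20) - 1 / 2 * (X x / (r + X x / 20))" for r x
    by (simp add: grazing_fun_def X_def m_def)
  have eqE: "grazing_fun (\<rho> q) = (\<lambda>x. - ln (E x) - 1 / 2 * (X x / E x))"
    by (simp add: eq E_def fun_eq_iff)
  have *: "has_kinetic_value \<sigma> c (\<lambda>(t, q, p). grazing_fun (\<rho> q) (p \<bullet> g q)) t q p
    (- v * Gr + 3 * (m v)\<^sup>2 * \<beta> * GX v - \<sigma>\<^sup>2 / 2 * (g q \<bullet> g q) * (9 * m v ^ 4 * GXX v + 6 * m v * GX v))"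
  proof (rule chart_kinetic_value[where \<Psi> = "\<lambda>t. grazing_fun", OF \<rho> g])
    fix r w :: "real \<Rightarrow> real"
    assume r: "(r has_real_derivative - (p \<bullet> g q)) (at 0)"
      and w: "(w has_real_derivative - (p \<bullet> H p + c \<bullet> g q)) (at 0)"
      and r0: "r 0 = \<rho> q" and w0: "w 0 = p \<bullet> g q"
    have Xw: "((\<lambda>s. X (w s)) has_real_derivative 3 * (m v)\<^sup>2 * \<beta>) (at 0)"
      by (rule DERIV_cong[OF DERIV_chain2[OF dX w]]) (simp add: w0 v_def \<beta>_def algebra_simps)
    have Er: "((\<lambda>s. r s + X (w s) / 20) has_real_derivative - v + 3 * (m v)\<^sup>2 * \<beta> / 20) (at 0)"
      using r by (auto intro!: derivative_eq_intros Xw simp: v_def)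
    have E0: "r 0 + X (w 0) / 20 = E v" by (simp add: r0 w0 E_def v_def)
    have dl: "((\<lambda>s. ln (r s + X (w s) / 20)) has_real_derivative (- v + 3 * (m v)\<^sup>2 * \<beta> / 20) / E v) (at 0)"
      by (rule DERIV_cong[OF DERIV_chain2[OF DERIV_ln_divide Er]]) (use E[of v] in \<open>simp_all only: E0, simp\<close>)
    have dd: "((\<lambda>s. X (w s) / (r s + X (w s) / 20)) has_real_derivative
        (3 * (m v)\<^sup>2 * \<beta> * E v - X v * (- v + 3 * (m v)\<^sup>2 * \<beta> / 20)) / (E v * E v)) (at 0)"
      using DERIV_divide[OF Xw Er] E[of v] unfolding E0 by (simp add: w0 flip: v_def)
    show "((\<lambda>s. grazing_fun (r s) (w s)) has_real_derivative - v * Gr + 3 * (m v)\<^sup>2 * \<beta> * GX v) (at 0)"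
      unfolding eq
    proof (rule DERIV_cong[OF DERIV_diff[OF DERIV_minus[OF dl] DERIV_cmult[OF dd]]])
      have rq: "\<rho> q = E v - X v / 20" by (simp add: E_def)
      show "- ((- v + 3 * (m v)\<^sup>2 * \<beta> / 20) / E v)
          - 1 / 2 * ((3 * (m v)\<^sup>2 * \<beta> * E v - X v * (- v + 3 * (m v)\<^sup>2 * \<beta> / 20)) / (E v * E v))
        = - v * Gr + 3 * (m v)\<^sup>2 * \<beta> * GX v"
        unfolding Gr_def GX_def rq using E[of v] by (simp add: field_simps power2_eq_square)
    qed
  next
    fix x
    have dl: "((\<lambda>x. ln (E x)) has_real_derivative (- 3 * m x ^ 2 / 20) / E x) (at x)"
      by (rule DERIV_cong[OF DERIV_chain2[OF DERIV_ln_divide dE]]) (use E[of x] in simp_all)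
    have "((\<lambda>x. X x / E x) has_real_derivative
      (- 3 * m x ^ 2 * E x - X x * (- 3 * m x ^ 2 / 20)) / (E x * E x)) (at x)"
      using DERIV_divide[OF dX dE] E[of x] by simp
    from DERIV_diff[OF DERIV_minus[OF dl] DERIV_cmult[OF this, of "1 / 2"]]
    show "(grazing_fun (\<rho> q) has_real_derivative GX x * (- 3 * m x ^ 2)) (at x)"
      unfolding eqE
    proof (rule DERIV_cong)
      have rq: "\<rho> q = E x - X x / 20" by (simp add: E_def)
      show "- (- 3 * (m x)\<^sup>2 / 20 / E x) - 1 / 2 * ((- 3 * (m x)\<^sup>2 * E x - X x * (- 3 * (m x)\<^sup>2 / 20)) / (E x * E x))
         = GX x * (- 3 * m x ^ 2)"
        unfolding GX_def rq using E[of x] by (simp add: field_simps power2_eq_square)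
    qed
  next
    have E1: "((\<lambda>x. 1 / E x) has_real_derivative 3 * m v ^ 2 / (20 * (E v)\<^sup>2)) (at v)"
      by (rule DERIV_cong[OF DERIV_divide[OF DERIV_const dE]]) (use E[of v] in \<open>simp_all add: power2_eq_square\<close>)
    have E2: "((\<lambda>x. (1 / E x)\<^sup>2) has_real_derivative 3 * m v ^ 2 / (10 * E v ^ 3)) (at v)"
      by (rule DERIV_cong[OF DERIV_power[OF E1]]) (use E[of v] in \<open>simp add: field_simps power2_eq_square power3_eq_cube\<close>)
    have GXe: "GX = (\<lambda>x. - 1 / 20 * (1 / E x) - \<rho> q / 2 * (1 / E x)\<^sup>2)"
      by (simp add: GX_def power_divide fun_eq_iff)
    have "(GX has_real_derivative GXX v * (- 3 * m v ^ 2)) (at v)"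
      unfolding GXe
      by (rule DERIV_cong[OF DERIV_diff[OF DERIV_cmult[OF E1] DERIV_cmult[OF E2]]])
         (use E[of v] in \<open>simp add: GXX_def field_simps power2_eq_square power3_eq_cube\<close>)
    from DERIV_mult[OF this dX2]
    show "((\<lambda>x. GX x * (- 3 * m x ^ 2)) has_real_derivative 9 * m v ^ 4 * GXX v + 6 * m v * GX v) (at (p \<bullet> g q))"
      unfolding v_def[symmetric]
      by (rule DERIV_cong) (simp add: algebra_simps power2_eq_square power4_eq_xxxx)
  qed
  have "- v * Gr + 3 * (m v)\<^sup>2 * \<beta> * GX v - \<kappa> * (9 * m v ^ 4 * GXX v + 6 * m v * GX v) \<ge> 0"
  proof (cases "v \<ge> 0")
    case True
    then have "m v = 0" "X v = 0" by (simp_all add: m_def X_def)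
    then show ?thesis using True E[of v] by (simp add: Gr_def)
  next
    case False
    then have mv: "m v = - v" by (simp add: m_def)
    have "0 \<le> m v * (Gr + 3 * m v * \<beta> * GX v - \<kappa> * (9 * X v * GXX v + 6 * GX v))"
      unfolding Gr_def GX_def GXX_def E_def X_def
      by (intro mult_nonneg_nonneg m0 grazing_inequality)
         (use \<kappa> b pos m0[of v] in \<open>auto simp: \<kappa>_def \<beta>_def m_def v_def\<close>)
    also have "\<dots> = - v * Gr + 3 * (m v)\<^sup>2 * \<beta> * GX v - \<kappa> * (9 * m v ^ 4 * GXX v + 6 * m v * GX v)"
      unfolding mv[symmetric] X_def
      by (simp add: algebra_simps power2_eq_square power3_eq_cube power4_eq_xxxx)
    finally show ?thesis .
  qed
  with * show ?thesis unfolding \<kappa>_def by blast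
qed

lemma grazing_fun_ge:
  assumes "\<rho> > 0"
  shows "grazing_fun \<rho> v \<ge> - ln (\<rho> + max 0 (- v) ^ 3 / 20) - 10"
proof -
  have "max 0 (- v) ^ 3 / (\<rho> + max 0 (- v) ^ 3 / 20) \<le> 20"
    using assms by (simp add: divide_le_eq add_pos_nonneg)
  then show ?thesis unfolding grazing_fun_def by linarith
qed

text \<open>
  The boundary points near which nothing is assumed about \<open>u\<close> except that it is bounded.
\<close>

definition singular_boundary :: "'a::euclidean_space set \<Rightarrow> (real \<times> 'a \<times> 'a) set" where
  "singular_boundary \<O> = {(t, q, p). t \<ge> 0 \<and> q \<in> frontier \<O> \<and> (t = 0 \<or> (q, p) \<notin> Gamma_plus \<O>)}"

section \<open>Assembly of the barriers\<close>

text \<open>The radius is fixed before y and \<open>\<eta>\<close>; V then costs almost nothing at y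
  but at least 1 near every singular point of the ball. The summand \<open>W \<delta>\<close> serves
  the singular points with t = 0 and is small at y for small \<open>\<delta>\<close>; the summand
  \<open>k * G\<close> serves those with t > 0, since G tends to infinity there and any small factor
  k is affordable.\<close>

lemma (in kinetic_subsolution) local_barrier:
  fixes z0 :: "real \<times> 'a \<times> 'a"
  defines "Dom \<equiv> {0<..} \<times> \<O> \<times> UNIV"
  assumes dom: "C2_domain \<O>" and bdd: "bounded \<O>" and z0: "z0 \<in> singular_boundary \<O>"
  shows "\<exists>r>0. \<forall>y\<in>ball z0 r \<inter> Dom. \<forall>\<eta>>0. \<exists>V. V y \<le> \<eta> \<and> continuous_on (ball z0 r \<inter> Dom) V \<and>
    (\<forall>t q p. (t, q, p) \<in> ball z0 r \<inter> Dom \<longrightarrow> V (t, q, p) \<ge> 0 \<and>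
      (\<exists>l\<ge>0. has_kinetic_value \<sigma> (drift q p) V t q p l)) \<and>
    (\<forall>z\<in>ball z0 r \<inter> singular_boundary \<O>. \<forall>\<^sub>F x in at z within Dom. V x \<ge> 1)"
proof -
  obtain t0 q0 p0 where zz: "z0 = (t0, q0, p0)" by (cases z0) auto
  have q0: "q0 \<in> frontier \<O>" using z0 by (auto simp: zz singular_boundary_def)
  obtain r0 \<rho> g H B where r0: "r0 > 0" "B \<ge> 0"
    and \<rho>: "\<And>x. x \<in> ball q0 r0 \<Longrightarrow> (\<rho> has_derivative (\<lambda>w. g x \<bullet> w)) (at x)"
    and g: "\<And>x. x \<in> ball q0 r0 \<Longrightarrow> (g has_derivative H x) (at x)"
    and HB: "\<And>x w. x \<in> ball q0 r0 \<Longrightarrow> norm (H x w) \<le> B * norm w"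
    and \<kappa>: "\<And>x. x \<in> ball q0 r0 \<Longrightarrow> 1 / 2 \<le> \<sigma>\<^sup>2 / 2 * (g x \<bullet> g x) \<and> \<sigma>\<^sup>2 / 2 * (g x \<bullet> g x) \<le> 1"
    and inO: "\<And>x. x \<in> ball q0 r0 \<Longrightarrow> x \<in> \<O> \<longleftrightarrow> \<rho> x > 0"
    and infr: "\<And>x. x \<in> ball q0 r0 \<Longrightarrow> x \<in> frontier \<O> \<longleftrightarrow> \<rho> x = 0"
    and normal: "\<And>x p. x \<in> ball q0 r0 \<Longrightarrow> x \<in> frontier \<O> \<Longrightarrow> p \<bullet> outward_normal \<O> x > 0 \<longleftrightarrow> p \<bullet> g x < 0"
    by (rule boundary_chart[OF dom q0 sigma_pos]) (rule that)
  have q0b: "q0 \<in> ball q0 r0" using r0 by simp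
  have c\<rho>: "isCont \<rho> x" and cg: "isCont g x" if "x \<in> ball q0 r0" for x
    using \<rho>[OF that] g[OF that] by (auto intro: has_derivative_continuous)
  define v where "v = (\<lambda>z::real \<times> 'a \<times> 'a. snd (snd z) \<bullet> g (fst (snd z)))"
  define R where "R = (\<lambda>z::real \<times> 'a \<times> 'a. \<rho> (fst (snd z)))"
  define E where "E = (\<lambda>z. R z + max 0 (- v z) ^ 3 / 20)"
  have cv: "isCont v z" and cR: "isCont R z" if "fst (snd z) \<in> ball q0 r0" for z
    unfolding v_def R_def
    using isCont_o2[where f = "\<lambda>z. fst (snd z)" and a = z, OF _ cg[OF that]]
      isCont_o2[where f = "\<lambda>z. fst (snd z)" and a = z, OF _ c\<rho>[OF that]]
    by (auto intro!: continuous_intros)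
  have cE: "isCont E z" if "fst (snd z) \<in> ball q0 r0" for z
    unfolding E_def using cv[OF that] cR[OF that] by (intro continuous_intros) auto

  have "bounded (F ` closure \<O>)"
    using bdd cont_F continuous_on_subset
    by (intro compact_imp_bounded compact_continuous_image) (auto simp: compact_closure)
  then obtain F0 where F0: "\<And>q. q \<in> \<O> \<Longrightarrow> norm (F q) \<le> F0"
    unfolding bounded_iff using closure_subset by (metis image_eqI subsetD)
  define P0 where "P0 = norm p0 + 1"
  \<comment> \<open>A bound for the drift of the normal velocity; the square root bounds the norm of
    g, and the final 1 keeps \<open>\<beta>0\<close> positive as a divisor.\<close>
  define \<beta>0 where "\<beta>0 = P0 * (B * P0) + (\<bar>F0\<bar> + \<bar>\<gamma>\<bar> * P0) * sqrt (2 / \<sigma>\<^sup>2) + 1"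
  have P0: "P0 > 0" by (simp add: P0_def add_nonneg_pos)
  have "\<beta>0 > 0" using P0 r0(2) unfolding \<beta>0_def by (intro add_nonneg_pos add_nonneg_nonneg mult_nonneg_nonneg) auto
  have beta: "\<bar>p \<bullet> H q p + drift q p \<bullet> g q\<bar> \<le> \<beta>0"
    if q: "q \<in> ball q0 r0" "q \<in> \<O>" and p: "norm p \<le> P0" for q p
  proof -
    have "\<bar>p \<bullet> H q p\<bar> \<le> norm p * norm (H q p)" by (rule Cauchy_Schwarz_ineq2)
    also have "\<dots> \<le> P0 * (B * P0)"
      using HB[OF q(1), of p] p P0 r0(2)
      by (intro mult_mono) (auto intro: order_trans mult_left_mono)
    finally have 1: "\<bar>p \<bullet> H q p\<bar> \<le> P0 * (B * P0)" .
    have "norm (drift q p) \<le> norm (F q) + \<bar>\<gamma>\<bar> * norm p"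
      unfolding drift_def by (metis norm_scaleR norm_triangle_ineq4)
    also have "\<dots> \<le> \<bar>F0\<bar> + \<bar>\<gamma>\<bar> * P0"
      using F0[OF q(2)] p by (intro add_mono mult_left_mono) auto
    finally have d: "norm (drift q p) \<le> \<bar>F0\<bar> + \<bar>\<gamma>\<bar> * P0" .
    have "(norm (g q))\<^sup>2 \<le> 2 / \<sigma>\<^sup>2"
      using \<kappa>[OF q(1)] sigma_pos by (simp add: power2_norm_eq_inner field_simps)
    then have "norm (g q) \<le> sqrt (2 / \<sigma>\<^sup>2)" by (rule real_le_rsqrt)
    then have "\<bar>drift q p \<bullet> g q\<bar> \<le> (\<bar>F0\<bar> + \<bar>\<gamma>\<bar> * P0) * sqrt (2 / \<sigma>\<^sup>2)"
      using d P0 by (intro order_trans[OF Cauchy_Schwarz_ineq2] mult_mono) auto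
    with 1 show ?thesis unfolding \<beta>0_def by linarith
  qed
  \<comment> \<open>If z0 is outgoing, so are all boundary points nearby, and the singular ones
    among them have t = 0: the corner barrier suffices. Otherwise the ball is shrunk until the
    negative part of v times \<open>\<beta>0\<close> is at most 1 / 30, as the grazing barrier
    demands.\<close>
  define incoming where "incoming \<longleftrightarrow> v z0 \<ge> 0"
  have "\<exists>r>0. \<forall>z\<in>ball z0 r. if incoming then v z > - 1 / (30 * \<beta>0) \<and> E z < 1 else v z < 0"
  proof -
    have z0b: "fst (snd z0) \<in> ball q0 r0" using q0b by (simp add: zz)
    have tv: "(v \<longlongrightarrow> v z0) (nhds z0)" and tE: "(E \<longlongrightarrow> E z0) (nhds z0)"
      using cv[OF z0b] cE[OF z0b] by (simp_all add: continuous_at tendsto_at_iff_tendsto_nhds)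
    have "\<forall>\<^sub>F z in nhds z0. if incoming then v z > - 1 / (30 * \<beta>0) \<and> E z < 1 else v z < 0"
    proof (cases incoming)
      case True
      then have "v z0 \<ge> 0" by (simp add: incoming_def)
      moreover have "E z0 = 0" using True infr[OF q0b] q0 by (simp add: E_def R_def zz incoming_def)
      moreover have "- 1 / (30 * \<beta>0) < 0" using \<open>\<beta>0 > 0\<close> by simp
      ultimately have "\<forall>\<^sub>F z in nhds z0. v z > - 1 / (30 * \<beta>0)" "\<forall>\<^sub>F z in nhds z0. E z < 1"
        using order_tendstoD[OF tv] order_tendstoD[OF tE] by (smt (verit) eventually_mono)+
      with True show ?thesis by (simp add: eventually_conj)
    next
      case False
      then show ?thesis using order_tendstoD(2)[OF tv, of 0] by (simp add: incoming_def)
    qed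
    then show ?thesis by (simp add: eventually_nhds_metric Ball_def dist_commute)
  qed
  then obtain r1 where r1: "r1 > 0"
    "\<And>z. z \<in> ball z0 r1 \<Longrightarrow> incoming \<Longrightarrow> v z > - 1 / (30 * \<beta>0) \<and> E z < 1"
    "\<And>z. z \<in> ball z0 r1 \<Longrightarrow> \<not> incoming \<Longrightarrow> v z < 0"
    by (metis (no_types, lifting))
  define r where "r = min r1 (min r0 1)"
  have r: "r > 0" using r0 r1 by (simp add: r_def)
  have ball: "fst (snd z) \<in> ball q0 r0" "norm (snd (snd z)) \<le> P0" "z \<in> ball z0 r1" if "z \<in> ball z0 r" for z
  proof -
    have d: "dist z0 z < r" using that by simp
    have "dist q0 (fst (snd z)) \<le> dist z0 z" "dist p0 (snd (snd z)) \<le> dist z0 z"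
      using dist_snd_le[of z0 z] dist_fst_le[of "snd z0" "snd z"] dist_snd_le[of "snd z0" "snd z"]
      by (auto simp: zz)
    moreover have "norm (snd (snd z)) \<le> norm p0 + dist p0 (snd (snd z))"
      by (metis dist_commute dist_norm norm_triangle_sub)
    ultimately show "fst (snd z) \<in> ball q0 r0" "norm (snd (snd z)) \<le> P0" "z \<in> ball z0 r1"
      using d by (auto simp: r_def P0_def)
  qed
  define W where "W = (\<lambda>\<delta> z. corner_fun (\<beta>0\<^sup>2) \<delta> (fst z) (R z) (v z))"
  \<comment> \<open>The constant 10 offsets the loss in \<open>grazing_fun_ge\<close>; since E < 1
    on the ball, G is then nonnegative.\<close>
  define G where "G = (\<lambda>z. if incoming then grazing_fun (R z) (v z) + 10 else 0)"
  have Rpos: "R z > 0" if "z \<in> ball z0 r \<inter> Dom" for z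
    using that inO[OF ball(1)[of z]] by (auto simp: R_def Dom_def)
  have Wkv: "\<exists>l\<ge>0. has_kinetic_value \<sigma> (drift q p) (W \<delta>) t q p l"
    if z: "(t, q, p) \<in> ball z0 r \<inter> Dom" and \<delta>: "\<delta> > 0" for t q p \<delta>
  proof -
    have q: "q \<in> ball q0 r0" using ball(1)[of "(t, q, p)"] z by simp
    have "\<bar>p \<bullet> H q p + drift q p \<bullet> g q\<bar> \<le> \<beta>0"
      using ball[of "(t, q, p)"] z by (intro beta) (auto simp: Dom_def)
    then have "(p \<bullet> H q p + drift q p \<bullet> g q)\<^sup>2 \<le> \<beta>0\<^sup>2"
      using \<open>\<beta>0 > 0\<close> by (simp add: abs_le_square_iff[symmetric])
    from corner_kinetic_value[where \<sigma> = \<sigma> and t = t and \<delta> = \<delta>, OF \<rho>[OF q] g[OF q] _ _ this] \<kappa>[OF q] z \<delta>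
    show ?thesis by (auto simp: W_def R_def v_def split_def Dom_def)
  qed
  have Gkv: "\<exists>l\<ge>0. has_kinetic_value \<sigma> (drift q p) G t q p l" "G (t, q, p) \<ge> 0"
    if z: "(t, q, p) \<in> ball z0 r \<inter> Dom" for t q p
  proof -
    have q: "q \<in> ball q0 r0" using ball(1)[of "(t, q, p)"] z by simp
    have "\<bar>p \<bullet> H q p + drift q p \<bullet> g q\<bar> \<le> \<beta>0"
      using ball[of "(t, q, p)"] z by (intro beta) (auto simp: Dom_def)
    moreover have "max 0 (- v (t, q, p)) \<le> 1 / (30 * \<beta>0)" if incoming
      using r1(2)[OF ball(3) that, of "(t, q, p)"] z \<open>\<beta>0 > 0\<close> by auto
    ultimately have small: "\<bar>p \<bullet> H q p + drift q p \<bullet> g q\<bar> * max 0 (- (p \<bullet> g q)) \<le> \<beta>0 * (1 / (30 * \<beta>0))" if incoming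
      using that \<open>\<beta>0 > 0\<close> by (intro mult_mono) (auto simp: v_def)
    have pos: "\<rho> q > 0" using Rpos[OF z] by (simp add: R_def)
    show "\<exists>l\<ge>0. has_kinetic_value \<sigma> (drift q p) G t q p l"
    proof (cases incoming)
      case True
      obtain l where l: "l \<ge> 0" "has_kinetic_value \<sigma> (drift q p) (\<lambda>(t, q, p). grazing_fun (\<rho> q) (p \<bullet> g q)) t q p l"
        using grazing_kinetic_value[where \<sigma> = \<sigma> and p = p and c = "drift q p", OF \<rho>[OF q] g[OF q] _ _ pos] \<kappa>[OF q] small[OF True] \<open>\<beta>0 > 0\<close>
        by auto
      from has_kinetic_value_add[OF l(2) has_kinetic_value_const[of _ _ 10]] l(1) True
      show ?thesis by (auto simp: G_def R_def v_def split_def)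
    next
      case False
      then show ?thesis using has_kinetic_value_const[of \<sigma> "drift q p" 0 t q p] by (auto simp: G_def)
    qed
    show "G (t, q, p) \<ge> 0"
    proof (cases incoming)
      case True
      have "E (t, q, p) < 1" using r1(2)[OF ball(3) True, of "(t, q, p)"] z by simp
      moreover have "E (t, q, p) > 0" using Rpos[OF z] by (simp add: E_def add_pos_nonneg)
      ultimately have "ln (E (t, q, p)) \<le> 0" by simp
      then show ?thesis using grazing_fun_ge[OF Rpos[OF z], of "v (t, q, p)"] by (simp add: G_def E_def)
    qed (simp add: G_def)
  qed
  have cont: "continuous_on (ball z0 r \<inter> Dom) v" "continuous_on (ball z0 r \<inter> Dom) R"
    using cv cR ball(1) by (auto intro!: continuous_at_imp_continuous_on)
  have Wcont: "continuous_on (ball z0 r \<inter> Dom) (W \<delta>)" if "\<delta> > 0" for \<delta>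
  proof -
    have "\<delta>\<^sup>2 + 5 * t ^ 3 / 3 > 0" if "t > 0" for t :: real
      using that \<open>\<delta> > 0\<close> by (intro add_pos_pos) auto
    then have "\<delta>\<^sup>2 + 5 * fst z ^ 3 / 3 \<noteq> 0" if "z \<in> ball z0 r \<inter> Dom" for z
      using that by (force simp: Dom_def)
    then show ?thesis
      unfolding W_def corner_fun_def using that
      by (intro continuous_intros cont) auto
  qed
  have Gcont: "continuous_on (ball z0 r \<inter> Dom) G"
  proof -
    have nz: "R z + max 0 (- v z) ^ 3 / 20 \<noteq> 0" if "z \<in> ball z0 r \<inter> Dom" for z
      using Rpos[OF that] by (smt (verit) divide_nonneg_nonneg zero_le_power)
    have "continuous_on (ball z0 r \<inter> Dom) (\<lambda>z. grazing_fun (R z) (v z))"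
      unfolding grazing_fun_def by (intro continuous_intros cont ballI nz) simp_all
    then show ?thesis
      unfolding G_def by (cases incoming) (auto intro!: continuous_intros)
  qed
  have ev: "\<forall>\<^sub>F x in at z within Dom. x \<in> ball z0 r \<inter> Dom" if "z \<in> ball z0 r" for z
  proof -
    have "\<forall>\<^sub>F x in nhds z. x \<in> ball z0 r" using that by (intro eventually_nhds_in_open) auto
    then show ?thesis unfolding eventually_at_filter by (rule eventually_mono) auto
  qed
  have Wsing: "\<forall>\<^sub>F x in at z within Dom. W \<delta> x \<ge> 1"
    if z: "z \<in> ball z0 r" "z \<in> singular_boundary \<O>" "fst z = 0" and \<delta>: "\<delta> > 0" for z \<delta>
  proof -
    have "R z = 0" using infr[OF ball(1)[OF z(1)]] z(2) by (auto simp: R_def singular_boundary_def)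
    then have "(R \<longlongrightarrow> 0) (at z within Dom)" "(v \<longlongrightarrow> v z) (at z within Dom)"
      using cR[OF ball(1)[OF z(1)]] cv[OF ball(1)[OF z(1)]]
      by (metis continuous_within continuous_at_imp_continuous_at_within)+
    moreover have "(fst \<longlongrightarrow> 0) (at z within Dom)"
      using z(3) tendsto_fst[OF tendsto_ident_at, of z Dom] by simp
    ultimately have "(W \<delta> \<longlongrightarrow> exp 1) (at z within Dom)"
      unfolding W_def using \<delta> by (intro corner_fun_tendsto_corner)
    then have "\<forall>\<^sub>F x in at z within Dom. W \<delta> x > 1"
      by (rule order_tendstoD) simp
    then show ?thesis by (rule eventually_mono) simp
  qed
  have Gsing: "\<forall>\<^sub>F x in at z within Dom. k * G x \<ge> 1"
    if z: "z \<in> ball z0 r" "z \<in> singular_boundary \<O>" "fst z \<noteq> 0" and k: "k > 0" for z k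
  proof -
    obtain t q p where tqp: "z = (t, q, p)" by (cases z) auto
    have q: "q \<in> frontier \<O>" "\<not> p \<bullet> outward_normal \<O> q > 0"
      using z by (auto simp: tqp singular_boundary_def Gamma_plus_def)
    then have v0: "v z \<ge> 0" using normal[of q p] ball(1)[OF z(1)] by (auto simp: tqp v_def)
    then have inc: incoming using r1(3)[OF ball(3)[OF z(1)]] by force
    have "R z = 0" using infr[OF ball(1)[OF z(1)]] q by (simp add: R_def tqp)
    then have "E z = 0" using v0 by (simp add: E_def)
    then have "(E \<longlongrightarrow> 0) (at z within Dom)"
      using cE[OF ball(1)[OF z(1)]] by (metis continuous_within continuous_at_imp_continuous_at_within)
    then have "\<forall>\<^sub>F x in at z within Dom. E x < exp (- (1 / k))"
      by (rule order_tendstoD) simp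
    with ev[OF z(1)] show ?thesis
    proof eventually_elim
      case (elim x)
      have "E x > 0" using Rpos[OF elim(1)] by (simp add: E_def add_pos_nonneg)
      then have "ln (E x) \<le> - (1 / k)" using elim(2) by (metis less_imp_le ln_exp ln_le_cancel_iff exp_gt_zero)
      then have "G x \<ge> 1 / k"
        using grazing_fun_ge[OF Rpos[OF elim(1)], of "v x"] inc by (simp add: G_def E_def)
      then show ?case using k by (simp add: field_simps)
    qed
  qed
  show ?thesis
  proof (intro exI[of _ r] conjI ballI allI impI r)
    fix y \<eta> assume y: "y \<in> ball z0 r \<inter> Dom" and \<eta>: "(\<eta>::real) > 0"
    have "fst y > 0" using y by (auto simp: Dom_def)
    then obtain \<delta> where \<delta>: "\<delta> > 0" "W \<delta> y \<le> \<eta> / 2"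
      using corner_fun_tendsto_0[of "fst y" "\<eta> / 2" "\<beta>0\<^sup>2" "R y" "v y"] \<eta> by (auto simp: W_def)
    define k where "k = \<eta> / (2 * (1 + \<bar>G y\<bar>))"
    have k: "k > 0" using \<eta> by (simp add: k_def)
    have "k * \<bar>G y\<bar> \<le> k * (1 + \<bar>G y\<bar>)" using k by (intro mult_left_mono) auto
    also have "\<dots> = \<eta> / 2" by (simp add: k_def field_simps)
    finally have kG: "k * G y \<le> \<eta> / 2" using k by (smt (verit) mult_left_mono)
    have W0: "W \<delta> x \<ge> 0" for x by (simp add: W_def corner_fun_def)
    show "\<exists>V. V y \<le> \<eta> \<and> continuous_on (ball z0 r \<inter> Dom) V \<and>
      (\<forall>t q p. (t, q, p) \<in> ball z0 r \<inter> Dom \<longrightarrow> V (t, q, p) \<ge> 0 \<and>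
      (\<exists>l\<ge>0. has_kinetic_value \<sigma> (drift q p) V t q p l)) \<and>
      (\<forall>z\<in>ball z0 r \<inter> singular_boundary \<O>. \<forall>\<^sub>F x in at z within Dom. V x \<ge> 1)"
    proof (intro exI[of _ "\<lambda>x. W \<delta> x + k * G x"] conjI allI impI ballI)
      show "W \<delta> y + k * G y \<le> \<eta>" using \<delta>(2) kG by simp
      show "continuous_on (ball z0 r \<inter> Dom) (\<lambda>x. W \<delta> x + k * G x)"
        by (intro continuous_intros Wcont Gcont \<delta>)
    next
      fix t q p assume z: "(t, q, p) \<in> ball z0 r \<inter> Dom"
      show "W \<delta> (t, q, p) + k * G (t, q, p) \<ge> 0"
        using W0 Gkv(2)[OF z] k by simp
      obtain l l' where "l \<ge> 0" "has_kinetic_value \<sigma> (drift q p) (W \<delta>) t q p l"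
        "l' \<ge> 0" "has_kinetic_value \<sigma> (drift q p) G t q p l'"
        using Wkv[OF z \<delta>(1)] Gkv(1)[OF z] by blast
      then show "\<exists>l\<ge>0. has_kinetic_value \<sigma> (drift q p) (\<lambda>x. W \<delta> x + k * G x) t q p l"
        using k has_kinetic_value_add[OF _ has_kinetic_value_cmult]
        by (intro exI[of _ "l + k * l'"]) auto
    next
      fix z assume z: "z \<in> ball z0 r \<inter> singular_boundary \<O>"
      show "\<forall>\<^sub>F x in at z within Dom. W \<delta> x + k * G x \<ge> 1"
      proof (cases "fst z = 0")
        case True
        from Wsing[OF _ _ True \<delta>(1)] z have "\<forall>\<^sub>F x in at z within Dom. W \<delta> x \<ge> 1" by simp
        moreover have "\<forall>\<^sub>F x in at z within Dom. x \<in> ball z0 r \<inter> Dom" using ev z by simp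
        ultimately show ?thesis
        proof eventually_elim
          case (elim x)
          have "G x \<ge> 0" using Gkv(2)[of "fst x" "fst (snd x)" "snd (snd x)"] elim(2) by simp
          then show ?case using elim(1) k by (simp add: add_increasing2)
        qed
      next
        case False
        from Gsing[OF _ _ False k] z have "\<forall>\<^sub>F x in at z within Dom. k * G x \<ge> 1" by simp
        then show ?thesis by (rule eventually_mono) (simp add: W0 add_increasing)
      qed
    qed
  qed
qed

section \<open>The weak maximum principle\<close>

lemma convergent_maximizing_sequence:
  fixes f :: "'a::metric_space \<Rightarrow> real"
  assumes "S \<noteq> {}" "S \<subseteq> K" "compact K" and bdd: "\<And>x. x \<in> S \<Longrightarrow> f x \<le> B"
  obtains y z s where "\<And>n. y n \<in> S" "y \<longlonglongrightarrow> z" "z \<in> K" "(\<lambda>n. f (y n)) \<longlonglongrightarrow> s" "\<And>x. x \<in> S \<Longrightarrow> f x \<le> s"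
proof -
  define s where "s = Sup (f ` S)"
  have bd: "bdd_above (f ` S)" by (rule bdd_aboveI2) (rule bdd)
  have le: "f x \<le> s" if "x \<in> S" for x unfolding s_def using that bd by (intro cSup_upper) auto
  have "\<exists>x\<in>S. s - 1 / Suc n < f x" for n
    using less_cSup_iff[OF _ bd, of "s - 1 / Suc n"] \<open>S \<noteq> {}\<close> by (auto simp: s_def)
  then obtain x where x: "\<And>n. x n \<in> S" "\<And>n. s - 1 / Suc n < f (x n)" by metis
  have lim: "(\<lambda>n. f (x n)) \<longlonglongrightarrow> s"
  proof (rule tendsto_sandwich)
    show "(\<lambda>n. s - 1 / Suc n) \<longlonglongrightarrow> s"
      using tendsto_diff[OF tendsto_const LIMSEQ_inverse_real_of_nat, of s] by (simp add: inverse_eq_divide)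
    show "(\<lambda>n. s) \<longlonglongrightarrow> s" by simp
  qed (use x le in \<open>auto intro!: always_eventually less_imp_le\<close>)
  have "\<forall>n. x n \<in> K" using x \<open>S \<subseteq> K\<close> by auto
  then obtain z r where z: "z \<in> K" "strict_mono r" "(x \<circ> r) \<longlonglongrightarrow> z"
    using \<open>compact K\<close> unfolding compact_def by blast
  show ?thesis
    using that[of "x \<circ> r" z s] x z le LIMSEQ_subseq_LIMSEQ[OF lim z(2)] by (auto simp: o_def)
qed

text \<open>The penalty that confines velocities: over bounded positions
  \<open>p \<bullet> c\<close> grows at most like \<open>1 + p \<bullet> p\<close>, so a large C
  makes the value nonnegative.\<close>

lemma norm_kinetic_value:
  "has_kinetic_value \<sigma> c (\<lambda>(t, q, p). exp (C * t) * (1 + p \<bullet> p)) t q p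
     (exp (C * t) * (C * (1 + p \<bullet> p) - 2 * (p \<bullet> c) - \<sigma>\<^sup>2 * DIM('a)))"
  for p :: "'a::euclidean_space"
proof (rule has_kinetic_valueI)
  have "((\<lambda>s. p - s *\<^sub>R c) has_vector_derivative - c) (at 0)"
    by (auto intro!: derivative_eq_intros)
  note d = DERIV_inner_self[OF this]
  show "((\<lambda>s. case (t + s, q - s *\<^sub>R p, p - s *\<^sub>R c) of (t, q, p) \<Rightarrow> exp (C * t) * (1 + p \<bullet> p)) has_real_derivative
      exp (C * t) * (C * (1 + p \<bullet> p) - 2 * (p \<bullet> c))) (at 0)"
    unfolding prod.case
    by (rule derivative_eq_intros d refl | simp)+ (simp add: algebra_simps)
  have "((\<lambda>s. p + s *\<^sub>R b) has_vector_derivative b) (at s)" for b s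
    by (auto intro!: derivative_eq_intros)
  note d1 = DERIV_inner_self[OF this]
  show "((\<lambda>s. case (t, q, p + s *\<^sub>R b) of (t, q, p) \<Rightarrow> exp (C * t) * (1 + p \<bullet> p)) has_real_derivative
      exp (C * t) * (2 * ((p + s *\<^sub>R b) \<bullet> b))) (at s)" for b s
    unfolding prod.case by (rule derivative_eq_intros d1 refl | simp)+
  show "((\<lambda>s. exp (C * t) * (2 * ((p + s *\<^sub>R b) \<bullet> b))) has_real_derivative exp (C * t) * 2) (at 0)"
    if "b \<in> Basis" for b
    unfolding inner_add_left inner_scaleR_left using that by (auto intro!: derivative_eq_intros)
qed (simp add: algebra_simps)

lemma dist_kinetic_value:
  fixes p :: "'a::euclidean_space"
  shows "has_kinetic_value \<sigma> c (\<lambda>(t, q, p). (t - t0)\<^sup>2 + (q - q0) \<bullet> (q - q0) + (p - p0) \<bullet> (p - p0)) t q p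
     (2 * (t - t0) - 2 * ((q - q0) \<bullet> p) - 2 * ((p - p0) \<bullet> c) - \<sigma>\<^sup>2 * DIM('a))"
proof (rule has_kinetic_valueI)
  have "((\<lambda>s. p - s *\<^sub>R c - p0) has_vector_derivative - c) (at 0)"
    "((\<lambda>s. q - s *\<^sub>R p - q0) has_vector_derivative - p) (at 0)"
    by (auto intro!: derivative_eq_intros)
  note d = this[THEN DERIV_inner_self]
  show "((\<lambda>s. case (t + s, q - s *\<^sub>R p, p - s *\<^sub>R c) of (t, q, p) \<Rightarrow>
      (t - t0)\<^sup>2 + (q - q0) \<bullet> (q - q0) + (p - p0) \<bullet> (p - p0)) has_real_derivative
      2 * (t - t0) - 2 * ((q - q0) \<bullet> p) - 2 * ((p - p0) \<bullet> c)) (at 0)"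
    unfolding prod.case
    by (rule derivative_eq_intros d refl | simp)+
  have "((\<lambda>s. p + s *\<^sub>R b - p0) has_vector_derivative b) (at s)" for b s
    by (auto intro!: derivative_eq_intros)
  note d1 = DERIV_inner_self[OF this]
  show "((\<lambda>s. case (t, q, p + s *\<^sub>R b) of (t, q, p) \<Rightarrow>
      (t - t0)\<^sup>2 + (q - q0) \<bullet> (q - q0) + (p - p0) \<bullet> (p - p0)) has_real_derivative
      2 * ((p + s *\<^sub>R b - p0) \<bullet> b)) (at s)" for b s
    unfolding prod.case by (rule derivative_eq_intros d1 refl | simp)+
  show "((\<lambda>s. 2 * ((p + s *\<^sub>R b - p0) \<bullet> b)) has_real_derivative 2) (at 0)" if "b \<in> Basis" for b
    unfolding inner_add_left inner_diff_left inner_scaleR_left using that by (auto intro!: derivative_eq_intros)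
qed (simp add: algebra_simps)

context kinetic_subsolution
begin

text \<open>In the interior, z would be a genuine maximum up to time T, against the comparison. On
  the initial or outgoing part u is continuous and \<open>\<Psi> \<ge> 0\<close>, whence
  \<open>s \<le> u z \<le> m\<close>; as only this lower bound enters, \<open>\<Psi>\<close> may
  blow up at the boundary. Nothing but the singular boundary remains.\<close>

lemma maximizing_limit_singular:
  fixes T m :: real
  defines "Dom \<equiv> {0<..} \<times> \<O> \<times> UNIV"
  defines "G \<equiv> {0..} \<times> (\<O> \<times> UNIV \<union> Gamma_plus \<O>) - {0} \<times> Gamma_plus \<O>"
  assumes cont: "continuous_on G u"
    and bdry: "\<And>z. z \<in> {0} \<times> (\<O> \<times> UNIV) \<union> {0<..} \<times> Gamma_plus \<O> \<Longrightarrow> u z \<le> m"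
    and N: "open N"
    and kv: "\<And>t q p. (t, q, p) \<in> N \<inter> Dom \<Longrightarrow> t \<le> T \<Longrightarrow> \<exists>l>0. has_kinetic_value \<sigma> (drift q p) \<Psi> t q p l"
    and pos: "\<And>x. x \<in> N \<inter> Dom \<Longrightarrow> \<Psi> x \<ge> 0" and cont_\<Psi>: "continuous_on (N \<inter> Dom) \<Psi>"
    and y: "\<And>n. y n \<in> N \<inter> Dom" "\<And>n. fst (y n) \<le> T" "y \<longlonglongrightarrow> z" and z: "z \<in> N"
    and lim: "(\<lambda>n. u (y n) - \<Psi> (y n)) \<longlonglongrightarrow> s" and "s > m"
    and max: "\<And>x. x \<in> N \<inter> Dom \<Longrightarrow> fst x \<le> T \<Longrightarrow> u x - \<Psi> x \<le> s"
  shows "z \<in> singular_boundary \<O>"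
proof (rule ccontr)
  assume nz: "z \<notin> singular_boundary \<O>"
  obtain t q p where zz: "z = (t, q, p)" by (cases z) auto
  have yt: "(\<lambda>n. fst (y n)) \<longlonglongrightarrow> t" and yq: "(\<lambda>n. fst (snd (y n))) \<longlonglongrightarrow> q"
    using tendsto_fst[OF y(3)] tendsto_fst[OF tendsto_snd[OF y(3)]] by (simp_all add: zz)
  have "t \<ge> 0"
  proof (rule LIMSEQ_le_const[OF yt])
    have "0 \<le> fst (y n)" for n using y(1)[of n] by (auto simp: Dom_def)
    then show "\<exists>N. \<forall>n\<ge>N. 0 \<le> fst (y n)" by blast
  qed
  have "t \<le> T"
    by (rule LIMSEQ_le_const2[OF yt]) (use y(2) in blast)
  have "fst (snd (y n)) \<in> \<O>" for n using y(1)[of n] by (auto simp: Dom_def)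
  then have "q \<in> closure \<O>" unfolding closure_sequential
    using yq by (intro exI[of _ "\<lambda>n. fst (snd (y n))"]) simp
  show False
  proof (cases "t > 0 \<and> q \<in> \<O>")
    case True
    then have "z \<in> N \<inter> Dom" using z by (simp add: zz Dom_def)
    have "open Dom" unfolding Dom_def by (intro open_Times open_O) auto
    then have "open (N \<inter> Dom)" using N by blast
    have "continuous_on (N \<inter> Dom) (\<lambda>x. u x - \<Psi> x)"
      by (intro continuous_intros cont_\<Psi> continuous_on_subset[OF continuous_u]) (auto simp: Dom_def)
    then have "(\<lambda>n. u (y n) - \<Psi> (y n)) \<longlonglongrightarrow> u z - \<Psi> z"
      by (rule continuous_on_tendsto_compose[OF _ y(3) \<open>z \<in> N \<inter> Dom\<close>])
        (rule always_eventually, rule allI, rule y(1))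
    then have s: "s = u z - \<Psi> z" using lim LIMSEQ_unique by blast
    obtain l where l: "l > 0" "has_kinetic_value \<sigma> (drift q p) \<Psi> t q p l"
      using kv[of t q p] \<open>z \<in> N \<inter> Dom\<close> \<open>t \<le> T\<close> by (auto simp: zz)
    obtain r where r: "r > 0" "ball z r \<subseteq> N \<inter> Dom"
      using \<open>open (N \<inter> Dom)\<close> \<open>z \<in> N \<inter> Dom\<close> openE by blast
    have "l \<le> 0"
    proof (rule comparison_at_max[OF _ _ l(2) r(1)])
      fix t' q' p' assume "t' \<le> t" and d: "dist (t', q', p') (t, q, p) < r"
      then have "(t', q', p') \<in> N \<inter> Dom" using r(2) by (auto simp: zz dist_commute)
      from max[OF this] show "u (t', q', p') - \<Psi> (t', q', p') \<le> u (t, q, p) - \<Psi> (t, q, p)"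
        using \<open>t' \<le> t\<close> \<open>t \<le> T\<close> s by (simp add: zz)
    qed (use True in auto)
    then show False using l(1) by simp
  next
    case False
    have fr: "q \<in> frontier \<O>" if "q \<notin> \<O>"
      using that \<open>q \<in> closure \<O>\<close> open_O by (simp add: frontier_def interior_open)
    have zG: "z \<in> {0} \<times> (\<O> \<times> UNIV) \<union> {0<..} \<times> Gamma_plus \<O>"
    proof (cases "q \<in> \<O>")
      case True
      then show ?thesis using False \<open>t \<ge> 0\<close> by (simp add: zz)
    next
      case q: False
      then show ?thesis using fr nz \<open>t \<ge> 0\<close> by (auto simp: zz singular_boundary_def)
    qed
    have dis: "q' \<notin> \<O>" if "(q', p') \<in> Gamma_plus \<O>" for q' p'
      using that open_O by (auto simp: Gamma_plus_def frontier_def interior_open)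
    then have "z \<in> G" using zG by (auto simp: G_def)
    moreover have "y n \<in> G" for n
      using y(1)[of n] dis by (cases "y n") (auto simp: G_def Dom_def)
    ultimately have "(\<lambda>n. u (y n)) \<longlonglongrightarrow> u z"
      by (intro continuous_on_tendsto_compose[OF cont y(3)]) auto
    moreover have "\<forall>n\<ge>0. u (y n) - \<Psi> (y n) \<le> u (y n)" using pos y(1) by simp
    ultimately have "s \<le> u z" using lim by (intro LIMSEQ_le) auto
    then show False using bdry[OF zG] \<open>s > m\<close> by simp
  qed
qed

text \<open>The penalty \<open>\<epsilon> * \<psi>\<close> puts the limit z of a maximising sequence
  on the singular boundary. Near z the maximisation is repeated with two further penalties:
  \<open>\<theta> * d\<close> keeps the new limit inside the ball, so that it is singular again, and
  \<open>A * V\<close> excludes this, because it costs at least s - m there.\<close>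

lemma weak_maximum_principle:
  fixes m B :: real
  defines "G \<equiv> {0..} \<times> (\<O> \<times> UNIV \<union> Gamma_plus \<O>) - {0} \<times> Gamma_plus \<O>"
  assumes dom: "C2_domain \<O>" and bdd: "bounded \<O>" and cont: "continuous_on G u"
    and uB: "\<And>t q p. t > 0 \<Longrightarrow> q \<in> \<O> \<Longrightarrow> u (t, q, p) \<le> B"
    and bdry: "\<And>z. z \<in> {0} \<times> (\<O> \<times> UNIV) \<union> {0<..} \<times> Gamma_plus \<O> \<Longrightarrow> u z \<le> m"
    and T: "T > 0" and q1: "q1 \<in> \<O>"
  shows "u (T, q1, p1) \<le> m"
proof (rule ccontr)
  assume "\<not> u (T, q1, p1) \<le> m"
  then have gt: "u (T, q1, p1) > m" by simp
  define Dom where "Dom = ({0<..} :: real set) \<times> \<O> \<times> (UNIV :: 'a set)"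
  have "bounded (F ` closure \<O>)"
    using bdd cont_F continuous_on_subset
    by (intro compact_imp_bounded compact_continuous_image) (auto simp: compact_closure)
  then obtain F1 where F1: "\<And>q. q \<in> \<O> \<Longrightarrow> norm (F q) \<le> F1"
    unfolding bounded_iff using closure_subset by (metis image_eqI subsetD)
  define F0 where "F0 = \<bar>F1\<bar>"
  have F0: "F0 \<ge> 0" "\<And>q. q \<in> \<O> \<Longrightarrow> norm (F q) \<le> F0" using F1 by (force simp: F0_def)+
  have drift: "norm (drift q p) \<le> F0 + \<bar>\<gamma>\<bar> * norm p" if "q \<in> \<O>" for q p
    using F0(2)[OF that] norm_triangle_ineq4[of "F q" "\<gamma> *\<^sub>R p"] by (simp add: drift_def)
  define C where "C = 1 + F0\<^sup>2 + 2 * \<bar>\<gamma>\<bar> + \<sigma>\<^sup>2 * DIM('a)"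
  \<comment> \<open>The summand t adds 1 to the kinetic value and so makes it strictly positive; C
    makes the remaining part nonnegative.\<close>
  define \<psi> where "\<psi> = (\<lambda>z :: real \<times> 'a \<times> 'a. fst z + (case z of (t, q, p) \<Rightarrow> exp (C * t) * (1 + p \<bullet> p)))"
  have psi_pos: "\<psi> x \<ge> 0" if "x \<in> Dom" for x
    using that by (auto simp: \<psi>_def Dom_def intro!: add_nonneg_nonneg)
  have psi_cont: "continuous_on S \<psi>" for S
    unfolding \<psi>_def split_def by (intro continuous_intros)
  have psi_kv: "\<exists>l\<ge>1. has_kinetic_value \<sigma> (drift q p) \<psi> t q p l" if q: "q \<in> \<O>" for t q p
  proof -
    have "has_kinetic_value \<sigma> (drift q p) (\<lambda>z. fst z) t q p 1"
      by (rule has_kinetic_valueI[where V' = "\<lambda>_ _. 0" and \<Lambda> = "\<lambda>_. 0"]) (auto intro!: derivative_eq_intros)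
    from has_kinetic_value_add[OF this norm_kinetic_value]
    have "has_kinetic_value \<sigma> (drift q p) \<psi> t q p
      (1 + exp (C * t) * (C * (1 + p \<bullet> p) - 2 * (p \<bullet> drift q p) - \<sigma>\<^sup>2 * DIM('a)))"
      unfolding \<psi>_def .
    moreover have "C * (1 + p \<bullet> p) - 2 * (p \<bullet> drift q p) - \<sigma>\<^sup>2 * DIM('a) \<ge> 0"
    proof -
      have "2 * (p \<bullet> F q) \<le> 2 * (norm p * F0)"
        using F0 q by (intro mult_left_mono order_trans[OF norm_cauchy_schwarz]) auto
      also have "\<dots> \<le> p \<bullet> p + F0\<^sup>2"
        using sum_squares_bound[of "norm p" F0] by (simp add: power2_norm_eq_inner)
      finally have "2 * (p \<bullet> F q) \<le> p \<bullet> p + F0\<^sup>2" .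
      moreover have "- (\<gamma> * (p \<bullet> p)) \<le> \<bar>\<gamma>\<bar> * (p \<bullet> p)"
        using mult_right_mono[of "- \<gamma>" "\<bar>\<gamma>\<bar>" "p \<bullet> p"] by simp
      moreover have "C * (1 + p \<bullet> p) - 2 * (p \<bullet> drift q p) - \<sigma>\<^sup>2 * DIM('a)
        = (p \<bullet> p + F0\<^sup>2 - 2 * (p \<bullet> F q)) + 2 * (\<bar>\<gamma>\<bar> * (p \<bullet> p) - - (\<gamma> * (p \<bullet> p)))
          + (1 + 2 * \<bar>\<gamma>\<bar> + F0\<^sup>2 * (p \<bullet> p) + \<sigma>\<^sup>2 * DIM('a) * (p \<bullet> p))"
        unfolding C_def drift_def inner_diff_right inner_scaleR_right by (simp add: algebra_simps)
      ultimately show ?thesis by simp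
    qed
    ultimately show ?thesis by (intro exI conjI) auto
  qed
  define \<epsilon> where "\<epsilon> = (u (T, q1, p1) - m) / (2 * (1 + \<psi> (T, q1, p1)))"
  have "\<psi> (T, q1, p1) \<ge> 0" using psi_pos T q1 by (simp add: Dom_def)
  then have \<epsilon>: "\<epsilon> > 0" using gt by (simp add: \<epsilon>_def)
  define w where "w = (\<lambda>x. u x - \<epsilon> * \<psi> x)"
  have w1: "w (T, q1, p1) > m"
  proof -
    have "\<epsilon> * \<psi> (T, q1, p1) < \<epsilon> * (2 * (1 + \<psi> (T, q1, p1)))"
      using \<epsilon> \<open>\<psi> (T, q1, p1) \<ge> 0\<close> by (intro mult_strict_left_mono) auto
    also have "\<dots> = u (T, q1, p1) - m" using \<open>\<psi> (T, q1, p1) \<ge> 0\<close> by (simp add: \<epsilon>_def)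
    finally show ?thesis by (simp add: w_def)
  qed
  define R where "R = sqrt ((\<bar>B\<bar> + \<bar>m\<bar>) / \<epsilon>)"
  define K where "K = {0..T} \<times> closure \<O> \<times> cball (0::'a) R"
  have K: "compact K" using bdd by (auto simp: K_def compact_closure intro!: compact_Times)
  have "C \<ge> 0" by (simp add: C_def)
  have inK: "x \<in> K" if x: "x \<in> Dom" "fst x \<le> T" and wx: "w x > m" for x
  proof -
    obtain t q p where xx: "x = (t, q, p)" by (cases x) auto
    have tq: "t > 0" "q \<in> \<O>" using x by (auto simp: xx Dom_def)
    have "1 * (1 + p \<bullet> p) \<le> exp (C * t) * (1 + p \<bullet> p)"
      using tq \<open>C \<ge> 0\<close> by (intro mult_right_mono) auto
    then have "p \<bullet> p \<le> \<psi> x" using tq by (simp add: \<psi>_def xx)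
    then have "\<epsilon> * (p \<bullet> p) \<le> \<epsilon> * \<psi> x" using \<epsilon> by simp
    then have "\<epsilon> * (p \<bullet> p) \<le> \<bar>B\<bar> + \<bar>m\<bar>" using wx uB[OF tq, of p] by (simp add: w_def xx)
    then have "(norm p)\<^sup>2 \<le> (\<bar>B\<bar> + \<bar>m\<bar>) / \<epsilon>"
      using \<epsilon> by (simp add: power2_norm_eq_inner field_simps)
    then have "norm p \<le> R" unfolding R_def by (rule real_le_rsqrt)
    then show ?thesis using x tq closure_subset[of \<O>] by (auto simp: K_def xx)
  qed
  have uB': "u x \<le> B" if "x \<in> Dom" for x using that uB by (auto simp: Dom_def)
  \<comment> \<open>Where w exceeds m the penalty bounds the velocity by R, so S lies in the compact
    set K.\<close>
  define S where "S = {x \<in> Dom. fst x \<le> T \<and> w x > m}"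
  have "(T, q1, p1) \<in> S" using T q1 w1 by (simp add: S_def Dom_def)
  moreover have "S \<subseteq> K" using inK by (auto simp: S_def)
  moreover have "w x \<le> B" if "x \<in> S" for x
    using uB'[of x] psi_pos[of x] that \<epsilon> by (auto simp: S_def w_def intro: order_trans[of _ "u x"])
  ultimately obtain y z s where y: "\<And>n. y n \<in> S" "y \<longlonglongrightarrow> z" "z \<in> K" "(\<lambda>n. w (y n)) \<longlonglongrightarrow> s"
    and sup: "\<And>x. x \<in> S \<Longrightarrow> w x \<le> s"
    using convergent_maximizing_sequence[of S K w B] K by blast
  have "s > m" using sup[OF \<open>(T, q1, p1) \<in> S\<close>] w1 by simp
  have sup': "w x \<le> s" if "x \<in> Dom" "fst x \<le> T" for x
    using that sup[of x] \<open>s > m\<close> by (cases "w x > m") (auto simp: S_def)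
  have "z \<in> singular_boundary \<O>"
  proof (rule maximizing_limit_singular[where N = UNIV and \<Psi> = "\<lambda>x. \<epsilon> * \<psi> x" and y = y and s = s and T = T and m = m])
    show "\<exists>l>0. has_kinetic_value \<sigma> (drift q p) (\<lambda>x. \<epsilon> * \<psi> x) t q p l"
      if "(t, q, p) \<in> UNIV \<inter> ({0<..} \<times> \<O> \<times> UNIV)" for t q p
    proof -
      have "q \<in> \<O>" using that by simp
      obtain l where "l \<ge> 1" "has_kinetic_value \<sigma> (drift q p) \<psi> t q p l"
        using psi_kv[OF \<open>q \<in> \<O>\<close>] by blast
      then show ?thesis using has_kinetic_value_cmult \<epsilon> by (intro exI[of _ "\<epsilon> * l"]) auto
    qed
    show "y n \<in> UNIV \<inter> ({0<..} \<times> \<O> \<times> UNIV)" for n using y(1)[of n] by (auto simp: S_def Dom_def)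
    show "fst (y n) \<le> T" for n using y(1)[of n] by (auto simp: S_def)
    show "u x - \<epsilon> * \<psi> x \<le> s" if "x \<in> UNIV \<inter> ({0<..} \<times> \<O> \<times> UNIV)" "fst x \<le> T" for x
      using sup'[of x] that by (simp add: Dom_def w_def)
    show "\<epsilon> * \<psi> x \<ge> 0" if "x \<in> UNIV \<inter> ({0<..} \<times> \<O> \<times> UNIV)" for x
      using psi_pos[of x] that \<epsilon> by (simp add: Dom_def)
    show "continuous_on (UNIV \<inter> ({0<..} \<times> \<O> \<times> UNIV)) (\<lambda>x. \<epsilon> * \<psi> x)"
      by (intro continuous_intros psi_cont)
    show "(\<lambda>n. u (y n) - \<epsilon> * \<psi> (y n)) \<longlonglongrightarrow> s" using y(4) by (simp add: w_def)
  qed (use cont bdry y \<open>s > m\<close> in \<open>auto simp: G_def\<close>)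
  from local_barrier[OF dom bdd this] obtain r0 where r0: "r0 > 0" and
    bar0: "\<And>y \<eta>. y \<in> ball z r0 \<inter> Dom \<Longrightarrow> \<eta> > 0 \<Longrightarrow> \<exists>V. V y \<le> \<eta> \<and> continuous_on (ball z r0 \<inter> Dom) V \<and>
    (\<forall>t q p. (t, q, p) \<in> ball z r0 \<inter> Dom \<longrightarrow> V (t, q, p) \<ge> 0 \<and>
      (\<exists>l\<ge>0. has_kinetic_value \<sigma> (drift q p) V t q p l)) \<and>
    (\<forall>z\<in>ball z r0 \<inter> singular_boundary \<O>. \<forall>\<^sub>F x in at z within Dom. V x \<ge> 1)"
    unfolding Dom_def by blast
  define r where "r = min r0 1"
  have r: "r > 0" "r \<le> r0" "r \<le> 1" using r0 by (auto simp: r_def)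
  obtain t0 q0 p0 where zz: "z = (t0, q0, p0)" by (cases z) auto
  define d where "d = (\<lambda>(t, q, p). (t - t0)\<^sup>2 + (q - q0) \<bullet> (q - q0) + (p - p0) \<bullet> (p - p0))"
  have d: "d x = (dist x z)\<^sup>2" for x
    by (cases x) (auto simp: d_def zz dist_Pair_Pair dist_norm power2_norm_eq_inner power2_eq_square[of "_ - t0"])
  have d_cont: "continuous_on A d" for A unfolding d by (intro continuous_intros)
  define P0 where "P0 = norm p0 + 1"
  define C1 where "C1 = 2 + 2 * P0 + 2 * (F0 + \<bar>\<gamma>\<bar> * P0) + \<sigma>\<^sup>2 * DIM('a)"
  have "P0 \<ge> 0" by (simp add: P0_def)
  then have "C1 > 0" using F0(1) unfolding C1_def by (intro add_pos_nonneg add_nonneg_nonneg mult_nonneg_nonneg) auto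
  have d_kv: "\<exists>l\<ge>- C1. has_kinetic_value \<sigma> (drift q p) d t q p l"
    if x: "(t, q, p) \<in> ball z r" and q: "q \<in> \<O>" for t q p
  proof -
    have dz: "dist (t, q, p) z < 1" using x r by (simp add: dist_commute)
    have 1: "\<bar>t - t0\<bar> \<le> 1" "norm (q - q0) \<le> 1" "norm (p - p0) \<le> 1"
      using dz dist_fst_le[of "(t, q, p)" z] dist_snd_le[of "(t, q, p)" z]
        dist_fst_le[of "(q, p)" "(q0, p0)"] dist_snd_le[of "(q, p)" "(q0, p0)"]
      by (simp_all add: zz dist_norm)
    have pP: "norm p \<le> P0" using 1(3) norm_triangle_sub[of p p0] by (simp add: P0_def)
    have "norm (drift q p) \<le> F0 + \<bar>\<gamma>\<bar> * P0"
      by (rule order_trans[OF drift[OF q]]) (simp add: mult_left_mono pP)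
    then have "(p - p0) \<bullet> drift q p \<le> 1 * (F0 + \<bar>\<gamma>\<bar> * P0)"
      using 1(3) by (intro order_trans[OF norm_cauchy_schwarz] mult_mono) auto
    moreover have "(q - q0) \<bullet> p \<le> 1 * P0"
      using 1(2) pP by (intro order_trans[OF norm_cauchy_schwarz] mult_mono) auto
    ultimately have "- C1 \<le> 2 * (t - t0) - 2 * ((q - q0) \<bullet> p) - 2 * ((p - p0) \<bullet> drift q p) - \<sigma>\<^sup>2 * DIM('a)"
      using 1(1) unfolding C1_def by (simp add: abs_le_iff)
    then show ?thesis using dist_kinetic_value unfolding d_def by blast
  qed
  \<comment> \<open>The first bound lets the possibly negative value of \<open>\<theta> * d\<close>
    consume at most half of \<open>\<epsilon>\<close>; the second makes
    \<open>\<theta> * r\<^sup>2\<close> fit into the gap s - m.\<close>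
  define \<theta> where "\<theta> = min (\<epsilon> / (2 * C1)) ((s - m) / r\<^sup>2)"
  have \<theta>: "\<theta> > 0" "\<theta> * C1 \<le> \<epsilon> / 2" "\<theta> * r\<^sup>2 \<le> s - m"
  proof -
    show "\<theta> > 0" using \<epsilon> \<open>C1 > 0\<close> \<open>s > m\<close> r by (simp add: \<theta>_def)
    have "\<theta> * C1 \<le> \<epsilon> / (2 * C1) * C1" using \<open>C1 > 0\<close> by (intro mult_right_mono) (auto simp: \<theta>_def)
    then show "\<theta> * C1 \<le> \<epsilon> / 2" using \<open>C1 > 0\<close> by simp
    have "\<theta> * r\<^sup>2 \<le> (s - m) / r\<^sup>2 * r\<^sup>2" by (intro mult_right_mono) (auto simp: \<theta>_def)
    then show "\<theta> * r\<^sup>2 \<le> s - m" using r by simp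
  qed
  \<comment> \<open>At x0 each of the three losses, in w, through \<open>\<theta> * d\<close> and
    through \<open>A * V\<close>, is at most e, so values above s - 3 e occur. Such values force
    \<open>\<theta> * d \<le> 3 * e\<close>, while \<open>\<theta> * r\<^sup>2 = 4 * e\<close>: they
    stay away from the edge of the ball.\<close>
  define e where "e = \<theta> * r\<^sup>2 / 4"
  have e: "e > 0" using \<theta> r by (simp add: e_def)
  have "\<forall>\<^sub>F n in sequentially. w (y n) > s - e" using y(4) e by (intro order_tendstoD) auto
  moreover have "\<forall>\<^sub>F n in sequentially. dist (y n) z < r / 2" using y(2) r by (intro tendstoD) auto
  ultimately have "\<forall>\<^sub>F n in sequentially. w (y n) > s - e \<and> dist (y n) z < r / 2" by (rule eventually_conj)
  then obtain x0 where x0: "x0 \<in> Dom" "fst x0 \<le> T" "w x0 > s - e" "dist x0 z < r / 2"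
    using y(1) unfolding eventually_sequentially S_def by blast
  have "d x0 \<le> (r / 2)\<^sup>2" unfolding d using x0(4) by (intro power_mono) auto
  then have "\<theta> * d x0 \<le> \<theta> * (r / 2)\<^sup>2" using \<theta> by simp
  then have dx0: "\<theta> * d x0 \<le> e" by (simp add: e_def power_divide)
  define A where "A = s - m"
  have A: "A > 0" using \<open>s > m\<close> by (simp add: A_def)
  have "x0 \<in> ball z r0 \<inter> Dom" using x0 r by (simp add: dist_commute)
  from bar0[OF this, of "e / A"] e A obtain V where V: "V x0 \<le> e / A" "continuous_on (ball z r0 \<inter> Dom) V"
    "\<And>t q p. (t, q, p) \<in> ball z r0 \<inter> Dom \<Longrightarrow> V (t, q, p) \<ge> 0"
    "\<And>t q p. (t, q, p) \<in> ball z r0 \<inter> Dom \<Longrightarrow> \<exists>l\<ge>0. has_kinetic_value \<sigma> (drift q p) V t q p l"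
    "\<And>z'. z' \<in> ball z r0 \<inter> singular_boundary \<O> \<Longrightarrow> \<forall>\<^sub>F x in at z' within Dom. V x \<ge> 1"
    by (smt (verit) divide_pos_pos)
  have br: "x \<in> ball z r0" if "x \<in> ball z r" for x using that r by simp
  have V0: "V x \<ge> 0" if "x \<in> ball z r \<inter> Dom" for x
    using V(3)[of "fst x" "fst (snd x)" "snd (snd x)"] that br by simp
  define \<Psi> where "\<Psi> = (\<lambda>x. \<epsilon> * \<psi> x + (\<theta> * d x + A * V x))"
  have d0: "d x \<ge> 0" for x by (simp add: d)
  have fle: "u x - \<Psi> x \<le> w x - \<theta> * d x" "u x - \<Psi> x \<le> w x - A * V x" if "x \<in> ball z r \<inter> Dom" for x
    using V0[OF that] d0[of x] A \<theta> by (simp_all add: \<Psi>_def w_def)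
  define S2 where "S2 = {x \<in> ball z r \<inter> Dom. fst x \<le> T \<and> u x - \<Psi> x > s - 3 * e}"
  have c2: "s - 3 * e \<ge> m" using \<theta>(3) e by (simp add: e_def)
  have "A * V x0 \<le> e" using V(1) A by (simp add: field_simps)
  then have x0S: "x0 \<in> S2" using x0 dx0 r by (simp add: S2_def \<Psi>_def w_def dist_commute)
  then have "S2 \<noteq> {}" by blast
  have "S2 \<subseteq> K"
  proof
    fix x assume x: "x \<in> S2"
    then have "x \<in> ball z r \<inter> Dom" "fst x \<le> T" "u x - \<Psi> x > m" using c2 by (auto simp: S2_def)
    then show "x \<in> K" using fle(1)[of x] d0[of x] \<theta> by (intro inK) (auto simp: mult_nonneg_nonneg intro: less_le_trans)
  qed
  have S2s: "u x - \<Psi> x \<le> s" if "x \<in> S2" for x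
  proof -
    have x: "x \<in> ball z r \<inter> Dom" "fst x \<le> T" using that by (auto simp: S2_def)
    have "\<theta> * d x \<ge> 0" using d0[of x] \<theta> by simp
    then show ?thesis using fle(1)[OF x(1)] sup'[of x] x by auto
  qed
  obtain y' z' s' where y': "\<And>n. y' n \<in> S2" "y' \<longlonglongrightarrow> z'" "z' \<in> K" "(\<lambda>n. u (y' n) - \<Psi> (y' n)) \<longlonglongrightarrow> s'"
    and sup2: "\<And>x. x \<in> S2 \<Longrightarrow> u x - \<Psi> x \<le> s'"
    by (rule convergent_maximizing_sequence[where f = "\<lambda>x. u x - \<Psi> x", OF \<open>S2 \<noteq> {}\<close> \<open>S2 \<subseteq> K\<close> K S2s], assumption)
       (rule that)
  have s': "s' > s - 3 * e" using sup2[OF x0S] x0S by (simp add: S2_def)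
  have y'in: "y' n \<in> ball z r \<inter> Dom" "fst (y' n) \<le> T" for n using y'(1)[of n] by (auto simp: S2_def)
  have "d (y' n) \<le> 3 * r\<^sup>2 / 4" for n
  proof -
    have "s - 3 * e < u (y' n) - \<Psi> (y' n)" using y'(1)[of n] by (simp add: S2_def)
    also have "\<dots> \<le> w (y' n) - \<theta> * d (y' n)" by (rule fle(1)[OF y'in(1)])
    also have "\<dots> \<le> s - \<theta> * d (y' n)" using sup'[of "y' n"] y'in[of n] by simp
    finally have "\<theta> * d (y' n) \<le> \<theta> * (3 * r\<^sup>2 / 4)" by (simp add: e_def)
    then show ?thesis using \<theta>(1) by simp
  qed
  moreover have "(\<lambda>n. d (y' n)) \<longlonglongrightarrow> d z'"
    by (rule continuous_on_tendsto_compose[OF d_cont y'(2), of UNIV]) auto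
  ultimately have "d z' \<le> 3 * r\<^sup>2 / 4" by (intro LIMSEQ_le_const2) auto
  also have "\<dots> < r\<^sup>2" using r by simp
  finally have z'r: "z' \<in> ball z r" using r unfolding d by (simp add: dist_commute power2_less_imp_less)
  have "z' \<in> singular_boundary \<O>"
  proof (rule maximizing_limit_singular[where N = "ball z r" and \<Psi> = \<Psi> and y = y' and s = s' and T = T and m = m])
    show "\<exists>l>0. has_kinetic_value \<sigma> (drift q p) \<Psi> t q p l"
      if "(t, q, p) \<in> ball z r \<inter> ({0<..} \<times> \<O> \<times> UNIV)" for t q p
    proof -
      have q: "q \<in> \<O>" and x: "(t, q, p) \<in> ball z r" using that by auto
      have xD: "(t, q, p) \<in> ball z r0 \<inter> Dom" using that br[OF x] by (simp add: Dom_def)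
      obtain l1 l2 l3 where l: "l1 \<ge> 1" "has_kinetic_value \<sigma> (drift q p) \<psi> t q p l1"
        "l2 \<ge> - C1" "has_kinetic_value \<sigma> (drift q p) d t q p l2"
        "l3 \<ge> 0" "has_kinetic_value \<sigma> (drift q p) V t q p l3"
        using psi_kv[OF q, of p t] d_kv[OF x q] V(4)[OF xD] by blast
      have "has_kinetic_value \<sigma> (drift q p) \<Psi> t q p (\<epsilon> * l1 + (\<theta> * l2 + A * l3))"
        unfolding \<Psi>_def by (intro has_kinetic_value_add has_kinetic_value_cmult l)
      moreover have "\<epsilon> * l1 + (\<theta> * l2 + A * l3) > 0"
      proof -
        have "\<epsilon> * 1 \<le> \<epsilon> * l1" using \<epsilon> l(1) by (intro mult_left_mono) auto
        moreover have "\<theta> * (- C1) \<le> \<theta> * l2" using \<theta> l(3) by (intro mult_left_mono) auto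
        moreover have "A * l3 \<ge> 0" using A l(5) by simp
        ultimately show ?thesis using \<theta>(2) \<epsilon> by linarith
      qed
      ultimately show ?thesis by blast
    qed
    show "y' n \<in> ball z r \<inter> ({0<..} \<times> \<O> \<times> UNIV)" for n using y'in(1)[of n] by (simp add: Dom_def)
    show "u x - \<Psi> x \<le> s'" if "x \<in> ball z r \<inter> ({0<..} \<times> \<O> \<times> UNIV)" "fst x \<le> T" for x
      using sup2[of x] s' that by (cases "x \<in> S2") (auto simp: S2_def Dom_def)
    show "\<Psi> x \<ge> 0" if "x \<in> ball z r \<inter> ({0<..} \<times> \<O> \<times> UNIV)" for x
      using psi_pos[of x] V0[of x] d0[of x] that \<epsilon> \<theta> A by (simp add: \<Psi>_def Dom_def)
    show "continuous_on (ball z r \<inter> ({0<..} \<times> \<O> \<times> UNIV)) \<Psi>"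
      unfolding \<Psi>_def using br
      by (intro continuous_intros psi_cont d_cont continuous_on_subset[OF V(2)]) (auto simp: Dom_def)
  qed (use cont bdry y' y'in s' c2 z'r in \<open>auto simp: G_def\<close>)
  \<comment> \<open>The bound on V holds along the punctured filter at z'; as z' lies outside Dom,
    the sequence never takes the value z'.\<close>
  moreover from this have "z' \<notin> Dom"
    using open_O by (auto simp: singular_boundary_def Dom_def frontier_def interior_open)
  ultimately have "filterlim y' (at z' within Dom) sequentially"
    using y'(2) y'in by (auto simp: filterlim_at intro!: always_eventually)
  moreover have "\<forall>\<^sub>F x in at z' within Dom. V x \<ge> 1"
    using V(5) \<open>z' \<in> singular_boundary \<O>\<close> br[OF z'r] by blast
  ultimately have "\<forall>\<^sub>F n in sequentially. V (y' n) \<ge> 1" by (rule eventually_compose_filterlim[rotated])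
  then obtain n where n: "V (y' n) \<ge> 1" unfolding eventually_sequentially by blast
  have "s - 3 * e < u (y' n) - \<Psi> (y' n)" using y'(1)[of n] by (simp add: S2_def)
  also have "\<dots> \<le> w (y' n) - A * V (y' n)" by (rule fle(2)[OF y'in(1)])
  also have "\<dots> \<le> s - A * 1"
    using sup'[of "y' n"] y'in[of n] A n by (intro diff_mono mult_left_mono) auto
  finally show False using c2 by (simp add: A_def)
qed

end

section \<open>Equality of the suprema and the theorem\<close>

text \<open>One inequality is the weak principle at each interior point. For the other, the initial
  and outgoing points are limits of interior points and lie in G, where u is continuous. Boundedness
  makes both suprema genuine.\<close>

lemma (in kinetic_subsolution) Sup_eq_Sup_boundary:
  defines "G \<equiv> {0..} \<times> (\<O> \<times> UNIV \<union> Gamma_plus \<O>) - {0} \<times> Gamma_plus \<O>"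
  assumes dom: "C2_domain \<O>" and bdd: "bounded \<O>" and cont: "continuous_on G u" and bu: "bounded (u ` G)"
  shows "(SUP z\<in>{0<..} \<times> (\<O> \<times> UNIV). u z) = (SUP z\<in>{0} \<times> (\<O> \<times> UNIV) \<union> {0<..} \<times> Gamma_plus \<O>. u z)"
    (is "Sup (u ` ?D) = Sup (u ` ?\<Gamma>)")
proof (cases "\<O> = {}")
  case True
  \<comment> \<open>Both sides are then \<open>Sup {}\<close>, whatever its value.\<close>
  then show ?thesis by (simp add: Gamma_plus_def)
next
  case False
  have dis: "q \<notin> \<O>" if "(q, p) \<in> Gamma_plus \<O>" for q p
    using that open_O by (auto simp: Gamma_plus_def frontier_def interior_open)
  have DG: "?D \<subseteq> G" and BG: "?\<Gamma> \<subseteq> G" using dis by (auto simp: G_def)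
  obtain B where B: "\<And>z. z \<in> G \<Longrightarrow> \<bar>u z\<bar> \<le> B"
    using bu unfolding bounded_iff by auto
  have uB: "u z \<le> B" if "z \<in> G" for z using B[OF that] by (simp add: abs_le_iff)
  have bdd_D: "bdd_above (u ` ?D)" and bdd_B: "bdd_above (u ` ?\<Gamma>)"
    by (rule bdd_aboveI2[where M = B], use uB DG BG in blast)+
  have ne: "?D \<noteq> {}" "?\<Gamma> \<noteq> {}" using False by (auto intro!: exI[of _ 1])
  show ?thesis
  proof (rule antisym)
    show "Sup (u ` ?D) \<le> Sup (u ` ?\<Gamma>)"
    proof (rule cSUP_least[OF ne(1)])
      fix z assume "z \<in> ?D"
      then obtain t q p where z: "z = (t, q, p)" "t > 0" "q \<in> \<O>" by auto
      have "u (t, q, p) \<le> Sup (u ` ?\<Gamma>)"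
      proof (rule weak_maximum_principle[OF dom bdd _ _ _ z(2,3)])
        show "continuous_on ({0..} \<times> (\<O> \<times> UNIV \<union> Gamma_plus \<O>) - {0} \<times> Gamma_plus \<O>) u"
          using cont by (simp add: G_def)
        show "u (t, q, p) \<le> B" if "t > 0" "q \<in> \<O>" for t q p
          using that DG by (intro uB) auto
        show "u z \<le> Sup (u ` ?\<Gamma>)" if "z \<in> ?\<Gamma>" for z
          using cSUP_upper[OF that bdd_B] .
      qed
      then show "u z \<le> Sup (u ` ?\<Gamma>)" by (simp add: z)
    qed
    show "Sup (u ` ?\<Gamma>) \<le> Sup (u ` ?D)"
    proof (rule cSUP_least[OF ne(2)])
      fix z assume z: "z \<in> ?\<Gamma>"
      have "z \<in> closure ?D"
      proof -
        have "fst z \<in> closure {0<..}" "fst (snd z) \<in> closure \<O>"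
          using z closure_subset[of \<O>] by (auto simp: Gamma_plus_def frontier_def)
        then show ?thesis by (cases z) (auto simp: closure_Times)
      qed
      then obtain y where y: "\<And>n. y n \<in> ?D" "y \<longlonglongrightarrow> z"
        unfolding closure_sequential by blast
      have "(\<lambda>n. u (y n)) \<longlonglongrightarrow> u z"
        using z BG DG y by (intro continuous_on_tendsto_compose[OF cont y(2)]) (blast, auto intro!: always_eventually)
      moreover have "u (y n) \<le> Sup (u ` ?D)" for n
        using cSUP_upper[OF y(1) bdd_D] .
      ultimately show "u z \<le> Sup (u ` ?D)" by (intro LIMSEQ_le_const2) auto
    qed
  qed
qed

theorem theorem2p14:
  fixes F :: "real ^ 'd \<Rightarrow> real ^ 'd"
    and \<gamma> \<sigma> :: real
    and \<O> :: "(real ^ 'd) set"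
    and u :: "real \<times> (real ^ 'd) \<times> (real ^ 'd) \<Rightarrow> real"
  assumes "\<sigma> > 0"
    and "C_infinity_on F UNIV"
    and "bounded \<O>" and "connected \<O>" and "C2_domain \<O>"
    and "C_1_2_on u ({0<..} \<times> (\<O> \<times> UNIV))"
    and "\<And>t x. t > 0 \<Longrightarrow> x \<in> \<O> \<times> UNIV \<Longrightarrow>
           time_deriv u (t, x) - kinetic_operator F \<gamma> \<sigma> (\<lambda>y. u (t, y)) x \<le> 0"
  shows "(continuous_on ({0..} \<times> (\<O> \<times> UNIV \<union> Gamma_plus \<O>) - {0} \<times> Gamma_plus \<O>) u \<and>
          bounded (u ` ({0..} \<times> (\<O> \<times> UNIV \<union> Gamma_plus \<O>) - {0} \<times> Gamma_plus \<O>)) \<longrightarrow>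
            (SUP z\<in>{0<..} \<times> (\<O> \<times> UNIV). u z)
            = (SUP z\<in>{0} \<times> (\<O> \<times> UNIV) \<union> {0<..} \<times> Gamma_plus \<O>. u z))
       \<and>
         (\<forall>t\<^sub>0 x\<^sub>0. t\<^sub>0 > 0 \<and> x\<^sub>0 \<in> \<O> \<times> UNIV \<and>
            (\<forall>z\<in>{0<..} \<times> (\<O> \<times> UNIV). u z \<le> u (t\<^sub>0, x\<^sub>0)) \<longrightarrow>
            (\<forall>t x. 0 < t \<and> t \<le> t\<^sub>0 \<and> x \<in> \<O> \<times> UNIV \<longrightarrow> u (t, x) = u (t\<^sub>0, x\<^sub>0)))"
proof -
  have "C_k_on 0 F UNIV" using assms(2) unfolding C_infinity_on_def by blast
  then interpret kinetic_subsolution F \<gamma> \<sigma> \<O> u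
    using assms by unfold_locales (auto simp: C2_domain_def)
  show ?thesis
  proof (intro conjI impI allI)
    fix t0 t :: real and x0 x :: "(real ^ 'd) \<times> (real ^ 'd)"
    assume max: "t0 > 0 \<and> x0 \<in> \<O> \<times> UNIV \<and> (\<forall>z\<in>{0<..} \<times> (\<O> \<times> UNIV). u z \<le> u (t0, x0))"
      and t: "0 < t \<and> t \<le> t0 \<and> x \<in> \<O> \<times> UNIV"
    then have "u (t, fst x, snd x) = u (t0, fst x0, snd x0)"
      by (intro strong_maximum_principle[OF assms(4)]) auto
    then show "u (t, x) = u (t0, x0)" by simp
  qed (use Sup_eq_Sup_boundary[OF assms(5,3)] in blast)
qed

end
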